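(* Let $\eta$ have state space $\{0,1\}$, let $\varepsilon\in\mathbb R$, let $X_t(\varepsilon)$ and $\theta_a(\varepsilon)$ be real-valued, and let $\theta_0(0)=\theta_1(0)=0$. Assume: (1) $Z$ is independent of $\eta$, the $Z_t$ are i.i.d., and for each $\vartheta\in\Theta$, $t\in\mathbb Z$, $\varphi(Z_t,\vartheta)$ has a density $f(x,\vartheta)$; (2) $\eta$ is a Markov chain and there is $\phi_*>0$ such that $\Pr\{\eta_t=b\mid\eta_s=a\}\ge\phi_*$ for all $a,b\in\{0,1\}$ and $s,t\in\mathbb Z$ with $|s-t|\ge1$; (3) for each $z\in\mathcal Z$, $a,b\in\{0,1\}$, $0<f(\varphi(z,\theta_a(\varepsilon)),\theta_b(\varepsilon))<\infty$ and this is continuous in $\varepsilon$; (4) there is an integer $q\ge2$ such that for each $z\in\mathcal Z$, $a,b\in\{0,1\}$, $f(\varphi(z,\theta_a(\varepsilon)),\theta_b(\varepsilon))$ as a function of $\varepsilon$ belongs to $C^{(q)}$ and all its derivatives of order $\le q$ are continuous in $(z,\varepsilon)$; furthermore, for any $r>0$, $\mathsf E[M_q(Z_0,r)^k]<\infty$, where $k=q^2(q+1)/2$; (5) $\lambda(x,\vartheta)=\ln f(x,\vartheta)\in C^{(2)}$, and $\varphi(z,v)$ as a function of $v$ belongs to $C^{(2)}$, such that for any $\vartheta$, $v$ and $\nu$ with $|\nu|\le2$, $\mathsf E[\lambda^{(\nu)}(\varphi(Z_t,v),\vartheta)]=(\mathsf E[\lambda(\varphi(Z_t,v),\vartheta)])^{(\nu)}$,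 where the differentiation is of functions of $(v,\vartheta)$ with respect to $v$ and $\vartheta$; (6) $\theta_a(\varepsilon)\in C^{(2)}$ for $a\in\{0,1\}$. Then $$\mathsf E[\mathsf r'(0)\mid\eta]=0,$$ $$\mathsf E[\mathsf r''(0)\mid\eta]=\operatorname{Var}[d_0'(0)]\sum_{t=1}^\infty D_{0t}\,[2\eta_t-P_{0t}(1,1)-P_{0t}(0,1)].$$ Moreover, for all $t$, $\mathsf E[d_t'(0)]=0$ and $\operatorname{Var}[d_t'(0)]=[\theta_1'(0)-\theta_0'(0)]^2J(0)$, where $J(\vartheta)$ is the Fisher information for the parametric family $f(x,\vartheta)$.
   Context: Model: $\eta=(\eta_t)_{t\in\mathbb Z}$ is a $\{0,1\}$-valued process; $Z=(Z_t)_{t\in\mathbb Z}$ takes values in a Euclidean space $\mathcal Z$; $\Theta\subset\mathbb R$ is open; $\varphi(\cdot,\vartheta):\mathcal Z\to\mathbb R$, $\vartheta\in\Theta$; $\theta_0,\theta_1:\mathbb R\to\Theta$; $X_t(\varepsilon)=\varphi(Z_t,\theta_{\eta_t}(\varepsilon))$. $C^{(q)}$ denotes functions all of whose (partial) derivatives of order $\le q$ exist and are continuous; $h^{(\nu)}$ is the partial derivative with multi-index $\nu$ and $|\nu|$ its order. Derivatives (primes) of random functions of $\varepsilon$ are taken in $\varepsilon$ with the realization of $(\eta,Z)$ fixed. With $\ell_{z,ab}(\varepsilon)=\ln f(\varphi(z,\theta_a(\varepsilon)),\theta_b(\varepsilon))$, $M_k(z,r)=\sup\{|\ell_{z,ab}^{(j)}(\varepsilon)|:1\le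 j\le k,\ |\varepsilon|\le r,\ a,b\in\{0,1\}\}$ for $k>0$. $P_{st}(a,b)=\Pr\{\eta_t=b\mid\eta_s=a\}$ and $D_{st}=P_{st}(1,1)-P_{st}(0,1)$. $\psi_t(\varepsilon,c)=f(\varphi(Z_t,\theta_{\eta_t}(\varepsilon)),\theta_c(\varepsilon))$ for $c\in\{0,1\}$ and $d_t(\varepsilon)=\ln\psi_t(\varepsilon,1)-\ln\psi_t(\varepsilon,0)$. Let $\sigma=(\sigma_t)$ be an independent copy of $\eta$, also independent of $Z$, and $\mathsf E_\sigma$ expectation with respect to $\sigma$ ($\eta,Z$ held fixed). Then $$\mathsf r(\varepsilon)=\lim_{n\to\infty}\ln\frac{\mathsf E_\sigma[\prod_{s=1}^n\psi_s(\varepsilon,\sigma_s)\mid\sigma_0=1]}{\mathsf E_\sigma[\prod_{s=1}^n\psi_s(\varepsilon,\sigma_s)\mid\sigma_0=0]}$$ (an almost sure limit, which exists). Fisher information: $J(\vartheta)=\int\bigl(\partial\lambda(x,\vartheta)/\partial\vartheta\bigr)^2f(x,\vartheta)\,dx$. *)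

theory Defs
  imports "HOL-Probability.Probability"
begin

subsection \<open>Partial derivatives and the classes \<open>C^(q)\<close>\<close>

definition partial_deriv :: "'a::euclidean_space \<Rightarrow> ('a \<Rightarrow> real) \<Rightarrow> 'a \<Rightarrow> real" where
  "partial_deriv b h x = deriv (\<lambda>s. h (x + s *\<^sub>R b)) 0"

text \<open>
  A multi-index is represented by the list of the coordinate directions in which one
  differentiates (the last one first); its order is the length of the list.
\<close>

definition partial_derivs :: "'a::euclidean_space list \<Rightarrow> ('a \<Rightarrow> real) \<Rightarrow> 'a \<Rightarrow> real" where
  "partial_derivs bs h = foldr partial_deriv bs h"

definition partials_exist :: "nat \<Rightarrow> 'a::euclidean_space set \<Rightarrow> ('a \<Rightarrow> real) \<Rightarrow> bool" where
  "partials_exist q S h \<longleftrightarrow>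
     (\<forall>bs b x. set bs \<subseteq> Basis \<and> length bs < q \<and> b \<in> Basis \<and> x \<in> S \<longrightarrow>
        (\<lambda>s. partial_derivs bs h (x + s *\<^sub>R b)) differentiable (at 0))"

text \<open>Meant for open \<open>S\<close>.\<close>

definition C_class :: "nat \<Rightarrow> 'a::euclidean_space set \<Rightarrow> ('a \<Rightarrow> real) \<Rightarrow> bool" where
  "C_class q S h \<longleftrightarrow>
     partials_exist q S h \<and>
     (\<forall>bs. set bs \<subseteq> Basis \<and> length bs \<le> q \<longrightarrow> continuous_on S (partial_derivs bs h))"

lemma partial_deriv_real: "partial_deriv (1::real) h = deriv h"
proof
  fix x :: real
  have "((\<lambda>s. h (x + s)) has_field_derivative D) (at 0) \<longleftrightarrow> (h has_field_derivative D) (at x)" for D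
    using DERIV_at_within_shift[of h D x 0 UNIV] by (simp add: add.commute)
  then show "partial_deriv 1 h x = deriv h x"
    by (simp add: partial_deriv_def deriv_def)
qed

lemma partial_derivs_real: "partial_derivs (replicate n (1::real)) h = (deriv ^^ n) h"
  by (induction n) (simp_all add: partial_derivs_def partial_deriv_real)


subsection \<open>Processes indexed by the integers\<close>

definition path_algebra :: "'w measure \<Rightarrow> 'b measure \<Rightarrow> (int \<Rightarrow> 'w \<Rightarrow> 'b) \<Rightarrow> 'w measure" where
  "path_algebra M N X = vimage_algebra (space M) (\<lambda>\<omega> t. X t \<omega>) (PiM UNIV (\<lambda>_. N))"

definition path_law :: "'w measure \<Rightarrow> 'b measure \<Rightarrow> (int \<Rightarrow> 'w \<Rightarrow> 'b) \<Rightarrow> (int \<Rightarrow> 'b) measure" where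
  "path_law M N X = distr M (PiM UNIV (\<lambda>_. N)) (\<lambda>\<omega> t. X t \<omega>)"

text \<open>A Markov chain on a countable state space, not assumed homogeneous or stationary.\<close>

definition markov_chain :: "'w measure \<Rightarrow> (int \<Rightarrow> 'w \<Rightarrow> 's) \<Rightarrow> bool" where
  "markov_chain M \<eta> \<longleftrightarrow>
     (\<forall>t n x b. \<P>(\<omega> in M. \<forall>s\<in>{t - int n..t}. \<eta> s \<omega> = x s) > 0 \<longrightarrow>
        \<P>(\<omega> in M. \<eta> (t + 1) \<omega> = b \<bar> \<forall>s\<in>{t - int n..t}. \<eta> s \<omega> = x s)
          = \<P>(\<omega> in M. \<eta> (t + 1) \<omega> = b \<bar> \<eta> t \<omega> = x t))"

text \<open>
  \<open>\<E>[Y | F] = g\<close> almost surely, for \<open>Y\<close> that is only almost surely defined (such as a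
  derivative which exists almost surely): the values of \<open>Y\<close> on a null set, where \<open>Y\<close> need not
  even be measurable, are disregarded. Integrability of \<open>Y\<close> is part of the assertion.
\<close>

definition has_cond_exp ::
  "'w measure \<Rightarrow> 'w measure \<Rightarrow> ('w \<Rightarrow> real) \<Rightarrow> ('w \<Rightarrow> real) \<Rightarrow> bool" where
  "has_cond_exp M F Y g \<longleftrightarrow>
     (\<exists>Y'. integrable M Y' \<and> (AE \<omega> in M. Y' \<omega> = Y \<omega>) \<and>
           (AE \<omega> in M. real_cond_exp M F Y' \<omega> = g \<omega>))"


subsection \<open>The model\<close>

text \<open>
  \<open>\<eta>\<close> is the \<open>{0,1}\<close>-valued process, \<open>Z\<close> the noise, \<open>f x \<tau>\<close> the density of \<open>\<phi> (Z t) \<tau>\<close>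
  and \<open>\<theta> a\<close>, for \<open>a \<in> {0,1}\<close>, the parameter in state \<open>a\<close> as a function of \<open>\<epsilon>\<close>.
\<close>

definition obs ::
  "('z \<Rightarrow> real \<Rightarrow> real) \<Rightarrow> (nat \<Rightarrow> real \<Rightarrow> real) \<Rightarrow> (int \<Rightarrow> 'w \<Rightarrow> nat) \<Rightarrow> (int \<Rightarrow> 'w \<Rightarrow> 'z)
     \<Rightarrow> int \<Rightarrow> real \<Rightarrow> 'w \<Rightarrow> real" where
  "obs \<phi> \<theta> \<eta> Z t \<epsilon> \<omega> = \<phi> (Z t \<omega>) (\<theta> (\<eta> t \<omega>) \<epsilon>)"

definition psi ::
  "(real \<Rightarrow> real \<Rightarrow> real) \<Rightarrow> ('z \<Rightarrow> real \<Rightarrow> real) \<Rightarrow> (nat \<Rightarrow> real \<Rightarrow> real) \<Rightarrow> (int \<Rightarrow> 'w \<Rightarrow> nat)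
     \<Rightarrow> (int \<Rightarrow> 'w \<Rightarrow> 'z) \<Rightarrow> int \<Rightarrow> real \<Rightarrow> nat \<Rightarrow> 'w \<Rightarrow> real" where
  "psi f \<phi> \<theta> \<eta> Z t \<epsilon> c \<omega> = f (obs \<phi> \<theta> \<eta> Z t \<epsilon> \<omega>) (\<theta> c \<epsilon>)"

definition log_lr ::
  "(real \<Rightarrow> real \<Rightarrow> real) \<Rightarrow> ('z \<Rightarrow> real \<Rightarrow> real) \<Rightarrow> (nat \<Rightarrow> real \<Rightarrow> real) \<Rightarrow> (int \<Rightarrow> 'w \<Rightarrow> nat)
     \<Rightarrow> (int \<Rightarrow> 'w \<Rightarrow> 'z) \<Rightarrow> int \<Rightarrow> real \<Rightarrow> 'w \<Rightarrow> real" where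
  "log_lr f \<phi> \<theta> \<eta> Z t \<epsilon> \<omega> = ln (psi f \<phi> \<theta> \<eta> Z t \<epsilon> 1 \<omega>) - ln (psi f \<phi> \<theta> \<eta> Z t \<epsilon> 0 \<omega>)"

definition ell ::
  "(real \<Rightarrow> real \<Rightarrow> real) \<Rightarrow> ('z \<Rightarrow> real \<Rightarrow> real) \<Rightarrow> (nat \<Rightarrow> real \<Rightarrow> real)
     \<Rightarrow> 'z \<Rightarrow> nat \<Rightarrow> nat \<Rightarrow> real \<Rightarrow> real" where
  "ell f \<phi> \<theta> z a b \<epsilon> = ln (f (\<phi> z (\<theta> a \<epsilon>)) (\<theta> b \<epsilon>))"

text \<open>
  The supremum is over a bounded set as soon as the \<open>ell f \<phi> \<theta> z a b\<close> are of class \<open>C^(k)\<close>.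
\<close>

definition M_sup ::
  "(real \<Rightarrow> real \<Rightarrow> real) \<Rightarrow> ('z \<Rightarrow> real \<Rightarrow> real) \<Rightarrow> (nat \<Rightarrow> real \<Rightarrow> real)
     \<Rightarrow> nat \<Rightarrow> 'z \<Rightarrow> real \<Rightarrow> real" where
  "M_sup f \<phi> \<theta> k z r =
     Sup {\<bar>(deriv ^^ j) (ell f \<phi> \<theta> z a b) \<epsilon>\<bar> | j \<epsilon> a b.
            1 \<le> j \<and> j \<le> k \<and> \<bar>\<epsilon>\<bar> \<le> r \<and> a \<in> {0, 1} \<and> b \<in> {0, 1}}"

definition trans_prob :: "'w measure \<Rightarrow> (int \<Rightarrow> 'w \<Rightarrow> nat) \<Rightarrow> int \<Rightarrow> int \<Rightarrow> nat \<Rightarrow> nat \<Rightarrow> real" where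
  "trans_prob M \<eta> s t a b = \<P>(\<omega> in M. \<eta> t \<omega> = b \<bar> \<eta> s \<omega> = a)"

definition trans_diff :: "'w measure \<Rightarrow> (int \<Rightarrow> 'w \<Rightarrow> nat) \<Rightarrow> int \<Rightarrow> int \<Rightarrow> real" where
  "trans_diff M \<eta> s t = trans_prob M \<eta> s t 1 1 - trans_prob M \<eta> s t 0 1"

text \<open>
  \<open>E\<^sub>\<sigma>[\<Prod>s=1..n. \<psi>\<^sub>s(\<epsilon>,\<sigma>\<^sub>s) | \<sigma>\<^sub>0 = a]\<close>. The independent copy \<open>\<sigma>\<close> of \<open>\<eta>\<close> is the coordinate process on
  the path space under the law of \<open>\<eta>\<close>, so that integrating over \<open>\<sigma>\<close> keeps \<open>\<omega>\<close>, that is the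
  realization of \<open>\<eta>\<close> and \<open>Z\<close>, fixed.
\<close>

definition sigma_exp ::
  "'w measure \<Rightarrow> (real \<Rightarrow> real \<Rightarrow> real) \<Rightarrow> ('z \<Rightarrow> real \<Rightarrow> real) \<Rightarrow> (nat \<Rightarrow> real \<Rightarrow> real)
     \<Rightarrow> (int \<Rightarrow> 'w \<Rightarrow> nat) \<Rightarrow> (int \<Rightarrow> 'w \<Rightarrow> 'z) \<Rightarrow> nat \<Rightarrow> real \<Rightarrow> nat \<Rightarrow> 'w \<Rightarrow> real" where
  "sigma_exp M f \<phi> \<theta> \<eta> Z n \<epsilon> a \<omega> =
     (let L = path_law M (count_space {0, 1}) \<eta> in
      \<integral>\<sigma>. (\<Prod>s=1..n. psi f \<phi> \<theta> \<eta> Z (int s) \<epsilon> (\<sigma> (int s)) \<omega>)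
         \<partial>(uniform_measure L {\<sigma> \<in> space L. \<sigma> 0 = a}))"

definition log_ratio ::
  "'w measure \<Rightarrow> (real \<Rightarrow> real \<Rightarrow> real) \<Rightarrow> ('z \<Rightarrow> real \<Rightarrow> real) \<Rightarrow> (nat \<Rightarrow> real \<Rightarrow> real)
     \<Rightarrow> (int \<Rightarrow> 'w \<Rightarrow> nat) \<Rightarrow> (int \<Rightarrow> 'w \<Rightarrow> 'z) \<Rightarrow> real \<Rightarrow> 'w \<Rightarrow> nat \<Rightarrow> real" where
  "log_ratio M f \<phi> \<theta> \<eta> Z \<epsilon> \<omega> n =
     ln (sigma_exp M f \<phi> \<theta> \<eta> Z n \<epsilon> 1 \<omega> / sigma_exp M f \<phi> \<theta> \<eta> Z n \<epsilon> 0 \<omega>)"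

definition r_lim ::
  "'w measure \<Rightarrow> (real \<Rightarrow> real \<Rightarrow> real) \<Rightarrow> ('z \<Rightarrow> real \<Rightarrow> real) \<Rightarrow> (nat \<Rightarrow> real \<Rightarrow> real)
     \<Rightarrow> (int \<Rightarrow> 'w \<Rightarrow> nat) \<Rightarrow> (int \<Rightarrow> 'w \<Rightarrow> 'z) \<Rightarrow> real \<Rightarrow> 'w \<Rightarrow> real" where
  "r_lim M f \<phi> \<theta> \<eta> Z \<epsilon> \<omega> = lim (log_ratio M f \<phi> \<theta> \<eta> Z \<epsilon> \<omega>)"

text \<open>
  A Bochner integral, hence \<open>0\<close> should the Fisher information be infinite.
\<close>

definition fisher_info :: "(real \<Rightarrow> real \<Rightarrow> real) \<Rightarrow> real \<Rightarrow> real" where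
  "fisher_info f \<tau> = (\<integral>x. (deriv (\<lambda>u. ln (f x u)) \<tau>)\<^sup>2 * f x \<tau> \<partial>lborel)"

end

theory Submission
  imports Defs
begin

text \<open>
  Conditioning on the first step of \<open>\<sigma>\<close> turns the log-likelihood ratio \<open>ln (E[.. | \<sigma>\<^sub>0 = 1] / E[.. | \<sigma>\<^sub>0 = 0])\<close>
  of the observations after time \<open>k\<close> into a backward recursion
  \<open>\<rho>\<^sub>k = g\<^sub>k (d\<^sub>k\<^sub>+\<^sub>1 + \<rho>\<^sub>k\<^sub>+\<^sub>1)\<close>, where \<open>g\<^sub>k\<close> is the difference of the logarithmic moment generating functions of two
  Bernoulli laws, with success probabilities \<open>P(1,1)\<close> and \<open>P(0,1)\<close> (\<open>ln_future_weight_ratio\<close>). The mixing condition keeps both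
  probabilities in \<open>[\<kappa>, 1 - \<kappa>]\<close>, so \<open>g\<^sub>k\<close> is bounded and contracts with the rate \<open>1 - \<kappa>\<^sup>2\<close>
  (\<open>tilt_diff_bound\<close>). The limit \<open>r\<close> therefore exists everywhere. Differentiating the recursion twice
  and comparing the horizons \<open>m\<close> and \<open>m + 1\<close> gives, uniformly for \<open>\<bar>\<epsilon>\<bar> < 1\<close>, differences of the values and of
  the first two derivatives of order \<open>m\<^sup>2 \<gamma>^m (1 + \<Sum>j\<le>m+1. \<mu> j)\<^sup>2\<close>, \<open>\<gamma> = 1 - \<kappa>\<^sup>2\<close>, where \<open>\<mu> j\<close> bounds the
  derivatives of \<open>d\<^sub>j\<close> (\<open>differences_bound\<close>). These bounds have summable expectations, since the
  moment condition makes the \<open>\<mu> j\<close> square integrable; so \<open>r\<close> is almost surely twice differentiable at \<open>0\<close>, and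
  conditional expectations of its derivatives are limits of those at finite horizons
  (\<open>\<Delta>_summable\<close>, \<open>has_cond_exp_limit\<close>).

  At \<open>\<epsilon> = 0\<close> all \<open>d\<^sub>t\<close> vanish and \<open>d\<^sub>t'(0) = (\<theta>\<^sub>1'(0) - \<theta>\<^sub>0'(0)) \<cdot> score\<close> does not depend on \<open>\<eta>\<close>, because the two
  densities in \<open>d\<^sub>t\<close> are evaluated at the same observation (\<open>llr1_zero\<close>). The moments of \<open>d\<^sub>t'(0)\<close> and \<open>d\<^sub>t''(0)\<close>
  come from the fact that \<open>exp d\<close> is the density of the law of \<open>X\<close> in state \<open>1\<close> with respect to the one in state \<open>0\<close>:
  \<open>E[U(d) | \<eta>\<^sub>t = 1] = E[exp(d) U(d) | \<eta>\<^sub>t = 0]\<close>. For \<open>U(w)\<close> equal to \<open>1 / (1 + exp w)\<close> and to its square both sides are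
  bounded functions of \<open>d\<close> with bounded derivatives, so the identity can be expanded to second order in \<open>\<epsilon>\<close>, with the result
  \<open>E d' = 0\<close> and \<open>E[d'' | \<eta>\<^sub>t] = (2 \<eta>\<^sub>t - 1) Var d'\<close> (\<open>llr_moments\<close>).

  At \<open>0\<close> the differentiated recursions are \<open>\<rho>\<^sub>k' = D (d' + \<rho>\<^sub>k\<^sub>+\<^sub>1')\<close> and
  \<open>\<rho>\<^sub>k'' = D (1 - s) (d' + \<rho>\<^sub>k\<^sub>+\<^sub>1')\<^sup>2 + D (d'' + \<rho>\<^sub>k\<^sub>+\<^sub>1'')\<close> with \<open>D = P(1,1) - P(0,1)\<close>, \<open>s = P(1,1) + P(0,1)\<close> for the
  step from \<open>k\<close> to \<open>k + 1\<close>. Hence \<open>\<rho>\<^sub>0'\<close> is the sum of \<open>D\<^sub>0\<^sub>t d\<^sub>t'\<close>, of conditional mean \<open>0\<close>. The \<open>d\<^sub>t'\<close> are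
  uncorrelated given \<open>\<eta>\<close>, and the Chapman-Kolmogorov recursion
  \<open>s\<^sub>k\<^sub>t = s\<^sub>k\<^sub>+\<^sub>1\<^sub>,\<^sub>t - (1 - s) D\<^sub>k\<^sub>+\<^sub>1\<^sub>,\<^sub>t\<close> absorbs exactly the quadratic term: by induction
  \<open>E[\<rho>\<^sub>k'' | \<eta>]\<close> is \<open>Var d'\<close> times the sum of \<open>D\<^sub>k\<^sub>t (2 \<eta>\<^sub>t - s\<^sub>k\<^sub>t)\<close> (\<open>R2_cond_mean\<close>).
\<close>

section \<open>Functions of one variable of class C^n\<close>

text \<open>
  Defined by recursion through the derivative, so that closure under products, reciprocals and
  logarithms is a plain induction on \<open>n\<close>; \<open>Ck_iff\<close> gives back the description by iterated derivatives.
\<close>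

primrec Ck :: "nat \<Rightarrow> (real \<Rightarrow> real) \<Rightarrow> bool" where
  "Ck 0 h \<longleftrightarrow> continuous_on UNIV h"
| "Ck (Suc n) h \<longleftrightarrow> (\<forall>x. h differentiable (at x)) \<and> Ck n (deriv h)"

lemma Ck_SucI:
  assumes "\<And>x. (h has_real_derivative h' x) (at x)" "Ck n h'"
  shows "Ck (Suc n) h"
proof -
  have "deriv h = h'" using assms(1) by (intro ext DERIV_imp_deriv)
  then show ?thesis using assms by (auto simp: real_differentiable_def)
qed

lemma Ck_SucD:
  assumes "Ck (Suc n) h"
  shows "(h has_real_derivative deriv h x) (at x)" "Ck n (deriv h)"
  using assms by (auto simp: DERIV_deriv_iff_real_differentiable)

lemma Ck_continuous: "Ck n h \<Longrightarrow> continuous_on UNIV h"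
  by (cases n) (auto simp: continuous_on_eq_continuous_at intro: differentiable_imp_continuous_within)

lemma Ck_Suc_imp: "Ck (Suc n) h \<Longrightarrow> Ck n h"
proof (induction n arbitrary: h)
  case 0 then show ?case using Ck_continuous[of "Suc 0" h] by simp
qed simp

lemma deriv_funpow_Suc: "(deriv ^^ Suc n) (h::real \<Rightarrow> real) = (deriv ^^ n) (deriv h)"
  by (simp only: funpow_Suc_right comp_def)

lemma Ck_iff:
  "Ck n h \<longleftrightarrow> (\<forall>j<n. \<forall>x. (deriv ^^ j) h differentiable (at x)) \<and> continuous_on UNIV ((deriv ^^ n) h)"
proof (induction n arbitrary: h)
  case (Suc n)
  have "(\<forall>j<Suc n. \<forall>x. (deriv ^^ j) h differentiable (at x)) \<longleftrightarrow>
    (\<forall>x. h differentiable (at x)) \<and> (\<forall>j<n. \<forall>x. (deriv ^^ j) (deriv h) differentiable (at x))"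
    unfolding All_less_Suc2 deriv_funpow_Suc by simp
  then show ?case unfolding Ck.simps Suc deriv_funpow_Suc by simp
qed simp

lemma Ck_mono: "Ck n h \<Longrightarrow> j \<le> n \<Longrightarrow> Ck j h"
  by (induction n) (auto simp: le_Suc_eq simp del: Ck.simps dest: Ck_Suc_imp)

lemma C_class_imp_Ck:
  assumes "C_class q UNIV h" shows "Ck q h"
proof -
  have *: "(deriv ^^ j) h differentiable (at x)" if "j < q" for j x
  proof -
    have "(\<lambda>s. partial_derivs (replicate j (1::real)) h (x + s *\<^sub>R 1)) differentiable (at 0)"
      using assms that unfolding C_class_def partials_exist_def
      by (elim conjE allE[of _ "replicate j 1"] allE[of _ "1::real"] allE[of _ x]) auto
    then have "(\<lambda>s. (deriv ^^ j) h (x + s)) differentiable (at 0)"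
      by (simp add: partial_derivs_real)
    then obtain D where "((\<lambda>s. (deriv ^^ j) h (x + s)) has_real_derivative D) (at 0)"
      by (auto simp: real_differentiable_def)
    then have "((deriv ^^ j) h has_real_derivative D) (at x)"
      using DERIV_at_within_shift[of "(deriv ^^ j) h" D x 0 UNIV] by (simp add: add.commute)
    then show ?thesis by (auto simp: real_differentiable_def)
  qed
  have "\<forall>bs. set bs \<subseteq> Basis \<and> length bs \<le> q \<longrightarrow> continuous_on UNIV (partial_derivs bs h)"
    using assms unfolding C_class_def by blast
  then have "continuous_on UNIV (partial_derivs (replicate q (1::real)) h)"
    by (elim allE[of _ "replicate q (1::real)"]) auto
  then show ?thesis using * unfolding Ck_iff by (auto simp: partial_derivs_real)
qed

lemma Ck_add: "Ck n g \<Longrightarrow> Ck n h \<Longrightarrow> Ck n (\<lambda>x. g x + h x)"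
proof (induction n arbitrary: g h)
  case (Suc n)
  note D = Ck_SucD[OF Suc.prems(1)] Ck_SucD[OF Suc.prems(2)]
  show ?case by (rule Ck_SucI[OF DERIV_add[OF D(1,3)] Suc.IH[OF D(2,4)]])
qed (auto intro: continuous_intros)

lemma Ck_mult: "Ck n g \<Longrightarrow> Ck n h \<Longrightarrow> Ck n (\<lambda>x. g x * h x)"
proof (induction n arbitrary: g h)
  case (Suc n)
  note D = Ck_SucD[OF Suc.prems(1)] Ck_SucD[OF Suc.prems(2)]
  note I = Suc.prems[THEN Ck_Suc_imp]
  show ?case by (rule Ck_SucI[OF DERIV_mult[OF D(1,3)] Ck_add[OF Suc.IH[OF D(2) I(2)] Suc.IH[OF D(4) I(1)]]])
qed (auto intro: continuous_intros)

lemma Ck_uminus: "Ck n h \<Longrightarrow> Ck n (\<lambda>x. - h x)"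
proof (induction n arbitrary: h)
  case (Suc n)
  note D = Ck_SucD[OF Suc.prems(1)]
  show ?case by (rule Ck_SucI[OF DERIV_minus[OF D(1)] Suc.IH[OF D(2)]])
qed (auto intro: continuous_intros)

text \<open>
  The derivative \<open>- (1/h) h' (1/h)\<close> is a product of functions that are one class lower.
\<close>

lemma Ck_inverse: "Ck n h \<Longrightarrow> (\<And>x. h x \<noteq> 0) \<Longrightarrow> Ck n (\<lambda>x. inverse (h x))"
proof (induction n)
  case (Suc n)
  note D = Ck_SucD[OF Suc.prems(1)]
  have I: "Ck n (\<lambda>x. inverse (h x))" by (rule Suc.IH[OF Suc.prems(1)[THEN Ck_Suc_imp] Suc.prems(2)])
  have "((\<lambda>x. inverse (h x)) has_real_derivative - (inverse (h x) * deriv h x * inverse (h x))) (at x)" for x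
    using DERIV_inverse'[OF D(1) Suc.prems(2)] .
  from Ck_SucI[OF this Ck_uminus[OF Ck_mult[OF Ck_mult[OF I D(2)] I]]] show ?case .
qed (auto intro: continuous_intros)

lemma Ck_ln:
  assumes "Ck n h" and pos: "\<And>x. h x > 0"
  shows "Ck n (\<lambda>x. ln (h x))"
proof (cases n)
  case 0
  have "h x \<noteq> 0" for x using pos[of x] by simp
  then show ?thesis using 0 assms(1) by (auto intro!: continuous_on_ln)
next
  case (Suc m)
  have ne: "h x \<noteq> 0" for x using pos[of x] by simp
  note D = Ck_SucD[OF assms(1)[unfolded Suc]]
  have "((\<lambda>x. ln (h x)) has_real_derivative inverse (h x) * deriv h x) (at x)" for x
    using DERIV_chain2[OF DERIV_ln[OF pos] D(1)] .
  from Ck_SucI[OF this Ck_mult[OF Ck_inverse[OF Ck_Suc_imp ne] D(2)]] assms(1)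
  show ?thesis unfolding Suc by blast
qed

section \<open>Contracting recursions with smooth data\<close>

text \<open>
  What the analysis of the backward recursion uses of its maps \<open>g k\<close>. The constants \<open>1\<close> in
  the last two bounds are those of the maps of a two-state chain.
\<close>

locale smooth_contraction =
  fixes g g1 g2 :: "nat \<Rightarrow> real \<Rightarrow> real" and B \<gamma> :: real
  assumes g_deriv: "(g k has_real_derivative g1 k x) (at x)"
    and g1_deriv: "(g1 k has_real_derivative g2 k x) (at x)"
    and g_bound: "\<bar>g k x\<bar> \<le> B"
    and g1_bound: "\<bar>g1 k x\<bar> \<le> \<gamma>"
    and g2_bound: "\<bar>g2 k x\<bar> \<le> 1"
    and g2_lipschitz: "\<bar>g2 k x - g2 k y\<bar> \<le> \<bar>x - y\<bar>"
    and gamma: "0 < \<gamma>" "\<gamma> < 1"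
begin

context
  fixes d d1 d2 :: "nat \<Rightarrow> real \<Rightarrow> real"
begin

text \<open>
  \<open>rho m k\<close> is the value at time \<open>k\<close> of the recursion started with \<open>0\<close> at time \<open>k + m\<close>. The number
  \<open>m\<close> of steps, not the starting time, is the recursion argument: the comparison of two horizons is then
  an induction on \<open>m\<close> in which both shift to time \<open>k + 1\<close>.
  \<open>rho1\<close> and \<open>rho2\<close> are the first two derivatives in \<open>e\<close>, written out by the chain rule.
\<close>

primrec rho :: "nat \<Rightarrow> nat \<Rightarrow> real \<Rightarrow> real" where
  "rho 0 k e = 0"
| "rho (Suc m) k e = g k (d (Suc k) e + rho m (Suc k) e)"

primrec rho1 :: "nat \<Rightarrow> nat \<Rightarrow> real \<Rightarrow> real" where
  "rho1 0 k e = 0"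
| "rho1 (Suc m) k e = g1 k (d (Suc k) e + rho m (Suc k) e) * (d1 (Suc k) e + rho1 m (Suc k) e)"

primrec rho2 :: "nat \<Rightarrow> nat \<Rightarrow> real \<Rightarrow> real" where
  "rho2 0 k e = 0"
| "rho2 (Suc m) k e = g2 k (d (Suc k) e + rho m (Suc k) e) * (d1 (Suc k) e + rho1 m (Suc k) e)\<^sup>2
     + g1 k (d (Suc k) e + rho m (Suc k) e) * (d2 (Suc k) e + rho2 m (Suc k) e)"

lemma rho_deriv:
  assumes "\<And>k x. (d k has_real_derivative d1 k x) (at x)"
  shows "(rho m k has_real_derivative rho1 m k x) (at x)"
proof (induction m arbitrary: k)
  case (Suc m)
  show ?case unfolding rho.simps rho1.simps
    by (rule DERIV_chain2[OF g_deriv DERIV_add[OF assms Suc]])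
next
  case 0
  have "rho 0 k = (\<lambda>_. 0)" by (simp add: fun_eq_iff)
  then show ?case by simp
qed

lemma rho1_deriv:
  assumes "\<And>k x. (d k has_real_derivative d1 k x) (at x)"
    and "\<And>k x. (d1 k has_real_derivative d2 k x) (at x)"
  shows "(rho1 m k has_real_derivative rho2 m k x) (at x)"
proof (induction m arbitrary: k)
  case (Suc m)
  note D = DERIV_add[OF assms(1)[of "Suc k"] rho_deriv[OF assms(1), of m "Suc k"]]
    and D1 = DERIV_add[OF assms(2)[of "Suc k"] Suc.IH[of "Suc k"]]
  show ?case unfolding rho1.simps rho2.simps
    by (rule DERIV_cong[OF DERIV_mult[OF DERIV_chain2[OF g1_deriv D] D1]])
       (simp add: power2_eq_square algebra_simps)
next
  case 0
  have "rho1 0 k = (\<lambda>_. 0)" by (simp add: fun_eq_iff)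
  then show ?case by simp
qed

lemma g_lipschitz: "\<bar>g k x - g k y\<bar> \<le> \<gamma> * \<bar>x - y\<bar>"
  using field_differentiable_bound[of UNIV "g k" "g1 k" \<gamma> x y] g_deriv g1_bound by auto

lemma g1_lipschitz: "\<bar>g1 k x - g1 k y\<bar> \<le> \<bar>x - y\<bar>"
  using field_differentiable_bound[of UNIV "g1 k" "g2 k" 1 x y] g1_deriv g2_bound by auto

text \<open>
  The two horizons differ by \<open>g\<close> of something against \<open>0\<close> at the far end, which is at most \<open>B\<close>, and each
  step back to time \<open>k\<close> contracts this by \<open>\<gamma>\<close>.
\<close>

lemma rho_diff: "\<bar>rho (Suc m) k e - rho m k e\<bar> \<le> B * \<gamma> ^ m"
proof (induction m arbitrary: k)
  case 0 then show ?case using g_bound by simp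
next
  case (Suc m)
  have "\<bar>rho (Suc (Suc m)) k e - rho (Suc m) k e\<bar> \<le> \<gamma> * \<bar>rho (Suc m) (Suc k) e - rho m (Suc k) e\<bar>"
    using g_lipschitz[of k "d (Suc k) e + rho (Suc m) (Suc k) e" "d (Suc k) e + rho m (Suc k) e"]
    by simp
  also have "\<dots> \<le> \<gamma> * (B * \<gamma> ^ m)" using Suc gamma by (intro mult_left_mono) auto
  finally show ?case by (simp add: mult_ac)
qed

lemma rho_convergent: "convergent (\<lambda>n. rho n k e)"
proof -
  have "summable (\<lambda>m. rho (Suc m) k e - rho m k e)"
    by (rule summable_comparison_test'[where g = "\<lambda>m. B * \<gamma> ^ m" and N = 0])
       (use rho_diff gamma in \<open>auto intro!: summable_mult summable_geometric\<close>)
  then have "convergent (\<lambda>n. \<Sum>m<n. rho (Suc m) k e - rho m k e)"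
    unfolding summable_iff_convergent .
  then show ?thesis unfolding sum_lessThan_telescope[of "\<lambda>m. rho m k e"] by simp
qed

context
  fixes \<mu> :: "nat \<Rightarrow> real" and e :: real
  assumes d1_bound: "\<And>k. \<bar>d1 k e\<bar> \<le> \<mu> k" and d2_bound: "\<And>k. \<bar>d2 k e\<bar> \<le> \<mu> k"
begin

abbreviation "cum_bound n \<equiv> \<Sum>j\<le>n. \<mu> j"

lemma mu_nonneg: "0 \<le> \<mu> k" using d1_bound[of k] by linarith

lemma cum_bound_mono: "m \<le> n \<Longrightarrow> cum_bound m \<le> cum_bound n"
  by (intro sum_mono2) (auto simp: mu_nonneg)

lemma cum_bound_nonneg: "0 \<le> cum_bound n" by (intro sum_nonneg) (auto simp: mu_nonneg)

lemma abs_g1_mult_le: "\<bar>g1 k x * y\<bar> \<le> \<bar>y\<bar>"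
  using mult_right_mono[of "\<bar>g1 k x\<bar>" 1 "\<bar>y\<bar>"] g1_bound[of k x] gamma by (simp add: abs_mult)

text \<open>
  Contraction is ignored here: the crude bound by the partial sums of \<open>\<mu>\<close> costs only polynomial
  factors in the end, against the geometric factor of \<open>rho_diff\<close>.
\<close>

lemma rho1_bound: "\<bar>rho1 m k e\<bar> \<le> cum_bound (k + m) - cum_bound k"
proof (induction m arbitrary: k)
  case (Suc m)
  have "\<bar>rho1 (Suc m) k e\<bar> \<le> \<bar>d1 (Suc k) e + rho1 m (Suc k) e\<bar>"
    unfolding rho1.simps by (rule abs_g1_mult_le)
  also have "\<dots> \<le> \<mu> (Suc k) + (cum_bound (Suc k + m) - cum_bound (Suc k))"
    using d1_bound[of "Suc k"] Suc[of "Suc k"] by linarith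
  finally show ?case by simp
qed simp

lemma a_bound: "\<bar>d1 (Suc k) e + rho1 m (Suc k) e\<bar> \<le> cum_bound (k + Suc m)"
  using d1_bound[of "Suc k"] rho1_bound[of m "Suc k"] cum_bound_nonneg[of k] by simp

lemma rho2_bound: "\<bar>rho2 m k e\<bar> \<le> m * (cum_bound (k + m))\<^sup>2 + cum_bound (k + m) - cum_bound k"
proof (induction m arbitrary: k)
  case (Suc m)
  let ?a = "d1 (Suc k) e + rho1 m (Suc k) e" and ?x = "d (Suc k) e + rho m (Suc k) e"
  have "\<bar>g2 k ?x * ?a\<^sup>2\<bar> \<le> 1 * (cum_bound (k + Suc m))\<^sup>2"
    unfolding abs_mult using g2_bound power_mono[OF a_bound[of k m], of 2] by (intro mult_mono) auto
  moreover have "\<bar>g1 k ?x * (d2 (Suc k) e + rho2 m (Suc k) e)\<bar> \<le> \<bar>d2 (Suc k) e + rho2 m (Suc k) e\<bar>"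
    by (rule abs_g1_mult_le)
  ultimately have "\<bar>rho2 (Suc m) k e\<bar> \<le> (cum_bound (k + Suc m))\<^sup>2 + \<mu> (Suc k)
      + (m * (cum_bound (Suc k + m))\<^sup>2 + cum_bound (Suc k + m) - cum_bound (Suc k))"
    using d2_bound[of "Suc k"] Suc[of "Suc k"] unfolding rho2.simps by linarith
  then show ?case by (simp add: algebra_simps)
qed simp

text \<open>
  Chosen so that \<open>1 \<le> K\<close> and \<open>B \<le> K \<gamma>\<close>: the latter lets the error \<open>B \<gamma> ^ m\<close> of one step be absorbed into
  a bound at the order \<open>\<gamma> ^ (m + 1)\<close> of the next step.
\<close>

definition "K = 1 + B / \<gamma>"

lemma B_nonneg: "0 \<le> B" using g_bound[of 0 0] by linarith

lemma K: "1 \<le> K" "B \<le> K * \<gamma>" "B \<le> K"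
proof -
  show "1 \<le> K" "B \<le> K * \<gamma>" using B_nonneg gamma by (auto simp: K_def field_simps)
  then show "B \<le> K" using gamma mult_left_le[of \<gamma> K] by linarith
qed

text \<open>
  The difference at one step is the change of \<open>g'\<close>, which is of order \<open>\<gamma> ^ m\<close> by \<open>rho_diff\<close>, plus
  \<open>\<gamma>\<close> times the difference one step later: an inhomogeneous recursion at the critical rate, whence the extra factor \<open>m + 1\<close>.
\<close>

lemma rho1_diff:
  "\<bar>rho1 (Suc m) k e - rho1 m k e\<bar> \<le> K * (1 + cum_bound (k + Suc m)) * (m + 1) * \<gamma> ^ m"
proof (induction m arbitrary: k)
  case 0
  have "\<bar>rho1 (Suc 0) k e\<bar> \<le> 1 * (1 + cum_bound (k + Suc 0))"
    using rho1_bound[of "Suc 0" k] cum_bound_nonneg[of k] by simp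
  also have "\<dots> \<le> K * (1 + cum_bound (k + Suc 0))"
    using K cum_bound_nonneg[of "k + Suc 0"] by (intro mult_right_mono) auto
  finally show ?case by simp
next
  case (Suc m)
  define S where "S = 1 + cum_bound (k + Suc (Suc m))"
  have S: "1 \<le> S" using cum_bound_nonneg[of "k + Suc (Suc m)"] unfolding S_def by linarith
  let ?x = "d (Suc k) e + rho m (Suc k) e" and ?x' = "d (Suc k) e + rho (Suc m) (Suc k) e"
  let ?a = "d1 (Suc k) e + rho1 m (Suc k) e" and ?a' = "d1 (Suc k) e + rho1 (Suc m) (Suc k) e"
  have "rho1 (Suc (Suc m)) k e - rho1 (Suc m) k e
    = (g1 k ?x' - g1 k ?x) * ?a' + g1 k ?x * (?a' - ?a)"
    unfolding rho1.simps(2)[of "Suc m" k] rho1.simps(2)[of "m" k] by (simp only: algebra_simps)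
  moreover have "\<bar>(g1 k ?x' - g1 k ?x) * ?a'\<bar> \<le> (B * \<gamma> ^ m) * S"
    unfolding abs_mult
  proof (intro mult_mono)
    show "\<bar>g1 k ?x' - g1 k ?x\<bar> \<le> B * \<gamma> ^ m"
      using g1_lipschitz[of k ?x' ?x] rho_diff[of m "Suc k" e] by linarith
    show "\<bar>?a'\<bar> \<le> S" using a_bound[of k "Suc m"] unfolding S_def by linarith
  qed (use B_nonneg gamma in auto)
  moreover have "\<bar>g1 k ?x * (?a' - ?a)\<bar> \<le> \<gamma> * (K * S * (m + 1) * \<gamma> ^ m)"
    unfolding abs_mult
  proof (intro mult_mono)
    show "\<bar>?a' - ?a\<bar> \<le> K * S * (m + 1) * \<gamma> ^ m"
      using Suc[of "Suc k"] unfolding S_def by simp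
  qed (use g1_bound gamma in auto)
  moreover have "(B * \<gamma> ^ m) * S \<le> K * \<gamma> * \<gamma> ^ m * S"
    using K gamma S by (intro mult_right_mono) auto
  ultimately have "\<bar>rho1 (Suc (Suc m)) k e - rho1 (Suc m) k e\<bar> \<le>
      K * \<gamma> * \<gamma> ^ m * S + \<gamma> * (K * S * (m + 1) * \<gamma> ^ m)" by linarith
  also have "\<dots> = K * S * (Suc m + 1) * \<gamma> ^ Suc m" by (simp add: algebra_simps)
  finally show ?case unfolding S_def .
qed

text \<open>
  The same argument once more. The inhomogeneous term is now of order \<open>(m + 2) \<gamma> ^ m\<close>, which gives the
  factor \<open>(m + 1)\<^sup>2\<close>; the constant \<open>4 K / \<gamma>\<close> works because \<open>(m + 2)\<^sup>2 - (m + 1)\<^sup>2 \<ge> m + 2\<close>.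
\<close>

lemma rho2_diff:
  "\<bar>rho2 (Suc m) k e - rho2 m k e\<bar> \<le> 4 * K / \<gamma> * (1 + cum_bound (k + Suc m))\<^sup>2 * (m + 1)\<^sup>2 * \<gamma> ^ m"
proof (induction m arbitrary: k)
  case 0
  define S where "S = 1 + cum_bound (k + Suc 0)"
  have S: "1 \<le> S" using cum_bound_nonneg[of "k + Suc 0"] unfolding S_def by linarith
  have "\<bar>rho2 (Suc 0) k e\<bar> \<le> 1 * S\<^sup>2"
    using rho2_bound[of "Suc 0" k] cum_bound_nonneg[of k] cum_bound_nonneg[of "k + Suc 0"]
    unfolding S_def power2_eq_square by (simp add: algebra_simps)
  also have "\<dots> \<le> (4 * K / \<gamma>) * S\<^sup>2"
    using K gamma by (intro mult_right_mono) (auto simp: field_simps)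
  finally show ?case unfolding S_def by simp
next
  case (Suc m)
  define S where "S = 1 + cum_bound (k + Suc (Suc m))"
  have S: "1 \<le> S" using cum_bound_nonneg[of "k + Suc (Suc m)"] unfolding S_def by linarith
  let ?x = "d (Suc k) e + rho m (Suc k) e" and ?x' = "d (Suc k) e + rho (Suc m) (Suc k) e"
  let ?a = "d1 (Suc k) e + rho1 m (Suc k) e" and ?a' = "d1 (Suc k) e + rho1 (Suc m) (Suc k) e"
  let ?c = "d2 (Suc k) e + rho2 m (Suc k) e" and ?c' = "d2 (Suc k) e + rho2 (Suc m) (Suc k) e"
  have eq: "rho2 (Suc (Suc m)) k e - rho2 (Suc m) k e
    = (g2 k ?x' - g2 k ?x) * ?a'\<^sup>2 + g2 k ?x * ((?a' - ?a) * (?a' + ?a))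
      + (g1 k ?x' - g1 k ?x) * ?c' + g1 k ?x * (?c' - ?c)"
    unfolding rho2.simps(2)[of "Suc m" k] rho2.simps(2)[of "m" k] power2_eq_square
    by (simp only: algebra_simps)
  have xx: "\<bar>?x' - ?x\<bar> \<le> B * \<gamma> ^ m" using rho_diff[of m "Suc k" e] by simp
  have a': "\<bar>?a'\<bar> \<le> S" using a_bound[of k "Suc m"] unfolding S_def by linarith
  have a: "\<bar>?a\<bar> \<le> S" using a_bound[of k "m"] cum_bound_mono[of "k + Suc m" "k + Suc (Suc m)"] unfolding S_def by linarith
  have aa: "\<bar>?a' - ?a\<bar> \<le> K * S * (m + 1) * \<gamma> ^ m" using rho1_diff[of m "Suc k"] unfolding S_def by simp
  have cc: "\<bar>?c' - ?c\<bar> \<le> 4 * K / \<gamma> * S\<^sup>2 * (m + 1)\<^sup>2 * \<gamma> ^ m" using Suc[of "Suc k"] unfolding S_def by simp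
  have S2: "S \<le> S\<^sup>2" using S by (simp add: self_le_power)
  have c': "\<bar>?c'\<bar> \<le> (m + 2) * S\<^sup>2"
  proof -
    have "\<bar>?c'\<bar> \<le> Suc m * (cum_bound (k + Suc (Suc m)))\<^sup>2 + cum_bound (k + Suc (Suc m)) - cum_bound k"
      using d2_bound[of "Suc k"] rho2_bound[of "Suc m" "Suc k"] by simp
    also have "\<dots> \<le> Suc m * S\<^sup>2 + S"
    proof -
      have "(cum_bound (k + Suc (Suc m)))\<^sup>2 \<le> S\<^sup>2"
        using cum_bound_nonneg[of "k + Suc (Suc m)"] unfolding S_def by (intro power_mono) linarith+
      then have "Suc m * (cum_bound (k + Suc (Suc m)))\<^sup>2 \<le> Suc m * S\<^sup>2" by (rule mult_left_mono) simp
      then show ?thesis using cum_bound_nonneg[of k] unfolding S_def by linarith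
    qed
    finally show ?thesis using S2 by (simp add: algebra_simps)
  qed
  have gm: "0 \<le> \<gamma> ^ m" using gamma by simp
  have BK: "B * \<gamma> ^ m \<le> K * \<gamma> ^ m" using K gm by (intro mult_right_mono)
  have 1: "\<bar>(g2 k ?x' - g2 k ?x) * ?a'\<^sup>2\<bar> \<le> K * \<gamma> ^ m * S\<^sup>2"
    unfolding abs_mult
  proof (intro mult_mono)
    show "\<bar>g2 k ?x' - g2 k ?x\<bar> \<le> K * \<gamma> ^ m"
      using g2_lipschitz[of k ?x' ?x] xx BK by linarith
    show "\<bar>?a'\<^sup>2\<bar> \<le> S\<^sup>2" using power_mono[OF a', of 2] by simp
  qed (use K gm in auto)
  have 2: "\<bar>g2 k ?x * ((?a' - ?a) * (?a' + ?a))\<bar> \<le> 1 * ((K * S * (m + 1) * \<gamma> ^ m) * (2 * S))"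
    unfolding abs_mult
  proof (intro mult_mono aa g2_bound)
    show "\<bar>?a' + ?a\<bar> \<le> 2 * S" using a a' by linarith
  qed (use K gm S in auto)
  have 3: "\<bar>(g1 k ?x' - g1 k ?x) * ?c'\<bar> \<le> K * \<gamma> ^ m * ((m + 2) * S\<^sup>2)"
    unfolding abs_mult
  proof (intro mult_mono c')
    show "\<bar>g1 k ?x' - g1 k ?x\<bar> \<le> K * \<gamma> ^ m"
      using g1_lipschitz[of k ?x' ?x] xx BK by linarith
  qed (use K gm in auto)
  have 4: "\<bar>g1 k ?x * (?c' - ?c)\<bar> \<le> \<gamma> * (4 * K / \<gamma> * S\<^sup>2 * (m + 1)\<^sup>2 * \<gamma> ^ m)"
    unfolding abs_mult by (intro mult_mono cc g1_bound) (use gamma in auto)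
  have "\<bar>rho2 (Suc (Suc m)) k e - rho2 (Suc m) k e\<bar> \<le>
      K * \<gamma> ^ m * S\<^sup>2 + 1 * ((K * S * (m + 1) * \<gamma> ^ m) * (2 * S)) + K * \<gamma> ^ m * ((m + 2) * S\<^sup>2)
      + \<gamma> * (4 * K / \<gamma> * S\<^sup>2 * (m + 1)\<^sup>2 * \<gamma> ^ m)"
    unfolding eq using 1 2 3 4 by linarith
  also have "\<dots> = K * \<gamma> ^ m * S\<^sup>2 * (1 + 2 * (m + 1) + (m + 2) + 4 * (m + 1)\<^sup>2)"
    using gamma by (simp add: power2_eq_square) (simp add: algebra_simps)
  also have "\<dots> \<le> K * \<gamma> ^ m * S\<^sup>2 * (4 * (Suc m + 1)\<^sup>2)"
  proof (rule mult_left_mono)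
    have "1 + 2 * (m + 1) + (m + 2) + 4 * (m + 1)\<^sup>2 \<le> 4 * (Suc m + 1)\<^sup>2"
      by (simp add: power2_eq_square algebra_simps)
    then show "real (1 + 2 * (m + 1) + (m + 2) + 4 * (m + 1)\<^sup>2) \<le> real (4 * (Suc m + 1)\<^sup>2)"
      by (rule of_nat_mono)
  qed (use K gm in auto)
  also have "\<dots> = 4 * K / \<gamma> * S\<^sup>2 * (Suc m + 1)\<^sup>2 * \<gamma> ^ Suc m"
    using gamma by (simp add: field_simps)
  finally show ?case unfolding S_def by simp
qed

text \<open>
  A single bound for all three orders, independent of \<open>e\<close>: it serves both for the uniform convergence of the
  derivatives and as an integrable majorant.
\<close>

lemma differences_bound:
  defines "\<Delta> \<equiv> \<lambda>m. 4 * K / \<gamma> * (1 + cum_bound (Suc m))\<^sup>2 * (m + 1)\<^sup>2 * \<gamma> ^ m"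
  shows "\<bar>rho (Suc m) 0 e - rho m 0 e\<bar> \<le> \<Delta> m"
    and "\<bar>rho1 (Suc m) 0 e - rho1 m 0 e\<bar> \<le> \<Delta> m"
    and "\<bar>rho2 (Suc m) 0 e - rho2 m 0 e\<bar> \<le> \<Delta> m"
proof -
  define S where "S = 1 + cum_bound (Suc m)"
  have S: "1 \<le> S" using cum_bound_nonneg[of "Suc m"] unfolding S_def by linarith
  have KK: "K \<le> 4 * K / \<gamma>" using K gamma by (simp add: field_simps)
  have m: "real (m + 1) \<le> (real m + 1)\<^sup>2" by (simp add: power2_eq_square algebra_simps)
  have "K * S * (m + 1) * \<gamma> ^ m \<le> 4 * K / \<gamma> * S\<^sup>2 * (m + 1)\<^sup>2 * \<gamma> ^ m"
    using KK K gamma S m by (intro mult_right_mono mult_mono) (auto simp: add.commute self_le_power)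
  moreover have "B * \<gamma> ^ m \<le> K * S * (m + 1) * \<gamma> ^ m"
  proof (rule mult_right_mono)
    have "B * 1 * 1 \<le> K * S * (m + 1)" using K S by (intro mult_mono) auto
    then show "B \<le> K * S * (m + 1)" by simp
  qed (use gamma in auto)
  ultimately show "\<bar>rho (Suc m) 0 e - rho m 0 e\<bar> \<le> \<Delta> m"
      "\<bar>rho1 (Suc m) 0 e - rho1 m 0 e\<bar> \<le> \<Delta> m"
    using rho_diff[of m 0 e] rho1_diff[of m 0] unfolding \<Delta>_def S_def add_0 by linarith+
  show "\<bar>rho2 (Suc m) 0 e - rho2 m 0 e\<bar> \<le> \<Delta> m"
    using rho2_diff[of m 0] unfolding \<Delta>_def by simp
qed

end

end

end

text \<open>
  Termwise differentiation of the telescoping series of the sequence \<open>F\<close>, by the Weierstrass test.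
\<close>

lemma lim_deriv_of_summable_differences:
  fixes F F' :: "nat \<Rightarrow> real \<Rightarrow> real"
  assumes deriv: "\<And>n x. (F n has_real_derivative F' n x) (at x)"
    and zero: "\<And>x. F 0 x = 0" "\<And>x. F' 0 x = 0"
    and S: "open S" "convex S" "x \<in> S"
    and bound: "\<And>m x. x \<in> S \<Longrightarrow> \<bar>F (Suc m) x - F m x\<bar> \<le> \<Delta> m"
      "\<And>m x. x \<in> S \<Longrightarrow> \<bar>F' (Suc m) x - F' m x\<bar> \<le> \<Delta> m"
    and \<Delta>: "summable \<Delta>"
  shows "((\<lambda>x. lim (\<lambda>n. F n x)) has_real_derivative lim (\<lambda>n. F' n x)) (at x)"
proof -
  have 1: "(\<Sum>n. F (Suc n) x - F n x) = lim (\<lambda>n. F n x)" "(\<Sum>n. F' (Suc n) x - F' n x) = lim (\<lambda>n. F' n x)" for x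
    unfolding suminf_eq_lim sum_lessThan_telescope[of "\<lambda>n. F n x"] sum_lessThan_telescope[of "\<lambda>n. F' n x"]
    by (simp_all add: zero)
  have "((\<lambda>x. \<Sum>n. F (Suc n) x - F n x) has_real_derivative (\<Sum>n. F' (Suc n) x - F' n x)) (at x)"
  proof (rule has_field_derivative_series'(2)[OF \<open>convex S\<close>])
    show "uniformly_convergent_on S (\<lambda>n x. \<Sum>i<n. F' (Suc i) x - F' i x)"
      by (rule Weierstrass_m_test'[where M = \<Delta>]) (simp_all add: bound(2) \<Delta>)
    show "summable (\<lambda>n. F (Suc n) x - F n x)"
      by (rule summable_comparison_test'[OF \<Delta>, where N = 0]) (simp add: bound(1) S)
    show "((\<lambda>x. F (Suc n) x - F n x) has_real_derivative F' (Suc n) y - F' n y) (at y within S)" for n y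
      by (rule has_field_derivative_at_within[OF DERIV_diff[OF deriv deriv]])
    show "x \<in> interior S" using S by (simp add: interior_open)
  qed (rule S)
  then show ?thesis unfolding 1 .
qed

lemma bound_of_summable_differences:
  fixes F :: "nat \<Rightarrow> real"
  assumes "F 0 = 0" "\<And>m. \<bar>F (Suc m) - F m\<bar> \<le> \<Delta> m" "summable \<Delta>"
  shows "convergent F" "\<bar>F n\<bar> \<le> suminf \<Delta>"
proof -
  have F: "F n = (\<Sum>m<n. F (Suc m) - F m)" for n using assms(1) by (simp add: sum_lessThan_telescope[of F])
  have "summable (\<lambda>m. F (Suc m) - F m)"
    by (rule summable_comparison_test'[OF assms(3), where N = 0]) (simp add: assms(2))
  then show "convergent F" unfolding summable_iff_convergent sum_lessThan_telescope[of F] using assms(1) by simp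
  have "\<bar>F n\<bar> \<le> (\<Sum>m<n. \<Delta> m)"
    by (subst F) (intro order.trans[OF sum_abs] sum_mono assms(2))
  also have "\<dots> \<le> suminf \<Delta>"
  proof (rule sum_le_suminf[OF assms(3)])
    show "0 \<le> \<Delta> m" for m using assms(2)[of m] by linarith
  qed simp
  finally show "\<bar>F n\<bar> \<le> suminf \<Delta>" .
qed

section \<open>Exponential tilting of a Bernoulli law\<close>

text \<open>
  Logarithmic moment generating function of the Bernoulli law with success probability \<open>p\<close>; its first two
  derivatives are mean and variance of the exponentially tilted law.
\<close>

definition log_mgf :: "real \<Rightarrow> real \<Rightarrow> real" where "log_mgf p x = ln (1 - p + p * exp x)"

definition tilt :: "real \<Rightarrow> real \<Rightarrow> real" where "tilt p x = p * exp x / (1 - p + p * exp x)"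

definition tilt_var :: "real \<Rightarrow> real \<Rightarrow> real" where "tilt_var p x = tilt p x * (1 - tilt p x)"

context
  fixes p :: real
  assumes p: "0 < p" "p < 1"
begin

lemma denom_pos: "0 < 1 - p + p * exp x"
  using p by (intro add_pos_pos) auto

lemma log_mgf_deriv: "(log_mgf p has_real_derivative tilt p x) (at x)"
  unfolding log_mgf_def[abs_def] tilt_def
  using denom_pos[of x] by (auto intro!: derivative_eq_intros simp: field_simps)

lemma tilt_deriv: "(tilt p has_real_derivative tilt_var p x) (at x)"
  unfolding tilt_def[abs_def] tilt_var_def
  using denom_pos[of x] by (auto intro!: derivative_eq_intros simp: divide_simps) (simp add: algebra_simps)

lemma tilt_var_deriv: "(tilt_var p has_real_derivative tilt_var p x * (1 - 2 * tilt p x)) (at x)"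
proof -
  have "((\<lambda>x. tilt p x * (1 - tilt p x)) has_real_derivative
      tilt_var p x * (1 - tilt p x) + (0 - tilt_var p x) * tilt p x) (at x)"
    by (intro DERIV_mult DERIV_diff tilt_deriv DERIV_const)
  then show ?thesis unfolding tilt_var_def[abs_def] by (rule DERIV_cong) (simp add: algebra_simps)
qed

lemma tilt_bounds: "0 \<le> tilt p x" "tilt p x \<le> 1"
  using p denom_pos[of x] by (auto simp: tilt_def field_simps)

lemma tilt_var_bounds: "0 \<le> tilt_var p x" "tilt_var p x \<le> 1/4"
proof -
  show "0 \<le> tilt_var p x" using tilt_bounds[of x] by (auto simp: tilt_var_def)
  have "0 \<le> (tilt p x - 1/2)\<^sup>2" by simp
  then show "tilt_var p x \<le> 1/4" by (simp add: tilt_var_def power2_eq_square algebra_simps)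
qed

lemma tilt_var_deriv_bound: "\<bar>tilt_var p x * (1 - 2 * tilt p x)\<bar> \<le> 1/4"
proof -
  have "\<bar>tilt_var p x * (1 - 2 * tilt p x)\<bar> \<le> 1/4 * 1"
    unfolding abs_mult using tilt_var_bounds[of x] tilt_bounds[of x] by (intro mult_mono) auto
  then show ?thesis by simp
qed

end

text \<open>
  With \<open>y = exp x\<close>, \<open>A = p (1 - p')\<close>, \<open>B = (1 - p) p'\<close>, the difference is \<open>(A - B) y\<close> divided by a product which is at least
  \<open>(A + B) y\<close>. So it is at most \<open>\<bar>A - B\<bar> / (A + B)\<close>, for every \<open>x\<close>, and \<open>A, B \<ge> \<kappa>\<^sup>2\<close>, \<open>A + B \<le> 1\<close>.
\<close>

lemma tilt_diff_bound:
  assumes "0 < \<kappa>" "\<kappa> \<le> p" "p \<le> 1 - \<kappa>" "\<kappa> \<le> p'" "p' \<le> 1 - \<kappa>"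
  shows "\<bar>tilt p x - tilt p' x\<bar> \<le> 1 - \<kappa>\<^sup>2"
proof -
  define y where "y = exp x"
  have y: "0 < y" by (simp add: y_def)
  define A where "A = p * (1 - p')" define B where "B = (1 - p) * p'"
  have N: "0 < 1 - p + p * y" "0 < 1 - p' + p' * y" using denom_pos[of p x] denom_pos[of p' x] assms by (auto simp: y_def)
  \<comment> \<open>Each of the four factors is at least kappa.\<close>
  have AB: "\<kappa>\<^sup>2 \<le> A" "\<kappa>\<^sup>2 \<le> B" unfolding A_def B_def power2_eq_square using assms by (auto intro!: mult_mono)
  have AB1: "A + B \<le> 1"
  proof -
    have "p * (1 - p') + (1 - p) * p' \<le> p * 1 + (1 - p) * 1"
      using assms by (intro add_mono mult_left_mono) auto
    then show ?thesis by (simp add: A_def B_def)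
  qed
  have eq: "tilt p x - tilt p' x = (A - B) * y / ((1 - p + p * y) * (1 - p' + p' * y))"
    using N unfolding tilt_def y_def[symmetric] A_def B_def by (simp add: divide_simps) (simp add: algebra_simps)
  have "(A + B) * y \<le> (1 - p + p * y) * (1 - p' + p' * y)"
  proof -
    have "(1 - p + p * y) * (1 - p' + p' * y) = (1-p)*(1-p') + (A + B) * y + p * p' * y\<^sup>2"
      by (simp add: A_def B_def power2_eq_square algebra_simps)
    then show ?thesis using assms by simp
  qed
  then have le1: "(A + B) * y / ((1 - p + p * y) * (1 - p' + p' * y)) \<le> 1"
    using N by (subst divide_le_eq_1_pos) auto
  have "(A + B) * \<bar>tilt p x - tilt p' x\<bar> = \<bar>A - B\<bar> * ((A + B) * y / ((1 - p + p * y) * (1 - p' + p' * y)))"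
    unfolding eq using N y by (simp add: abs_mult)
  also have "\<dots> \<le> \<bar>A - B\<bar> * 1" by (rule mult_left_mono[OF le1]) simp
  finally have "(A + B) * \<bar>tilt p x - tilt p' x\<bar> \<le> \<bar>A - B\<bar>" by simp
  also have "\<bar>A - B\<bar> \<le> (A + B) - 2 * \<kappa>\<^sup>2" using AB by linarith
  also have "\<dots> \<le> (A + B) * (1 - \<kappa>\<^sup>2)"
    using mult_right_mono[OF AB1 zero_le_power2[of \<kappa>]]
      zero_le_power2[of \<kappa>] unfolding right_diff_distrib mult_1_left mult_1_right by linarith
  finally show ?thesis using AB assms(1)
    by (smt (verit, best) mult_left_le_imp_le zero_less_power)
qed

lemma log_mgf_diff_bound:
  assumes "0 < \<kappa>" "\<kappa> \<le> p" "p \<le> 1 - \<kappa>" "\<kappa> \<le> p'" "p' \<le> 1 - \<kappa>"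
  shows "\<bar>log_mgf p x - log_mgf p' x\<bar> \<le> ln (1 / \<kappa>)"
proof -
  have *: "log_mgf a x - log_mgf b x \<le> ln (1 / \<kappa>)" if "\<kappa> \<le> a" "a \<le> 1 - \<kappa>" "\<kappa> \<le> b" "b \<le> 1 - \<kappa>" for a b
  proof -
    have N: "0 < 1 - a + a * exp x" "0 < 1 - b + b * exp x" using denom_pos[of a x] denom_pos[of b x] that assms(1) by auto
    have "\<kappa> * (1 - a + a * exp x) = \<kappa> * (1 - a) + (\<kappa> * a) * exp x" by (simp add: algebra_simps)
    also have "\<dots> \<le> 1 - b + b * exp x"
    proof (intro add_mono mult_right_mono)
      have "\<kappa> * (1 - a) \<le> \<kappa> * 1" "\<kappa> * a \<le> \<kappa> * 1" using that assms(1) by (auto intro!: mult_left_mono)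
      then show "\<kappa> * (1 - a) \<le> 1 - b" "\<kappa> * a \<le> b" using that by auto
    qed simp
    finally have "(1 - a + a * exp x) / (1 - b + b * exp x) \<le> 1 / \<kappa>"
      using N assms(1) by (simp add: field_simps)
    moreover have "log_mgf a x - log_mgf b x = ln ((1 - a + a * exp x) / (1 - b + b * exp x))"
      using N by (simp add: log_mgf_def ln_div)
    moreover have "0 < (1 - a + a * exp x) / (1 - b + b * exp x)" using N by simp
    ultimately show ?thesis using assms(1) by (metis ln_mono)
  qed
  show ?thesis using *[of p p'] *[of p' p] assms by auto
qed

section \<open>Two-state Markov chains\<close>

text \<open>
  The lower bound \<open>\<kappa>\<close> also ensures that every state has positive probability at all times, since conditional
  probabilities given a null event are \<open>0\<close>.
\<close>

locale binary_chain = prob_space M for M :: "'w measure" +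
  fixes \<eta> :: "int \<Rightarrow> 'w \<Rightarrow> nat" and \<kappa> :: real
  assumes eta_rv: "\<And>t. \<eta> t \<in> measurable M (count_space {0, 1})"
    and markov: "markov_chain M \<eta>"
    and kappa: "0 < \<kappa>"
    and mixing: "\<And>a b s t. a \<in> {0, 1} \<Longrightarrow> b \<in> {0, 1} \<Longrightarrow> \<bar>s - t\<bar> \<ge> 1 \<Longrightarrow> \<kappa> \<le> trans_prob M \<eta> s t a b"
begin

lemma eta_cases: "\<omega> \<in> space M \<Longrightarrow> \<eta> t \<omega> \<in> {0, 1}"
  using measurable_space[OF eta_rv[of t]] by simp

lemma eta_measurable [measurable]: "\<eta> t \<in> measurable M (count_space UNIV)"
  by (rule measurable_compose[OF eta_rv]) simp

lemma state_prob_pos: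
  assumes "a \<in> {0, 1}" shows "0 < \<P>(\<omega> in M. \<eta> t \<omega> = a)"
proof -
  have "0 < trans_prob M \<eta> t (t + 1) a 0"
    using mixing[of a 0 t "t + 1"] kappa assms by auto
  then have "\<P>(\<omega> in M. \<eta> t \<omega> = a) \<noteq> 0" by (auto simp: trans_prob_def cond_prob_def)
  then show ?thesis using measure_nonneg[of M "{\<omega>\<in>space M. \<eta> t \<omega> = a}"] by linarith
qed

lemma trans_prob_sum:
  assumes "a \<in> {0, 1}" shows "trans_prob M \<eta> s t a 0 + trans_prob M \<eta> s t a 1 = 1"
proof -
  have "\<P>(\<omega> in M. \<eta> t \<omega> = 0 \<and> \<eta> s \<omega> = a) + \<P>(\<omega> in M. \<eta> t \<omega> = 1 \<and> \<eta> s \<omega> = a)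
    = prob ({\<omega>\<in>space M. \<eta> t \<omega> = 0 \<and> \<eta> s \<omega> = a} \<union> {\<omega>\<in>space M. \<eta> t \<omega> = 1 \<and> \<eta> s \<omega> = a})"
    by (intro finite_measure_Union[symmetric]) auto
  also have "{\<omega>\<in>space M. \<eta> t \<omega> = 0 \<and> \<eta> s \<omega> = a} \<union> {\<omega>\<in>space M. \<eta> t \<omega> = 1 \<and> \<eta> s \<omega> = a}
    = {\<omega>\<in>space M. \<eta> s \<omega> = a}" using eta_cases by auto
  finally show ?thesis using state_prob_pos[OF assms, of s]
    by (simp add: trans_prob_def cond_prob_def add_divide_distrib[symmetric])
qed

lemma trans_prob_bounds:
  assumes "a \<in> {0, 1}" "b \<in> {0, 1}" "s \<noteq> t"
  shows "\<kappa> \<le> trans_prob M \<eta> s t a b" "trans_prob M \<eta> s t a b \<le> 1 - \<kappa>"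
proof -
  have 1: "\<kappa> \<le> trans_prob M \<eta> s t a c" if "c \<in> {0, 1}" for c using mixing that assms by auto
  from 1[OF assms(2)] show "\<kappa> \<le> trans_prob M \<eta> s t a b" .
  show "trans_prob M \<eta> s t a b \<le> 1 - \<kappa>"
    using 1[of 0] 1[of 1] trans_prob_sum[OF assms(1), of s t] assms(2) by auto
qed

lemma trans_prob_refl: "a \<in> {0, 1} \<Longrightarrow> trans_prob M \<eta> t t a b = of_bool (a = b)"
proof -
  assume a: "a \<in> {0, 1}"
  have "{\<omega>\<in>space M. \<eta> t \<omega> = b \<and> \<eta> t \<omega> = a} = (if a = b then {\<omega>\<in>space M. \<eta> t \<omega> = a} else {})" by auto
  then show ?thesis using state_prob_pos[OF a, of t] by (auto simp: trans_prob_def cond_prob_def)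
qed

text \<open>
  The Markov property for a whole history. Null histories contribute nothing on either side.
\<close>

lemma history_step:
  fixes k j :: nat
  shows "\<P>(\<omega> in M. \<eta> (int (k + j) + 1) \<omega> = c \<and> (\<forall>s\<in>{k..k+j}. \<eta> (int s) \<omega> = x s))
    = \<P>(\<omega> in M. \<forall>s\<in>{k..k+j}. \<eta> (int s) \<omega> = x s) * trans_prob M \<eta> (int (k + j)) (int (k + j) + 1) (x (k + j)) c"
    (is "prob ?A = prob ?H * ?t")
proof (cases "prob ?H = 0")
  case True
  have "prob ?A \<le> prob ?H" by (rule finite_measure_mono) auto
  then have "prob ?A = 0" using True measure_nonneg[of M ?A] by linarith
  then show ?thesis using True by simp
next
  case False
  let ?x = "\<lambda>s. x (nat s)" and ?I = "{int (k + j) - int j..int (k + j)}"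
  have I: "?I = int ` {k..k + j}" by (simp add: image_int_atLeastAtMost)
  have H: "(\<forall>s\<in>?I. \<eta> s \<omega> = ?x s) \<longleftrightarrow> (\<forall>s\<in>{k..k+j}. \<eta> (int s) \<omega> = x s)" for \<omega>
    unfolding I by simp
  have "\<P>(\<omega> in M. \<forall>s\<in>?I. \<eta> s \<omega> = ?x s) > 0"
    unfolding H using False measure_nonneg[of M ?H] by linarith
  then have "\<P>(\<omega> in M. \<eta> (int (k + j) + 1) \<omega> = c \<bar> \<forall>s\<in>?I. \<eta> s \<omega> = ?x s)
      = \<P>(\<omega> in M. \<eta> (int (k + j) + 1) \<omega> = c \<bar> \<eta> (int (k + j)) \<omega> = ?x (int (k + j)))"
    by (rule markov[unfolded markov_chain_def, rule_format, of "int (k + j)" j ?x c])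
  then show ?thesis using False unfolding H nat_int by (simp add: trans_prob_def cond_prob_def field_simps)
qed

lemma product_expand:
  fixes w :: "nat \<Rightarrow> nat \<Rightarrow> real"
  assumes "\<omega> \<in> space M"
  shows "(\<Prod>s\<in>{k..k+j}. w s (\<eta> (int s) \<omega>)) =
    (\<Sum>x\<in>PiE {k..k+j} (\<lambda>_. {0,1}). (\<Prod>s\<in>{k..k+j}. w s (x s)) *
       indicator {\<omega>\<in>space M. \<forall>s\<in>{k..k+j}. \<eta> (int s) \<omega> = x s} \<omega>)"
proof -
  let ?y = "restrict (\<lambda>s. \<eta> (int s) \<omega>) {k..k+j}" and ?E = "PiE {k..k+j} (\<lambda>_. {0,1::nat})"
  have y: "?y \<in> ?E" using eta_cases[OF assms] by auto
  have ind: "indicator {\<omega>\<in>space M. \<forall>s\<in>{k..k+j}. \<eta> (int s) \<omega> = x s} \<omega> = (if x = ?y then 1 else 0 :: real)" if "x \<in> ?E" for x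
  proof -
    have "(\<forall>s\<in>{k..k+j}. \<eta> (int s) \<omega> = x s) \<longleftrightarrow> x = ?y"
    proof
      assume "\<forall>s\<in>{k..k+j}. \<eta> (int s) \<omega> = x s"
      then show "x = ?y" by (intro PiE_ext[OF that y]) auto
    qed auto
    then show ?thesis using assms by (simp add: indicator_def)
  qed
  have "(\<Sum>x\<in>?E. (\<Prod>s\<in>{k..k+j}. w s (x s)) * indicator {\<omega>\<in>space M. \<forall>s\<in>{k..k+j}. \<eta> (int s) \<omega> = x s} \<omega>)
     = (\<Sum>x\<in>?E. if x = ?y then (\<Prod>s\<in>{k..k+j}. w s (?y s)) else 0)"
    by (intro sum.cong) (auto simp: ind)
  also have "\<dots> = (\<Prod>s\<in>{k..k+j}. w s (?y s))"
    using y by (subst sum.delta) (auto intro!: finite_PiE)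
  also have "\<dots> = (\<Prod>s\<in>{k..k+j}. w s (\<eta> (int s) \<omega>))" by (intro prod.cong) auto
  finally show ?thesis by simp
qed

lemma markov_step:
  fixes w :: "nat \<Rightarrow> nat \<Rightarrow> real" and h :: "nat \<Rightarrow> real"
  shows "expectation (\<lambda>\<omega>. (\<Prod>s\<in>{k..k+j}. w s (\<eta> (int s) \<omega>)) * h (\<eta> (int (k + j) + 1) \<omega>)) =
    expectation (\<lambda>\<omega>. (\<Prod>s\<in>{k..k+j}. w s (\<eta> (int s) \<omega>)) *
      (\<Sum>c\<in>{0,1}. trans_prob M \<eta> (int (k+j)) (int (k+j) + 1) (\<eta> (int (k+j)) \<omega>) c * h c))"
proof -
  let ?E = "PiE {k..k+j} (\<lambda>_. {0,1::nat})" and ?W = "\<lambda>x. \<Prod>s\<in>{k..k+j}. w s (x s)"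
  let ?H = "\<lambda>x. {\<omega>\<in>space M. \<forall>s\<in>{k..k+j}. \<eta> (int s) \<omega> = x s}"
  let ?A = "\<lambda>x c. {\<omega>\<in>space M. \<eta> (int (k+j) + 1) \<omega> = c \<and> (\<forall>s\<in>{k..k+j}. \<eta> (int s) \<omega> = x s)}"
  let ?P = "trans_prob M \<eta> (int (k+j)) (int (k+j) + 1)"
  have fin: "finite ?E" by (auto intro: finite_PiE)
  have [measurable]: "?H x \<in> events" "?A x c \<in> events" for x c by measurable
  have int: "integrable M (\<lambda>\<omega>. indicator (?A x c) \<omega> :: real)" for x c
    by (rule integrable_real_indicator) (auto simp: less_top[symmetric])
  have intH: "integrable M (\<lambda>\<omega>. indicator (?H x) \<omega> :: real)" for x
    by (rule integrable_real_indicator) (auto simp: less_top[symmetric])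
  have "expectation (\<lambda>\<omega>. (\<Prod>s\<in>{k..k+j}. w s (\<eta> (int s) \<omega>)) * h (\<eta> (int (k + j) + 1) \<omega>))
    = expectation (\<lambda>\<omega>. \<Sum>x\<in>?E. \<Sum>c\<in>{0,1}. (?W x * h c) * indicator (?A x c) \<omega>)"
  proof (rule Bochner_Integration.integral_cong[OF refl])
    fix \<omega> assume \<omega>: "\<omega> \<in> space M"
    have 1: "h (\<eta> (int (k + j) + 1) \<omega>) = (\<Sum>c\<in>{0,1}. h c * of_bool (\<eta> (int (k+j) + 1) \<omega> = c))"
      using eta_cases[OF \<omega>, of "int (k+j) + 1"] by auto
    show "(\<Prod>s\<in>{k..k+j}. w s (\<eta> (int s) \<omega>)) * h (\<eta> (int (k + j) + 1) \<omega>) =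
      (\<Sum>x\<in>?E. \<Sum>c\<in>{0,1}. (?W x * h c) * indicator (?A x c) \<omega>)"
      unfolding product_expand[OF \<omega>] 1 sum_product using \<omega>
      by (intro sum.cong refl) (auto simp: indicator_def)
  qed
  also have "\<dots> = (\<Sum>x\<in>?E. \<Sum>c\<in>{0,1}. (?W x * h c) * prob (?A x c))"
  proof (rule trans[OF Bochner_Integration.integral_sum], goal_cases)
    case (1 x)
    show ?case by (intro Bochner_Integration.integrable_sum integrable_mult_right int)
  next
    case 2
    show ?case
      by (intro sum.cong refl trans[OF Bochner_Integration.integral_sum] integrable_mult_right int)
        simp
  qed
  also have "\<dots> = (\<Sum>x\<in>?E. (?W x * (\<Sum>c\<in>{0,1}. ?P (x (k + j)) c * h c)) * prob (?H x))"
    unfolding history_step by (intro sum.cong) (auto simp: algebra_simps)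
  also have "\<dots> = expectation (\<lambda>\<omega>. \<Sum>x\<in>?E. (?W x * (\<Sum>c\<in>{0,1}. ?P (x (k + j)) c * h c)) * indicator (?H x) \<omega>)"
    by (subst Bochner_Integration.integral_sum) (simp_all add: intH)
  also have "\<dots> = expectation (\<lambda>\<omega>. (\<Prod>s\<in>{k..k+j}. w s (\<eta> (int s) \<omega>)) * (\<Sum>c\<in>{0,1}. ?P (\<eta> (int (k+j)) \<omega>) c * h c))"
  proof (rule Bochner_Integration.integral_cong[OF refl])
    fix \<omega> assume \<omega>: "\<omega> \<in> space M"
    show "(\<Sum>x\<in>?E. (?W x * (\<Sum>c\<in>{0,1}. ?P (x (k + j)) c * h c)) * indicator (?H x) \<omega>)
      = (\<Prod>s\<in>{k..k+j}. w s (\<eta> (int s) \<omega>)) * (\<Sum>c\<in>{0,1}. ?P (\<eta> (int (k+j)) \<omega>) c * h c)"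
      unfolding product_expand[OF \<omega>] sum_distrib_right[of _ ?E]
    proof (intro sum.cong refl)
      fix x
      show "?W x * (\<Sum>c\<in>{0,1}. ?P (x (k + j)) c * h c) * indicator (?H x) \<omega> =
        ?W x * indicator (?H x) \<omega> * (\<Sum>c\<in>{0,1}. ?P (\<eta> (int (k+j)) \<omega>) c * h c)"
      proof (cases "\<omega> \<in> ?H x")
        case True
        then have "\<forall>s\<in>{k..k+j}. \<eta> (int s) \<omega> = x s" by blast
        then have "\<eta> (int (k + j)) \<omega> = x (k + j)" by (rule bspec) simp
        then show ?thesis by simp
      qed simp
    qed
  qed
  finally show ?thesis .
qed

text \<open>
  \<open>E[\<Prod>s=k+1..k+m. w s (\<eta> s) | \<eta> k = a]\<close>, computed backwards.
\<close>

primrec future_weight :: "(nat \<Rightarrow> nat \<Rightarrow> real) \<Rightarrow> nat \<Rightarrow> nat \<Rightarrow> nat \<Rightarrow> real" where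
  "future_weight w 0 k a = 1"
| "future_weight w (Suc m) k a = (\<Sum>c\<in>{0,1}. trans_prob M \<eta> (int k) (int k + 1) a c * (w (Suc k) c * future_weight w m (Suc k) c))"

text \<open>
  The process \<open>\<Prod>s\<le>k+j. w s (\<eta> s)\<close> times \<open>future_weight\<close> of the remaining steps has constant expectation in \<open>j\<close>,
  by \<open>markov_step\<close>. The start in \<open>a\<close> is coded as one more weight, at time \<open>k\<close>.
\<close>

lemma chain_expectation:
  "expectation (\<lambda>\<omega>. of_bool (\<eta> (int k) \<omega> = a) * (\<Prod>s\<in>{Suc k..k+m}. w s (\<eta> (int s) \<omega>)))
    = \<P>(\<omega> in M. \<eta> (int k) \<omega> = a) * future_weight w m k a"
proof -
  define w' where "w' s c = (if s = k then of_bool (c = a) else w s c)" for s c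
  have w': "of_bool (\<eta> (int k) \<omega> = a) * (\<Prod>s\<in>{Suc k..k+j}. w s (\<eta> (int s) \<omega>)) = (\<Prod>s\<in>{k..k+j}. w' s (\<eta> (int s) \<omega>))" for j \<omega>
  proof -
    have "(\<Prod>s\<in>{k..k+j}. w' s (\<eta> (int s) \<omega>)) = w' k (\<eta> (int k) \<omega>) * (\<Prod>s\<in>{Suc k..k+j}. w' s (\<eta> (int s) \<omega>))"
      by (rule prod.atLeast_Suc_atMost) simp
    also have "(\<Prod>s\<in>{Suc k..k+j}. w' s (\<eta> (int s) \<omega>)) = (\<Prod>s\<in>{Suc k..k+j}. w s (\<eta> (int s) \<omega>))"
      by (intro prod.cong) (auto simp: w'_def)
    finally show ?thesis by (simp add: w'_def)
  qed
  have "expectation (\<lambda>\<omega>. (\<Prod>s\<in>{k..k+j}. w' s (\<eta> (int s) \<omega>)) * future_weight w m (k + j) (\<eta> (int (k+j)) \<omega>))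
    = expectation (\<lambda>\<omega>. \<Prod>s\<in>{k..k+j+m}. w' s (\<eta> (int s) \<omega>))" for j
  proof (induction m arbitrary: j)
    case (Suc m)
    have "expectation (\<lambda>\<omega>. (\<Prod>s\<in>{k..k+j}. w' s (\<eta> (int s) \<omega>)) * future_weight w (Suc m) (k + j) (\<eta> (int (k+j)) \<omega>))
      = expectation (\<lambda>\<omega>. (\<Prod>s\<in>{k..k+j}. w' s (\<eta> (int s) \<omega>)) *
          (w (Suc (k+j)) (\<eta> (int (k + j) + 1) \<omega>) * future_weight w m (Suc (k + j)) (\<eta> (int (k + j) + 1) \<omega>)))"
      unfolding future_weight.simps by (rule markov_step[symmetric])
    also have "\<dots> = expectation (\<lambda>\<omega>. (\<Prod>s\<in>{k..k+Suc j}. w' s (\<eta> (int s) \<omega>)) * future_weight w m (k + Suc j) (\<eta> (int (k+Suc j)) \<omega>))"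
      by (intro Bochner_Integration.integral_cong) (auto simp: w'_def add_ac)
    also have "\<dots> = expectation (\<lambda>\<omega>. \<Prod>s\<in>{k..k+j+Suc m}. w' s (\<eta> (int s) \<omega>))"
      unfolding Suc by simp
    finally show ?case .
  qed simp
  from this[of 0] have "expectation (\<lambda>\<omega>. of_bool (\<eta> (int k) \<omega> = a) * (\<Prod>s\<in>{Suc k..k+m}. w s (\<eta> (int s) \<omega>)))
    = expectation (\<lambda>\<omega>. w' k (\<eta> (int k) \<omega>) * future_weight w m k (\<eta> (int k) \<omega>))" unfolding w' by simp
  also have "\<dots> = expectation (\<lambda>\<omega>. indicator {\<omega>\<in>space M. \<eta> (int k) \<omega> = a} \<omega> * future_weight w m k a)"
    by (intro Bochner_Integration.integral_cong) (auto simp: w'_def)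
  finally show ?thesis by simp
qed

lemma trans_prob_future_weight:
  assumes "a \<in> {0, 1}"
  shows "trans_prob M \<eta> (int k) (int (k + Suc m)) a b = future_weight (\<lambda>s c. if s = k + Suc m then of_bool (c = b) else 1) (Suc m) k a"
proof -
  have "expectation (\<lambda>\<omega>. of_bool (\<eta> (int k) \<omega> = a) * (\<Prod>s\<in>{Suc k..k+Suc m}. if s = k + Suc m then of_bool (\<eta> (int s) \<omega> = b) else 1) :: real)
    = expectation (indicator {\<omega>\<in>space M. \<eta> (int (k + Suc m)) \<omega> = b \<and> \<eta> (int k) \<omega> = a})"
    by (intro Bochner_Integration.integral_cong) (auto simp: prod.delta)
  then have "\<P>(\<omega> in M. \<eta> (int (k + Suc m)) \<omega> = b \<and> \<eta> (int k) \<omega> = a) =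
     \<P>(\<omega> in M. \<eta> (int k) \<omega> = a) * future_weight (\<lambda>s c. if s = k + Suc m then of_bool (c = b) else 1) (Suc m) k a"
    using chain_expectation[of k a "\<lambda>s c. if s = k + Suc m then of_bool (c = b) else 1" "Suc m"] by simp
  then show ?thesis using state_prob_pos[OF assms, of "int k"] by (simp add: trans_prob_def cond_prob_def)
qed

lemma chapman_kolmogorov:
  assumes a: "a \<in> {0, 1}" and b: "b \<in> {0, 1}"
  shows "trans_prob M \<eta> (int k) (int (k + Suc m)) a b =
    (\<Sum>c\<in>{0,1}. trans_prob M \<eta> (int k) (int k + 1) a c * trans_prob M \<eta> (int (Suc k)) (int (Suc k + m)) c b)"
proof (cases m)
  case 0
  then show ?thesis using b by (auto simp: add_ac trans_prob_refl)
next
  case (Suc n)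
  let ?w = "\<lambda>s c. if s = k + Suc m then of_bool (c = b) else 1 :: real"
  have 1: "trans_prob M \<eta> (int (Suc k)) (int (Suc k + m)) c b = future_weight ?w m (Suc k) c" if "c \<in> {0,1}" for c
    using trans_prob_future_weight[OF that, of "Suc k" n b] Suc by simp
  show ?thesis unfolding trans_prob_future_weight[OF a] future_weight.simps(2)[of _ m]
    by (intro sum.cong refl) (use 1 Suc in auto)
qed

definition up_prob :: "nat \<Rightarrow> nat \<Rightarrow> real" where "up_prob k a = trans_prob M \<eta> (int k) (int k + 1) a 1"

lemma up_prob_bounds: "a \<in> {0,1} \<Longrightarrow> \<kappa> \<le> up_prob k a" "a \<in> {0,1} \<Longrightarrow> up_prob k a \<le> 1 - \<kappa>"
  unfolding up_prob_def using trans_prob_bounds[of a 1] by auto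

text \<open>
  The companion of \<open>trans_diff\<close>: \<open>1 - trans_sum\<close> is \<open>P(1,0) - P(0,1)\<close>, the asymmetry of the transition.
\<close>

definition trans_sum :: "nat \<Rightarrow> nat \<Rightarrow> real" where
  "trans_sum k t = trans_prob M \<eta> (int k) (int t) 1 1 + trans_prob M \<eta> (int k) (int t) 0 1"

abbreviation "D k t \<equiv> trans_diff M \<eta> (int k) (int t)"

lemma D_refl: "D k k = 1" and trans_sum_refl: "trans_sum k k = 1"
  by (auto simp: trans_diff_def trans_sum_def trans_prob_refl)

text \<open>
  Conditioning on the first step expresses both quantities for \<open>k, t\<close> by those for \<open>k + 1, t\<close>. For \<open>m = 0\<close> the
  right-hand sides involve the diagonal values of the preceding lemma.
\<close>

lemma D_rec: "D k (k + Suc m) = (up_prob k 1 - up_prob k 0) * D (Suc k) (Suc k + m)"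
  and trans_sum_rec: "trans_sum k (k + Suc m) = trans_sum (Suc k) (Suc k + m) - (1 - up_prob k 1 - up_prob k 0) * D (Suc k) (Suc k + m)"
proof -
  have zero: "0 \<in> {0, 1::nat}" and one: "1 \<in> {0, 1::nat}" by auto
  have z: "trans_prob M \<eta> (int k) (int k + 1) a 0 = 1 - up_prob k a" if "a \<in> {0,1}" for a
    using trans_prob_sum[OF that, of "int k" "int k + 1"] by (simp add: up_prob_def)
  have *: "trans_prob M \<eta> (int k) (int (k + Suc m)) a 1 = (1 - up_prob k a) * trans_prob M \<eta> (int (Suc k)) (int (Suc k + m)) 0 1
      + up_prob k a * trans_prob M \<eta> (int (Suc k)) (int (Suc k + m)) 1 1" if "a \<in> {0,1}" for a
    unfolding chapman_kolmogorov[OF that one] using z[OF that] by (simp add: up_prob_def)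
  show "D k (k + Suc m) = (up_prob k 1 - up_prob k 0) * D (Suc k) (Suc k + m)"
    unfolding trans_diff_def *[OF one] *[OF zero] by (simp add: algebra_simps)
  show "trans_sum k (k + Suc m) = trans_sum (Suc k) (Suc k + m) - (1 - up_prob k 1 - up_prob k 0) * D (Suc k) (Suc k + m)"
    unfolding trans_sum_def trans_diff_def *[OF one] *[OF zero] by (simp add: algebra_simps)
qed

end

section \<open>The log-likelihood ratio as a contracting recursion\<close>

sublocale binary_chain \<subseteq> filter: smooth_contraction
  "\<lambda>k x. log_mgf (up_prob k 1) x - log_mgf (up_prob k 0) x" "\<lambda>k x. tilt (up_prob k 1) x - tilt (up_prob k 0) x"
  "\<lambda>k x. tilt_var (up_prob k 1) x - tilt_var (up_prob k 0) x" "ln (1 / \<kappa>)" "1 - \<kappa>\<^sup>2"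
proof unfold_locales
  have p: "0 < up_prob k a" "up_prob k a < 1" if "a \<in> {0,1}" for k a
    using up_prob_bounds[OF that, of k] kappa by auto
  fix k x y
  note P = p[of 1 k, simplified] p[of 0 k, simplified]
  note PB = up_prob_bounds[of 1 k, simplified] up_prob_bounds[of 0 k, simplified]
  show "((\<lambda>x. log_mgf (up_prob k 1) x - log_mgf (up_prob k 0) x) has_real_derivative tilt (up_prob k 1) x - tilt (up_prob k 0) x) (at x)"
    by (intro DERIV_diff log_mgf_deriv) (use P in auto)
  show "((\<lambda>x. tilt (up_prob k 1) x - tilt (up_prob k 0) x) has_real_derivative tilt_var (up_prob k 1) x - tilt_var (up_prob k 0) x) (at x)"
    by (intro DERIV_diff tilt_deriv) (use P in auto)
  show "\<bar>log_mgf (up_prob k 1) x - log_mgf (up_prob k 0) x\<bar> \<le> ln (1 / \<kappa>)"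
    by (rule log_mgf_diff_bound) (use PB kappa in auto)
  show "\<bar>tilt (up_prob k 1) x - tilt (up_prob k 0) x\<bar> \<le> 1 - \<kappa>\<^sup>2"
    by (rule tilt_diff_bound) (use PB kappa in auto)
  show "\<bar>tilt_var (up_prob k 1) x - tilt_var (up_prob k 0) x\<bar> \<le> 1"
    using tilt_var_bounds[of "up_prob k 1" x] tilt_var_bounds[of "up_prob k 0" x] P by simp
  have "\<bar>(tilt_var (up_prob k 1) x - tilt_var (up_prob k 0) x) - (tilt_var (up_prob k 1) y - tilt_var (up_prob k 0) y)\<bar> \<le> 1 * \<bar>x - y\<bar>"
  proof (rule field_differentiable_bound[of UNIV "\<lambda>x. tilt_var (up_prob k 1) x - tilt_var (up_prob k 0) x", unfolded real_norm_def])
    show "((\<lambda>x. tilt_var (up_prob k 1) x - tilt_var (up_prob k 0) x) has_real_derivative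
        tilt_var (up_prob k 1) z * (1 - 2 * tilt (up_prob k 1) z) - tilt_var (up_prob k 0) z * (1 - 2 * tilt (up_prob k 0) z)) (at z within UNIV)" for z
      by (intro DERIV_diff tilt_var_deriv) (use P in auto)
    show "\<bar>tilt_var (up_prob k 1) z * (1 - 2 * tilt (up_prob k 1) z) - tilt_var (up_prob k 0) z * (1 - 2 * tilt (up_prob k 0) z)\<bar> \<le> 1" for z
      using tilt_var_deriv_bound[of "up_prob k 1" z] tilt_var_deriv_bound[of "up_prob k 0" z] P by simp
  qed auto
  then show "\<bar>tilt_var (up_prob k 1) x - tilt_var (up_prob k 0) x - (tilt_var (up_prob k 1) y - tilt_var (up_prob k 0) y)\<bar> \<le> \<bar>x - y\<bar>" by simp
  have "\<kappa> \<le> 1/2" using PB by linarith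
  then have "\<kappa>\<^sup>2 \<le> (1/2)\<^sup>2" using kappa by (intro power_mono) auto
  then show "0 < 1 - \<kappa>\<^sup>2" by (simp add: power2_eq_square)
  show "1 - \<kappa>\<^sup>2 < 1" using kappa by simp
qed

context binary_chain
begin

text \<open>
  The weights, which will be functions of the fixed realization, are integrated over an independent copy of the chain.
\<close>

lemma path_integral:
  fixes w :: "nat \<Rightarrow> nat \<Rightarrow> real"
  defines "L \<equiv> path_law M (count_space {0, 1}) \<eta>"
  assumes a: "a \<in> {0, 1}"
  shows "(\<integral>\<sigma>. (\<Prod>s=1..n. w s (\<sigma> (int s))) \<partial>uniform_measure L {\<sigma> \<in> space L. \<sigma> 0 = a}) = future_weight w n 0 a"
proof -
  let ?N = "PiM UNIV (\<lambda>_::int. count_space {0, 1::nat})" and ?Y = "\<lambda>\<omega> t. \<eta> t \<omega>"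
  have Y [measurable]: "?Y \<in> measurable M ?N"
  proof (rule measurable_PiM_single'[OF eta_rv])
    show "?Y \<in> space M \<rightarrow> (\<Pi>\<^sub>E i\<in>UNIV. space (count_space {0, 1}))"
      using eta_cases unfolding PiE_UNIV_domain space_count_space by blast
  qed
  have comp [measurable]: "(\<lambda>\<sigma>. h (\<sigma> t)) \<in> borel_measurable ?N" for h :: "nat \<Rightarrow> real" and t
    by (rule measurable_compose[OF measurable_component_singleton[of t]]) auto
  have setsL [measurable_cong]: "sets L = sets ?N" by (simp add: L_def path_law_def)
  interpret L: prob_space L unfolding L_def path_law_def by (rule prob_space_distr[OF Y])
  let ?A = "{\<sigma> \<in> space L. \<sigma> 0 = a}"
  have indA: "indicator ?A \<sigma> = (of_bool (\<sigma> 0 = a) :: real)" if "\<sigma> \<in> space L" for \<sigma>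
    using that by (auto simp: indicator_def)
  have A [measurable]: "?A \<in> sets L"
  proof -
    have "{\<sigma> \<in> space L. (of_bool (\<sigma> 0 = a) :: real) = 1} \<in> sets L" using comp[of "\<lambda>c. of_bool (c = a)" 0] by measurable
    then show ?thesis by (simp cong: conj_cong)
  qed
  have intL: "(\<integral>\<sigma>. h \<sigma> \<partial>L) = expectation (\<lambda>\<omega>. h (?Y \<omega>))" if "h \<in> borel_measurable ?N" for h :: "(int \<Rightarrow> nat) \<Rightarrow> real"
    unfolding L_def path_law_def by (rule integral_distr[OF Y that])
  have mA: "measure L ?A = \<P>(\<omega> in M. \<eta> 0 \<omega> = a)"
  proof -
    have "measure L ?A = (\<integral>\<sigma>. indicator ?A \<sigma> \<partial>L)" by simp
    also have "\<dots> = (\<integral>\<sigma>. of_bool (\<sigma> 0 = a) \<partial>L)" by (intro Bochner_Integration.integral_cong refl indA)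
    also have "\<dots> = expectation (\<lambda>\<omega>. of_bool (\<eta> 0 \<omega> = a))" by (rule intL) (rule comp)
    also have "\<dots> = expectation (indicator {\<omega>\<in>space M. \<eta> 0 \<omega> = a})"
      by (intro Bochner_Integration.integral_cong) auto
    finally show ?thesis by simp
  qed
  have pos: "0 < measure L ?A" unfolding mA by (rule state_prob_pos[OF a])
  have um: "uniform_measure L ?A = density L (\<lambda>\<sigma>. ennreal (indicator ?A \<sigma> / measure L ?A))"
    unfolding uniform_measure_def using pos
    by (intro density_cong) (auto simp: L.emeasure_eq_measure ennreal_indicator[symmetric] divide_ennreal simp del: ennreal_indicator)
  have "(\<integral>\<sigma>. (\<Prod>s=1..n. w s (\<sigma> (int s))) \<partial>uniform_measure L ?A)
     = (\<integral>\<sigma>. (indicator ?A \<sigma> / measure L ?A) * (\<Prod>s=1..n. w s (\<sigma> (int s))) \<partial>L)"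
    unfolding um by (subst integral_density) (auto simp: zero_le_divide_iff)
  also have "\<dots> = (\<integral>\<sigma>. (of_bool (\<sigma> 0 = a) * (\<Prod>s=1..n. w s (\<sigma> (int s)))) / measure L ?A \<partial>L)"
    by (intro Bochner_Integration.integral_cong refl) (simp add: indA)
  also have "\<dots> = (\<integral>\<sigma>. (of_bool (\<sigma> 0 = a) * (\<Prod>s=1..n. w s (\<sigma> (int s)))) \<partial>L) / measure L ?A"
    by simp
  also have "(\<integral>\<sigma>. (of_bool (\<sigma> 0 = a) * (\<Prod>s=1..n. w s (\<sigma> (int s)))) \<partial>L) =
     expectation (\<lambda>\<omega>. of_bool (\<eta> 0 \<omega> = a) * (\<Prod>s=1..n. w s (\<eta> (int s) \<omega>)))"
    by (rule intL) (intro borel_measurable_times borel_measurable_prod comp)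
  also have "\<dots> = \<P>(\<omega> in M. \<eta> 0 \<omega> = a) * future_weight w n 0 a"
    using chain_expectation[of 0 a w n] by simp
  finally show ?thesis using pos unfolding mA by simp
qed

lemma future_weight_pos:
  assumes "\<And>s c. c \<in> {0,1} \<Longrightarrow> 0 < w s c" and "a \<in> {0, 1}"
  shows "0 < future_weight w m k a"
  using assms(2)
proof (induction m arbitrary: k a)
  case (Suc m)
  have "0 < trans_prob M \<eta> (int k) (int k + 1) a c" if "c \<in> {0,1}" for c
    using trans_prob_bounds[OF Suc.prems that, of "int k" "int k + 1"] kappa by linarith
  then show ?case unfolding future_weight.simps using Suc.IH assms(1) by (intro sum_pos mult_pos_pos) auto
qed simp

text \<open>
  In one step \<open>future_weight\<close> from \<open>a\<close> is \<open>(1 - p a) F 0 + p a F 1 = F 0 (1 - p a + p a exp x)\<close>, where \<open>F c\<close> is the weight of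
  continuing through \<open>c\<close>, \<open>p a\<close> the probability of moving from \<open>a\<close> to \<open>1\<close> and \<open>x = ln (F 1 / F 0)\<close>. The common factor \<open>F 0\<close> cancels in the ratio.
\<close>

lemma ln_future_weight_ratio:
  assumes w: "\<And>s c. c \<in> {0,1} \<Longrightarrow> 0 < w s c" and d: "\<And>s. d s e = ln (w s 1) - ln (w s 0)"
  shows "ln (future_weight w m k 1 / future_weight w m k 0) = filter.rho d m k e"
proof (induction m arbitrary: k)
  case (Suc m)
  let ?F = "\<lambda>c. w (Suc k) c * future_weight w m (Suc k) c" and ?x = "d (Suc k) e + filter.rho d m (Suc k) e"
  have F: "0 < w (Suc k) c" "0 < future_weight w m (Suc k) c" "0 < ?F c" if "c \<in> {0,1}" for c
    using w[OF that] future_weight_pos[OF w that] by simp_all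
  have ex: "exp ?x = ?F 1 / ?F 0"
    unfolding d Suc[symmetric] using F[of 0] F[of 1] by (simp add: exp_add exp_diff)
  have p: "0 < up_prob k a" "up_prob k a < 1" if "a \<in> {0,1}" for a
    using up_prob_bounds[OF that, of k] kappa by auto
  have step: "future_weight w (Suc m) k a = ?F 0 * (1 - up_prob k a + up_prob k a * exp ?x)" if "a \<in> {0,1}" for a
  proof -
    have "trans_prob M \<eta> (int k) (int k + 1) a 0 = 1 - up_prob k a"
      using trans_prob_sum[OF that, of "int k" "int k + 1"] by (simp add: up_prob_def)
    then have "future_weight w (Suc m) k a = (1 - up_prob k a) * ?F 0 + up_prob k a * ?F 1" by (simp add: up_prob_def)
    also have "\<dots> = ?F 0 * (1 - up_prob k a + up_prob k a * exp ?x)"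
      unfolding ex using F(1,2)[of 0] by (simp add: distrib_left)
    finally show ?thesis .
  qed
  have "future_weight w (Suc m) k 1 / future_weight w (Suc m) k 0 = (1 - up_prob k 1 + up_prob k 1 * exp ?x) / (1 - up_prob k 0 + up_prob k 0 * exp ?x)"
  proof -
    have "?F 0 \<noteq> 0" using F(1,2)[of 0] by simp
    moreover have "1 \<in> {0, 1::nat}" "0 \<in> {0, 1::nat}" by simp_all
    ultimately show ?thesis by (simp only: step mult_divide_mult_cancel_left not_False_eq_True)
  qed
  moreover have "0 < 1 - up_prob k 1 + up_prob k 1 * exp ?x" "0 < 1 - up_prob k 0 + up_prob k 0 * exp ?x"
    by (rule denom_pos[OF p]; simp)+
  ultimately have "ln (future_weight w (Suc m) k 1 / future_weight w (Suc m) k 0) = log_mgf (up_prob k 1) ?x - log_mgf (up_prob k 0) ?x"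
    unfolding log_mgf_def[of "up_prob k 1" ?x] log_mgf_def[of "up_prob k 0" ?x] by (simp only: ln_divide_pos)
  then show ?case unfolding filter.rho.simps .
next
  case 0
  show ?case unfolding filter.rho.simps by simp
qed

end

section \<open>Limits and derivatives under the expectation\<close>

text \<open>
  If \<open>E h(e)\<close> vanishes near \<open>e = 0\<close>, so do the expectations of the first two derivatives at \<open>0\<close>: divide the Taylor remainders by \<open>e\<close>
  and \<open>e\<^sup>2\<close>, write them as derivatives at intermediate points, and use dominated convergence along \<open>e = 1/(n+2)\<close>.
\<close>

lemma (in prob_space) expectation_derivs_zero:
  fixes h h1 h2 :: "'a \<Rightarrow> real \<Rightarrow> real"
  assumes zero: "\<And>e. -1 < e \<Longrightarrow> e < 1 \<Longrightarrow> expectation (\<lambda>\<omega>. h \<omega> e) = 0"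
    and meas [measurable]: "\<And>e. (\<lambda>\<omega>. h \<omega> e) \<in> borel_measurable M"
      "(\<lambda>\<omega>. h1 \<omega> 0) \<in> borel_measurable M" "(\<lambda>\<omega>. h2 \<omega> 0) \<in> borel_measurable M"
    and h1: "\<And>\<omega> e. \<omega> \<in> space M \<Longrightarrow> -1 < e \<Longrightarrow> e < 1 \<Longrightarrow> (h \<omega> has_real_derivative h1 \<omega> e) (at e)"
    and h2: "\<And>\<omega> e. \<omega> \<in> space M \<Longrightarrow> -1 < e \<Longrightarrow> e < 1 \<Longrightarrow> (h1 \<omega> has_real_derivative h2 \<omega> e) (at e)"
    and cont: "\<And>\<omega>. \<omega> \<in> space M \<Longrightarrow> isCont (h2 \<omega>) 0"
    and C: "integrable M C" "\<And>\<omega> e. \<omega> \<in> space M \<Longrightarrow> -1 < e \<Longrightarrow> e < 1 \<Longrightarrow> \<bar>h1 \<omega> e\<bar> \<le> C \<omega>"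
      "\<And>\<omega> e. \<omega> \<in> space M \<Longrightarrow> -1 < e \<Longrightarrow> e < 1 \<Longrightarrow> \<bar>h2 \<omega> e\<bar> \<le> C \<omega>"
    and int0: "integrable M (\<lambda>\<omega>. h \<omega> 0)"
  shows "expectation (\<lambda>\<omega>. h1 \<omega> 0) = 0 \<and> expectation (\<lambda>\<omega>. h2 \<omega> 0) = 0"
proof -
  \<comment> \<open>A null sequence inside the open interval of differentiability; 1 / (n + 1) would start at its end point.\<close>
  define x where "x n = 1 / (real n + 2)" for n
  have x: "0 < x n" "x n < 1" for n by (auto simp: x_def field_simps)
  have x0: "x \<longlonglongrightarrow> 0" unfolding x_def by real_asymp
  have sandwich: "(\<lambda>n. t n) \<longlonglongrightarrow> 0" if "\<And>n. 0 < t n \<and> t n < x n" for t :: "nat \<Rightarrow> real"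
    by (rule tendsto_sandwich[OF _ _ tendsto_const x0]) (use that in \<open>auto intro!: always_eventually less_imp_le\<close>)
  define q1 where "q1 n \<omega> = (h \<omega> (x n) - h \<omega> 0) / x n" for n \<omega>
  define q2 where "q2 n \<omega> = (h \<omega> (x n) - h \<omega> 0 - h1 \<omega> 0 * x n) / (x n)\<^sup>2 * 2" for n \<omega>
  have T1: "\<exists>t. \<forall>n. (0 < t n \<and> t n < x n) \<and> q1 n \<omega> = h1 \<omega> (t n)" if \<omega>: "\<omega> \<in> space M" for \<omega>
  proof (intro choice allI)
    fix n
    obtain t where "0 < t" "t < x n" "h \<omega> (x n) - h \<omega> 0 = (x n - 0) * h1 \<omega> t"
      using MVT2[of 0 "x n" "h \<omega>" "h1 \<omega>"] x[of n] h1[OF \<omega>] by auto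
    then show "\<exists>t. (0 < t \<and> t < x n) \<and> q1 n \<omega> = h1 \<omega> t" using x(1)[of n] by (auto simp: q1_def intro!: exI[of _ t])
  qed
  have T2: "\<exists>t. \<forall>n. (0 < t n \<and> t n < x n) \<and> q2 n \<omega> = h2 \<omega> (t n)" if \<omega>: "\<omega> \<in> space M" for \<omega>
  proof (intro choice allI)
    fix n
    let ?d = "\<lambda>m::nat. if m = 0 then h \<omega> else if m = 1 then h1 \<omega> else h2 \<omega>"
    have "\<exists>t>0. t < x n \<and> h \<omega> (x n) = (\<Sum>m<2. (?d m 0 / fact m) * x n ^ m)
        + (?d 2 t / fact 2) * x n ^ 2"
      by (rule Maclaurin[where diff = ?d]) (use x[of n] h1[OF \<omega>] h2[OF \<omega>] in \<open>auto simp: less_2_cases_iff\<close>)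
    then show "\<exists>t. (0 < t \<and> t < x n) \<and> q2 n \<omega> = h2 \<omega> t" using x(1)[of n]
      by (auto simp: q2_def lessThan_nat_numeral fact_numeral)
  qed
  have inth1: "integrable M (\<lambda>\<omega>. h1 \<omega> 0)"
  proof (rule Bochner_Integration.integrable_bound[OF C(1) meas(2)], rule AE_I2)
    fix \<omega> assume "\<omega> \<in> space M"
    from C(2)[OF this, of 0] show "norm (h1 \<omega> 0) \<le> norm (C \<omega>)" by simp
  qed
  have inth: "integrable M (\<lambda>\<omega>. h \<omega> (x n))" for n
  proof (rule Bochner_Integration.integrable_bound[of M "\<lambda>\<omega>. \<bar>h \<omega> 0\<bar> + C \<omega>"])
    show "AE \<omega> in M. norm (h \<omega> (x n)) \<le> norm (\<bar>h \<omega> 0\<bar> + C \<omega>)"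
    proof (rule AE_I2)
      fix \<omega> assume \<omega>: "\<omega> \<in> space M"
      obtain t where t: "0 < t" "t < x n" "q1 n \<omega> = h1 \<omega> t" using T1[OF \<omega>] by blast
      have "h \<omega> (x n) = h \<omega> 0 + h1 \<omega> t * x n" using t(3) x(1)[of n] by (simp add: q1_def field_simps)
      moreover have "\<bar>h1 \<omega> t * x n\<bar> \<le> C \<omega> * 1"
        unfolding abs_mult using C(2)[OF \<omega>, of t] t x[of n] by (intro mult_mono) auto
      ultimately show "norm (h \<omega> (x n)) \<le> norm (\<bar>h \<omega> 0\<bar> + C \<omega>)" by simp
    qed
  qed (use int0 C in auto)
  have e0: "expectation (\<lambda>\<omega>. h \<omega> (x n)) = 0" "expectation (\<lambda>\<omega>. h \<omega> 0) = 0" for n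
    using zero[of "x n"] zero[of 0] x[of n] by auto
  have "(\<lambda>n. expectation (q1 n)) \<longlonglongrightarrow> expectation (\<lambda>\<omega>. h1 \<omega> 0)"
  proof (rule integral_dominated_convergence[OF _ _ C(1)])
    show "AE \<omega> in M. (\<lambda>n. q1 n \<omega>) \<longlonglongrightarrow> h1 \<omega> 0"
    proof (rule AE_I2)
      fix \<omega> assume \<omega>: "\<omega> \<in> space M"
      obtain t where t: "\<And>n. 0 < t n \<and> t n < x n" "\<And>n. q1 n \<omega> = h1 \<omega> (t n)" using T1[OF \<omega>] by blast
      have "isCont (h1 \<omega>) 0" using h2[OF \<omega>, of 0] by (auto intro: DERIV_isCont)
      then show "(\<lambda>n. q1 n \<omega>) \<longlonglongrightarrow> h1 \<omega> 0"
        unfolding t(2) by (rule isCont_tendsto_compose[OF _ sandwich[OF t(1)]])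
    qed
    show "AE \<omega> in M. norm (q1 n \<omega>) \<le> C \<omega>" for n
    proof (rule AE_I2)
      fix \<omega> assume \<omega>: "\<omega> \<in> space M"
      obtain t where t: "0 < t" "t < x n" "q1 n \<omega> = h1 \<omega> t" using T1[OF \<omega>] by blast
      then show "norm (q1 n \<omega>) \<le> C \<omega>" using C(2)[OF \<omega>, of t] x[of n] by simp
    qed
    show "q1 n \<in> borel_measurable M" for n unfolding q1_def[abs_def] by measurable
  qed measurable
  moreover have "expectation (q1 n) = 0" for n
    unfolding q1_def[abs_def] by (simp add: inth int0 e0)
  ultimately have E1: "expectation (\<lambda>\<omega>. h1 \<omega> 0) = 0" by (simp add: LIMSEQ_const_iff)
  have "(\<lambda>n. expectation (q2 n)) \<longlonglongrightarrow> expectation (\<lambda>\<omega>. h2 \<omega> 0)"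
  proof (rule integral_dominated_convergence[OF _ _ C(1)])
    show "AE \<omega> in M. (\<lambda>n. q2 n \<omega>) \<longlonglongrightarrow> h2 \<omega> 0"
    proof (rule AE_I2)
      fix \<omega> assume \<omega>: "\<omega> \<in> space M"
      obtain t where t: "\<And>n. 0 < t n \<and> t n < x n" "\<And>n. q2 n \<omega> = h2 \<omega> (t n)" using T2[OF \<omega>] by blast
      show "(\<lambda>n. q2 n \<omega>) \<longlonglongrightarrow> h2 \<omega> 0"
        unfolding t(2) by (rule isCont_tendsto_compose[OF cont[OF \<omega>] sandwich[OF t(1)]])
    qed
    show "AE \<omega> in M. norm (q2 n \<omega>) \<le> C \<omega>" for n
    proof (rule AE_I2)
      fix \<omega> assume \<omega>: "\<omega> \<in> space M"
      obtain t where t: "0 < t" "t < x n" "q2 n \<omega> = h2 \<omega> t" using T2[OF \<omega>] by blast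
      then show "norm (q2 n \<omega>) \<le> C \<omega>" using C(3)[OF \<omega>, of t] x[of n] by simp
    qed
    show "q2 n \<in> borel_measurable M" for n unfolding q2_def[abs_def] by measurable
  qed measurable
  moreover have "expectation (q2 n) = 0" for n
    unfolding q2_def[abs_def] by (simp add: inth inth1 int0 e0 E1)
  ultimately have "expectation (\<lambda>\<omega>. h2 \<omega> 0) = 0" by (simp add: LIMSEQ_const_iff)
  with E1 show ?thesis ..
qed

text \<open>
  By monotone convergence the sum of the \<open>\<Delta> m\<close> has finite expectation, hence is finite almost surely.
\<close>

lemma (in prob_space) AE_summable_of_expectations:
  fixes \<Delta> :: "nat \<Rightarrow> 'a \<Rightarrow> real"
  assumes int: "\<And>m. integrable M (\<Delta> m)" and nonneg: "\<And>m \<omega>. 0 \<le> \<Delta> m \<omega>"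
    and bound: "\<And>m. expectation (\<Delta> m) \<le> c m" and c: "summable c"
  shows "AE \<omega> in M. summable (\<lambda>m. \<Delta> m \<omega>)" "integrable M (\<lambda>\<omega>. \<Sum>m. \<Delta> m \<omega>)"
proof -
  have [measurable]: "\<Delta> m \<in> borel_measurable M" for m using int by auto
  have E0: "0 \<le> expectation (\<Delta> m)" for m using nonneg by simp
  have sE: "summable (\<lambda>m. expectation (\<Delta> m))"
    by (rule summable_comparison_test'[OF c, of 0]) (use E0 bound in auto)
  have "(\<integral>\<^sup>+\<omega>. (\<Sum>m. ennreal (\<Delta> m \<omega>)) \<partial>M) = (\<Sum>m. \<integral>\<^sup>+\<omega>. ennreal (\<Delta> m \<omega>) \<partial>M)"
    by (rule nn_integral_suminf) measurable
  also have "\<dots> = (\<Sum>m. ennreal (expectation (\<Delta> m)))"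
    by (intro suminf_cong nn_integral_eq_integral int AE_I2 nonneg)
  also have "\<dots> < \<infinity>" using ennreal_suminf_neq_top[OF sE E0] by (simp add: less_top)
  finally have "AE \<omega> in M. (\<Sum>m. ennreal (\<Delta> m \<omega>)) \<noteq> \<infinity>"
    by (intro nn_integral_PInf_AE) (auto simp: less_top)
  then show AE: "AE \<omega> in M. summable (\<lambda>m. \<Delta> m \<omega>)"
    by eventually_elim (rule summable_suminf_not_top, auto simp: nonneg)
  show "integrable M (\<lambda>\<omega>. \<Sum>m. \<Delta> m \<omega>)"
    by (rule integrable_suminf[OF int]) (use AE sE nonneg in simp_all)
qed

lemma summable_poly_geometric:
  fixes \<gamma> :: real
  assumes "0 < \<gamma>" "\<gamma> < 1"
  shows "summable (\<lambda>m. (real m + 2) ^ 4 * \<gamma> ^ m)"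
proof -
  have "(\<lambda>n. ((real n + 3) / (real n + 2)) ^ 4) \<longlonglongrightarrow> 1" by real_asymp
  from tendsto_mult_right[OF this, of \<gamma>]
  have "(\<lambda>n. \<gamma> * ((real n + 3) / (real n + 2)) ^ 4) \<longlonglongrightarrow> \<gamma>" by (simp add: mult.commute)
  from order_tendstoD(2)[OF this, of "(1 + \<gamma>) / 2"] assms
  obtain N where N: "\<And>n. n \<ge> N \<Longrightarrow> \<gamma> * ((real n + 3) / (real n + 2)) ^ 4 < (1 + \<gamma>) / 2"
    by (auto simp: eventually_sequentially)
  show ?thesis
  proof (rule summable_ratio_test[where N = N and c = "(1 + \<gamma>) / 2"])
    fix n assume n: "N \<le> n"
    have "(real (Suc n) + 2) ^ 4 * \<gamma> ^ Suc n = (\<gamma> * ((real n + 3) / (real n + 2)) ^ 4) * ((real n + 2) ^ 4 * \<gamma> ^ n)"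
      by (simp add: power_divide add_ac)
    also have "\<dots> \<le> (1 + \<gamma>) / 2 * ((real n + 2) ^ 4 * \<gamma> ^ n)"
      using N[OF n] assms by (intro mult_right_mono) auto
    finally show "norm ((real (Suc n) + 2) ^ 4 * \<gamma> ^ Suc n) \<le> (1 + \<gamma>) / 2 * norm ((real n + 2) ^ 4 * \<gamma> ^ n)"
      using assms by (simp add: abs_mult)
  qed (use assms in auto)
qed

text \<open>
  If \<open>E[Y n | F] = g n\<close>, tested on the events of \<open>F\<close>, then the limits satisfy the same relation, by dominated
  convergence on each event. The limit \<open>y\<close> of the \<open>Y n\<close> is only known almost surely, hence need not
  be measurable; \<open>lim (\<lambda>n. Y n \<omega>)\<close> is a measurable version.
\<close>

lemma (in prob_space) has_cond_exp_limit:
  fixes Y g :: "nat \<Rightarrow> 'a \<Rightarrow> real"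
  assumes F: "subalgebra M F"
    and Y: "\<And>n. integrable M (Y n)" and W: "integrable M W" "\<And>n. AE \<omega> in M. \<bar>Y n \<omega>\<bar> \<le> W \<omega>"
    and Ylim: "AE \<omega> in M. (\<lambda>n. Y n \<omega>) \<longlonglongrightarrow> y \<omega>"
    and g: "\<And>n. g n \<in> borel_measurable F" "\<And>n \<omega>. \<omega> \<in> space M \<Longrightarrow> \<bar>g n \<omega>\<bar> \<le> C"
    and glim: "\<And>\<omega>. \<omega> \<in> space M \<Longrightarrow> (\<lambda>n. g n \<omega>) \<longlonglongrightarrow> G \<omega>"
    and eq: "\<And>n A. A \<in> sets F \<Longrightarrow> expectation (\<lambda>\<omega>. indicator A \<omega> * Y n \<omega>) = expectation (\<lambda>\<omega>. indicator A \<omega> * g n \<omega>)"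
  shows "has_cond_exp M F y G"
proof -
  interpret F: finite_measure_subalgebra M F
    by unfold_locales (rule F)
  have sp: "space F = space M" using F by (simp add: subalgebra_def)
  define y' where "y' \<omega> = lim (\<lambda>n. Y n \<omega>)" for \<omega>
  have Ym [measurable]: "Y n \<in> borel_measurable M" for n using Y by auto
  have y'm [measurable]: "y' \<in> borel_measurable M" unfolding y'_def[abs_def] by measurable
  have y'y: "AE \<omega> in M. y' \<omega> = y \<omega>" using Ylim by eventually_elim (auto simp: y'_def intro: limI)
  have Ylim': "AE \<omega> in M. (\<lambda>n. Y n \<omega>) \<longlonglongrightarrow> y' \<omega>" using Ylim y'y by eventually_elim simp
  have GF: "G \<in> borel_measurable F"
    by (rule borel_measurable_LIMSEQ_metric[OF g(1)]) (use glim sp in auto)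
  have gM [measurable]: "g n \<in> borel_measurable M" for n by (rule measurable_from_subalg[OF F g(1)])
  have GM [measurable]: "G \<in> borel_measurable M" by (rule measurable_from_subalg[OF F GF])
  have iy: "integrable M y'"
    by (rule integrable_dominated_convergence[OF y'm Ym W(1) Ylim']) (use W(2) in auto)
  have iG: "integrable M G"
    by (rule integrable_dominated_convergence[where s = g and w = "\<lambda>_. C"])
      (use g(2) glim GM gM in \<open>auto intro!: AE_I2\<close>)
  have "AE \<omega> in M. real_cond_exp M F y' \<omega> = G \<omega>"
  proof (rule F.real_cond_exp_charact[OF _ iy iG GF])
    fix A assume A: "A \<in> sets F"
    have [measurable]: "A \<in> events" using A F by (auto simp: subalgebra_def)
    have "(\<lambda>n. expectation (\<lambda>\<omega>. indicator A \<omega> * Y n \<omega>)) \<longlonglongrightarrow> expectation (\<lambda>\<omega>. indicator A \<omega> * y' \<omega>)"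
    proof (rule integral_dominated_convergence[OF _ _ W(1)])
      show "AE \<omega> in M. (\<lambda>n. indicator A \<omega> * Y n \<omega>) \<longlonglongrightarrow> indicator A \<omega> * y' \<omega>"
        using Ylim' by eventually_elim (rule tendsto_mult_left)
      show "AE \<omega> in M. norm (indicator A \<omega> * Y n \<omega>) \<le> W \<omega>" for n
        using W(2)[of n] by eventually_elim (auto simp: indicator_def)
    qed measurable
    moreover have "(\<lambda>n. expectation (\<lambda>\<omega>. indicator A \<omega> * g n \<omega>)) \<longlonglongrightarrow> expectation (\<lambda>\<omega>. indicator A \<omega> * G \<omega>)"
    proof (rule integral_dominated_convergence[where w = "\<lambda>_. \<bar>C\<bar>"])
      show "AE \<omega> in M. (\<lambda>n. indicator A \<omega> * g n \<omega>) \<longlonglongrightarrow> indicator A \<omega> * G \<omega>"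
        by (intro AE_I2 tendsto_mult_left glim)
      show "AE \<omega> in M. norm (indicator A \<omega> * g n \<omega>) \<le> \<bar>C\<bar>" for n
      proof (rule AE_I2)
        fix \<omega> assume "\<omega> \<in> space M"
        from g(2)[OF this, of n] show "norm (indicator A \<omega> * g n \<omega>) \<le> \<bar>C\<bar>" by (auto simp: indicator_def)
      qed
      show "integrable M (\<lambda>_. \<bar>C\<bar>)" by simp
    qed measurable
    ultimately have "expectation (\<lambda>\<omega>. indicator A \<omega> * y' \<omega>) = expectation (\<lambda>\<omega>. indicator A \<omega> * G \<omega>)"
      unfolding eq[OF A] by (rule LIMSEQ_unique)
    then show "(\<integral>\<omega>\<in>A. y' \<omega> \<partial>M) = (\<integral>\<omega>\<in>A. G \<omega> \<partial>M)" by (simp add: set_lebesgue_integral_def)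
  qed
  then show ?thesis unfolding has_cond_exp_def using iy y'y by blast
qed

section \<open>The observation model and its integrable envelope\<close>

text \<open>
  Positivity of \<open>f\<close> at every \<open>x\<close> makes the laws of an observation in the two states mutually absolutely
  continuous; \<open>change_of_density\<close> rests on this.
\<close>

locale switching_model = binary_chain M \<eta> \<kappa>
  for M :: "'w measure" and \<eta> :: "int \<Rightarrow> 'w \<Rightarrow> nat" and \<kappa> :: real +
  fixes Z :: "int \<Rightarrow> 'w \<Rightarrow> 'z::euclidean_space"
    and \<Theta> :: "real set"
    and \<phi> :: "'z \<Rightarrow> real \<Rightarrow> real"
    and \<theta> :: "nat \<Rightarrow> real \<Rightarrow> real"
    and f :: "real \<Rightarrow> real \<Rightarrow> real"
    and q :: nat
  assumes Z_rv [measurable]: "\<And>t. Z t \<in> borel_measurable M"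
    and Theta: "open \<Theta>"
    and theta_range: "\<And>a \<epsilon>. a \<in> {0, 1} \<Longrightarrow> \<theta> a \<epsilon> \<in> \<Theta>"
    and theta_zero: "\<theta> 0 0 = 0" "\<theta> 1 0 = 0"
    and indep: "indep_set (sets (path_algebra M borel Z)) (sets (path_algebra M (count_space {0, 1}) \<eta>))"
    and Z_indep: "indep_vars (\<lambda>_. borel) Z UNIV"
    and Z_ident: "\<And>s t. distr M borel (Z s) = distr M borel (Z t)"
    and density: "\<And>\<tau> t. \<tau> \<in> \<Theta> \<Longrightarrow> distributed M lborel (\<lambda>\<omega>. \<phi> (Z t \<omega>) \<tau>) (\<lambda>x. ennreal (f x \<tau>))"
    and q: "q \<ge> 2"
    and f_Cq: "\<And>z a b. a \<in> {0, 1} \<Longrightarrow> b \<in> {0, 1} \<Longrightarrow>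
                 C_class q UNIV (\<lambda>\<epsilon>. f (\<phi> z (\<theta> a \<epsilon>)) (\<theta> b \<epsilon>))"
    and f_derivs_cont: "\<And>a b j. a \<in> {0, 1} \<Longrightarrow> b \<in> {0, 1} \<Longrightarrow> j \<le> q \<Longrightarrow>
          continuous_on UNIV (\<lambda>(z, \<epsilon>). (deriv ^^ j) (\<lambda>e. f (\<phi> z (\<theta> a e)) (\<theta> b e)) \<epsilon>)"
    and moments: "\<And>\<rho>. \<rho> > 0 \<Longrightarrow>
          integrable M (\<lambda>\<omega>. M_sup f \<phi> \<theta> q (Z 0 \<omega>) \<rho> ^ (q\<^sup>2 * (q + 1) div 2))"
    and lambda_real: "\<And>x \<tau>. \<tau> \<in> \<Theta> \<Longrightarrow> 0 < f x \<tau>"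
    and lambda_C2: "C_class 2 (UNIV \<times> \<Theta>) (\<lambda>(x, \<tau>). ln (f x \<tau>))"
    and phi_C2: "\<And>z. C_class 2 \<Theta> (\<phi> z)"
    and theta_C2: "\<And>a. a \<in> {0, 1} \<Longrightarrow> C_class 2 UNIV (\<theta> a)"
begin

text \<open>
  Density in state \<open>b\<close> of an observation made in state \<open>a\<close> with noise \<open>z\<close>.
\<close>

definition lik where "lik a b z e = f (\<phi> z (\<theta> a e)) (\<theta> b e)"

abbreviation "log_lik a b z \<equiv> ell f \<phi> \<theta> z a b"

lemma lik_pos: "a \<in> {0, 1} \<Longrightarrow> b \<in> {0, 1} \<Longrightarrow> 0 < lik a b z e"
  unfolding lik_def by (rule lambda_real[OF theta_range])

lemma log_lik_eq: "log_lik a b z e = ln (lik a b z e)" by (simp add: ell_def lik_def)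

lemma lik_Ck: assumes "a \<in> {0, 1}" "b \<in> {0, 1}" shows "Ck q (lik a b z)"
  using C_class_imp_Ck[OF f_Cq[OF assms]] unfolding lik_def[abs_def] .

lemma log_lik_Ck: assumes "a \<in> {0, 1}" "b \<in> {0, 1}" shows "Ck q (log_lik a b z)"
proof -
  have "Ck q (\<lambda>e. ln (lik a b z e))" by (rule Ck_ln[OF lik_Ck[OF assms] lik_pos[OF assms]])
  then show ?thesis by (simp add: log_lik_eq[abs_def])
qed

lemma log_lik_derivs:
  assumes "a \<in> {0, 1}" "b \<in> {0, 1}"
  shows "(log_lik a b z has_real_derivative deriv (log_lik a b z) e) (at e)"
    and "(deriv (log_lik a b z) has_real_derivative deriv (deriv (log_lik a b z)) e) (at e)"
    and "isCont (deriv (deriv (log_lik a b z))) e"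
proof -
  have "Ck (Suc (Suc 0)) (log_lik a b z)" using Ck_mono[OF log_lik_Ck[OF assms] q] by (simp add: numeral_2_eq_2)
  note 1 = Ck_SucD[OF this] and 2 = Ck_SucD[OF Ck_SucD(2)[OF this]]
  show "(log_lik a b z has_real_derivative deriv (log_lik a b z) e) (at e)"
    "(deriv (log_lik a b z) has_real_derivative deriv (deriv (log_lik a b z)) e) (at e)" by (fact 1(1), fact 2(1))
  show "isCont (deriv (deriv (log_lik a b z))) e" using 2(2) by (simp add: continuous_on_eq_continuous_at)
qed

lemma lik_derivs:
  assumes "a \<in> {0, 1}" "b \<in> {0, 1}"
  shows "(lik a b z has_real_derivative deriv (lik a b z) e) (at e)"
    and "(deriv (lik a b z) has_real_derivative deriv (deriv (lik a b z)) e) (at e)"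
proof -
  have "Ck (Suc (Suc 0)) (lik a b z)" using Ck_mono[OF lik_Ck[OF assms] q] by (simp add: numeral_2_eq_2)
  note 1 = Ck_SucD[OF this] and 2 = Ck_SucD[OF Ck_SucD(2)[OF this]]
  show "(lik a b z has_real_derivative deriv (lik a b z) e) (at e)"
    "(deriv (lik a b z) has_real_derivative deriv (deriv (lik a b z)) e) (at e)" by (fact 1(1), fact 2(1))
qed

lemma log_lik_deriv_eq:
  assumes "a \<in> {0, 1}" "b \<in> {0, 1}"
  shows "deriv (log_lik a b z) e = deriv (lik a b z) e / lik a b z e"
    and "deriv (deriv (log_lik a b z)) e = (deriv (deriv (lik a b z)) e * lik a b z e - (deriv (lik a b z) e)\<^sup>2) / (lik a b z e)\<^sup>2"
proof -
  note pos = lik_pos[OF assms, of z]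
  have 1: "deriv (log_lik a b z) = (\<lambda>e. deriv (lik a b z) e / lik a b z e)"
  proof (intro ext DERIV_imp_deriv)
    fix e show "(log_lik a b z has_real_derivative deriv (lik a b z) e / lik a b z e) (at e)"
      unfolding log_lik_eq[abs_def]
      by (rule DERIV_cong[OF DERIV_chain2[OF DERIV_ln[OF pos] lik_derivs(1)[OF assms]]])
        (simp add: divide_inverse)
  qed
  then show "deriv (log_lik a b z) e = deriv (lik a b z) e / lik a b z e" by simp
  show "deriv (deriv (log_lik a b z)) e = (deriv (deriv (lik a b z)) e * lik a b z e - (deriv (lik a b z) e)\<^sup>2) / (lik a b z e)\<^sup>2"
    unfolding 1 using pos[of e]
    by (intro DERIV_imp_deriv DERIV_cong[OF DERIV_divide[OF lik_derivs(2)[OF assms] lik_derivs(1)[OF assms]]])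
       (auto simp: power2_eq_square)
qed

lemma lik_measurable:
  assumes "a \<in> {0, 1}" "b \<in> {0, 1}"
  shows "(\<lambda>z. lik a b z e) \<in> borel_measurable borel"
    and "(\<lambda>z. deriv (lik a b z) e) \<in> borel_measurable borel"
    and "(\<lambda>z. deriv (deriv (lik a b z)) e) \<in> borel_measurable borel"
proof -
  have *: "(\<lambda>z. (deriv ^^ j) (lik a b z) e) \<in> borel_measurable borel" if "j \<le> q" for j
  proof (rule borel_measurable_continuous_onI)
    have "continuous_on UNIV ((\<lambda>(z, \<epsilon>). (deriv ^^ j) (lik a b z) \<epsilon>) \<circ> (\<lambda>z. (z, e)))"
      using f_derivs_cont[OF assms that]
      by (intro continuous_on_compose continuous_intros) (auto simp: lik_def[abs_def] elim: continuous_on_subset)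
    then show "continuous_on UNIV (\<lambda>z. (deriv ^^ j) (lik a b z) e)" by (simp add: comp_def)
  qed
  show "(\<lambda>z. lik a b z e) \<in> borel_measurable borel" "(\<lambda>z. deriv (lik a b z) e) \<in> borel_measurable borel"
    "(\<lambda>z. deriv (deriv (lik a b z)) e) \<in> borel_measurable borel"
    using *[of 0] *[of 1] *[of 2] q by (simp_all add: numeral_2_eq_2)
qed

lemma log_lik_measurable:
  assumes "a \<in> {0, 1}" "b \<in> {0, 1}"
  shows "(\<lambda>z. log_lik a b z e) \<in> borel_measurable borel"
    and "(\<lambda>z. deriv (log_lik a b z) e) \<in> borel_measurable borel"
    and "(\<lambda>z. deriv (deriv (log_lik a b z)) e) \<in> borel_measurable borel"
  unfolding log_lik_eq log_lik_deriv_eq[OF assms] using lik_measurable[OF assms] by measurable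

text \<open>
  A majorant of the first two derivatives for \<open>\<bar>e\<bar> < 1\<close>. The supremum runs over rational points,
  so that it is measurable in \<open>z\<close>; continuity extends the bound to all points. Measurability is what allows the moment
  bound at time \<open>0\<close> to be moved to other times.
\<close>

definition envelope where
  "envelope z = (SUP e\<in>\<rat> \<inter> {-1<..<1}. \<Sum>a\<in>{0,1}. \<Sum>b\<in>{0,1}. \<bar>deriv (log_lik a b z) e\<bar> + \<bar>deriv (deriv (log_lik a b z)) e\<bar>)"

text \<open>
  The supremum is a true upper bound because all derivatives up to order \<open>q\<close> are continuous, hence bounded on \<open>[-1, 1]\<close>.
\<close>

lemma M_sup_upper:
  assumes "1 \<le> j" "j \<le> q" "\<bar>e\<bar> \<le> 1" "a \<in> {0, 1}" "b \<in> {0, 1}"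
  shows "\<bar>(deriv ^^ j) (log_lik a b z) e\<bar> \<le> M_sup f \<phi> \<theta> q z 1"
  unfolding M_sup_def
proof (rule cSup_upper)
  let ?S = "{\<bar>(deriv ^^ j) (log_lik a b z) \<epsilon>\<bar> | j \<epsilon> a b. 1 \<le> j \<and> j \<le> q \<and> \<bar>\<epsilon>\<bar> \<le> 1 \<and> a \<in> {0, 1} \<and> b \<in> {0, 1}}"
  show "\<bar>(deriv ^^ j) (log_lik a b z) e\<bar> \<in> ?S" using assms by blast
  have bd: "bdd_above ((\<lambda>e. \<bar>(deriv ^^ j) (log_lik a b z) e\<bar>) ` {-1..1})" if "j \<le> q" "a \<in> {0, 1}" "b \<in> {0, 1}" for j a b
  proof -
    have "continuous_on UNIV ((deriv ^^ j) (log_lik a b z))"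
      using Ck_mono[OF log_lik_Ck[OF that(2,3)] that(1)] unfolding Ck_iff by blast
    then have "continuous_on {-1..1} (\<lambda>e. \<bar>(deriv ^^ j) (log_lik a b z) e\<bar>)"
      by (intro continuous_intros) (rule continuous_on_subset, auto)
    then show ?thesis by (intro bounded_imp_bdd_above compact_imp_bounded compact_continuous_image) auto
  qed
  have "?S \<subseteq> (\<Union>j\<in>{..q}. \<Union>a\<in>{0,1}. \<Union>b\<in>{0,1}. (\<lambda>e. \<bar>(deriv ^^ j) (log_lik a b z) e\<bar>) ` {-1..1})"
    by (auto simp: abs_le_iff)
  moreover have "bdd_above \<dots>" using bd by (auto simp: bdd_above_UN)
  ultimately show "bdd_above ?S" by (rule bdd_above_mono[rotated])
qed

lemma envelope_terms_le:
  assumes "\<bar>e\<bar> \<le> 1"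
  shows "(\<Sum>a\<in>{0,1}. \<Sum>b\<in>{0,1}. \<bar>deriv (log_lik a b z) e\<bar> + \<bar>deriv (deriv (log_lik a b z)) e\<bar>) \<le> 8 * M_sup f \<phi> \<theta> q z 1"
proof -
  have "\<bar>deriv (log_lik a b z) e\<bar> + \<bar>deriv (deriv (log_lik a b z)) e\<bar> \<le> 2 * M_sup f \<phi> \<theta> q z 1" if "a \<in> {0,1}" "b \<in> {0,1}" for a b
    using M_sup_upper[of 1 e a b z] M_sup_upper[of 2 e a b z] q assms that by (simp add: numeral_2_eq_2)
  from this[of 0 0] this[of 0 1] this[of 1 0] this[of 1 1] show ?thesis by simp
qed

lemma envelope_bdd: "bdd_above ((\<lambda>e. \<Sum>a\<in>{0,1}. \<Sum>b\<in>{0,1}. \<bar>deriv (log_lik a b z) e\<bar> + \<bar>deriv (deriv (log_lik a b z)) e\<bar>) ` (\<rat> \<inter> {-1<..<1}))"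
  by (rule bdd_aboveI[of _ "8 * M_sup f \<phi> \<theta> q z 1"]) (auto intro!: envelope_terms_le[simplified])

lemma rat0: "0 \<in> \<rat> \<inter> {-1<..<1::real}" by auto

lemma envelope_nonneg: "0 \<le> envelope z"
  unfolding envelope_def by (rule order.trans[OF _ cSUP_upper[OF rat0 envelope_bdd]]) simp

lemma envelope_le_M_sup: "envelope z \<le> 8 * M_sup f \<phi> \<theta> q z 1"
  unfolding envelope_def by (rule cSUP_least) (use rat0 in blast, auto intro!: envelope_terms_le[simplified])

lemma envelope_measurable [measurable]: "envelope \<in> borel_measurable borel"
  unfolding envelope_def[abs_def]
proof (rule borel_measurable_cSUP)
  show "countable (\<rat> \<inter> {-1<..<1::real})" by (simp add: countable_rat)
  show "(\<lambda>z. \<Sum>a\<in>{0,1}. \<Sum>b\<in>{0,1}. \<bar>deriv (log_lik a b z) e\<bar> + \<bar>deriv (deriv (log_lik a b z)) e\<bar>) \<in> borel_measurable borel" for e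
    by (intro borel_measurable_sum borel_measurable_add borel_measurable_abs log_lik_measurable)
qed (rule envelope_bdd)

lemma envelope_upper:
  assumes "-1 < e" "e < 1" "a \<in> {0,1}" "b \<in> {0,1}"
  shows "\<bar>deriv (log_lik a b z) e\<bar> + \<bar>deriv (deriv (log_lik a b z)) e\<bar> \<le> envelope z"
proof (rule ccontr)
  let ?g = "\<lambda>e. \<bar>deriv (log_lik a b z) e\<bar> + \<bar>deriv (deriv (log_lik a b z)) e\<bar>"
  assume "\<not> ?g e \<le> envelope z"
  moreover have "isCont ?g e"
    using log_lik_derivs(3)[OF assms(3,4)] DERIV_isCont[OF log_lik_derivs(2)[OF assms(3,4)]] by (intro continuous_intros)
  then have "(?g \<longlongrightarrow> ?g e) (nhds e)"
    using tendsto_at_iff_tendsto_nhds[of ?g e] unfolding isCont_def by blast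
  ultimately have "\<forall>\<^sub>F x in nhds e. envelope z < ?g x" by (elim order_tendstoD(1)) linarith
  moreover have "\<forall>\<^sub>F x in nhds e. x \<in> {-1<..<1}" using assms by (intro eventually_nhds_in_open) auto
  ultimately have "\<forall>\<^sub>F x in nhds e. envelope z < ?g x \<and> x \<in> {-1<..<1}" by (rule eventually_conj)
  then obtain \<delta> where \<delta>: "0 < \<delta>" "\<And>x. dist x e < \<delta> \<Longrightarrow> envelope z < ?g x \<and> x \<in> {-1<..<1}"
    unfolding eventually_nhds_metric by blast
  \<comment> \<open>A violation of the bound would persist at nearby rational points.\<close>
  obtain x where x: "x \<in> \<rat>" "e < x" "x < e + \<delta>" using Rats_dense_in_real[of e "e + \<delta>"] \<delta>(1) by auto
  then have x': "envelope z < ?g x" "x \<in> \<rat> \<inter> {-1<..<1}" using \<delta>(2)[of x] by (auto simp: dist_real_def)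
  have "?g x \<le> (\<Sum>a\<in>{0,1}. \<Sum>b\<in>{0,1}. \<bar>deriv (log_lik a b z) x\<bar> + \<bar>deriv (deriv (log_lik a b z)) x\<bar>)"
    using assms(3,4) by auto
  also have "\<dots> \<le> envelope z" unfolding envelope_def by (rule cSUP_upper[OF x'(2) envelope_bdd])
  finally show False using x'(1) by simp
qed

text \<open>
  The exponent \<open>q\<^sup>2 (q + 1) / 2\<close> is at least \<open>2\<close>, so the moment condition dominates the square; the \<open>Z t\<close> are
  identically distributed, so the time does not matter.
\<close>

lemma envelope_sq_integrable: "integrable M (\<lambda>\<omega>. (envelope (Z t \<omega>))\<^sup>2)" and envelope_integrable: "integrable M (\<lambda>\<omega>. envelope (Z t \<omega>))"
  and envelope_sq_ident: "expectation (\<lambda>\<omega>. (envelope (Z t \<omega>))\<^sup>2) = expectation (\<lambda>\<omega>. (envelope (Z 0 \<omega>))\<^sup>2)"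
proof -
  let ?M = "\<lambda>\<omega>. M_sup f \<phi> \<theta> q (Z 0 \<omega>) 1" and ?k = "q\<^sup>2 * (q + 1) div 2"
  have "2\<^sup>2 * (2 + 1) \<le> q\<^sup>2 * (q + 1)" using q by (intro mult_mono power_mono) auto
  then have "2 * 2 div 2 \<le> ?k" by (intro div_le_mono) simp
  then have k: "2 \<le> ?k" by simp
  have "integrable M (\<lambda>\<omega>. (envelope (Z 0 \<omega>))\<^sup>2)"
  proof (rule Bochner_Integration.integrable_bound[of M "\<lambda>\<omega>. 64 * (1 + ?M \<omega> ^ ?k)"])
    show "AE \<omega> in M. norm ((envelope (Z 0 \<omega>))\<^sup>2) \<le> norm (64 * (1 + ?M \<omega> ^ ?k))"
    proof (rule AE_I2)
      fix \<omega>
      have M0: "0 \<le> ?M \<omega>" using M_sup_upper[of 1 0 0 0 "Z 0 \<omega>"] q by simp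
      have "(?M \<omega>)\<^sup>2 \<le> 1 + ?M \<omega> ^ ?k"
      proof (cases "?M \<omega> \<le> 1")
        case True
        then have "(?M \<omega>)\<^sup>2 \<le> 1" using M0 by (simp add: power_le_one)
        then show ?thesis using M0 by (simp add: add_increasing2)
      next
        case False
        then have "(?M \<omega>)\<^sup>2 \<le> ?M \<omega> ^ ?k" using k by (intro power_increasing) auto
        then show ?thesis by simp
      qed
      moreover have "(envelope (Z 0 \<omega>))\<^sup>2 \<le> (8 * ?M \<omega>)\<^sup>2"
        by (intro power_mono envelope_le_M_sup envelope_nonneg)
      ultimately have "(envelope (Z 0 \<omega>))\<^sup>2 \<le> 64 * (1 + ?M \<omega> ^ ?k)" by (simp add: power_mult_distrib)
      then show "norm ((envelope (Z 0 \<omega>))\<^sup>2) \<le> norm (64 * (1 + ?M \<omega> ^ ?k))" by simp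
    qed
    show "integrable M (\<lambda>\<omega>. 64 * (1 + ?M \<omega> ^ ?k))"
      using moments[of 1] by (intro integrable_mult_right Bochner_Integration.integrable_add) auto
  qed measurable
  then have "integrable (distr M borel (Z 0)) (\<lambda>z. (envelope z)\<^sup>2)" by (subst integrable_distr_eq) auto
  then have "integrable (distr M borel (Z t)) (\<lambda>z. (envelope z)\<^sup>2)" using Z_ident[of 0 t] by simp
  then show 1: "integrable M (\<lambda>\<omega>. (envelope (Z t \<omega>))\<^sup>2)" by (subst (asm) integrable_distr_eq) auto
  show "integrable M (\<lambda>\<omega>. envelope (Z t \<omega>))"
  proof (rule Bochner_Integration.integrable_bound[of M "\<lambda>\<omega>. 1 + (envelope (Z t \<omega>))\<^sup>2"])
    have "\<bar>x\<bar> \<le> 1 + x\<^sup>2" for x :: real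
      using zero_le_power2[of "\<bar>x\<bar> - 1"] by (simp add: power2_eq_square algebra_simps)
    then show "AE \<omega> in M. norm (envelope (Z t \<omega>)) \<le> norm (1 + (envelope (Z t \<omega>))\<^sup>2)" by (intro AE_I2) simp
  qed (use 1 in auto)
  have "(\<integral>z. (envelope z)\<^sup>2 \<partial>distr M borel (Z t)) = (\<integral>z. (envelope z)\<^sup>2 \<partial>distr M borel (Z 0))" using Z_ident[of 0 t] by simp
  then show "expectation (\<lambda>\<omega>. (envelope (Z t \<omega>))\<^sup>2) = expectation (\<lambda>\<omega>. (envelope (Z 0 \<omega>))\<^sup>2)"
    by (simp add: integral_distr)
qed

text \<open>
  The log-likelihood ratio \<open>d\<close> of the model, with the state \<open>a\<close> and the noise \<open>z\<close> as separate arguments so that the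
  independence of chain and noise can be used.
\<close>

definition llr where "llr a z e = log_lik a 1 z e - log_lik a 0 z e"
definition llr1 where "llr1 a z e = deriv (log_lik a 1 z) e - deriv (log_lik a 0 z) e"
definition llr2 where "llr2 a z e = deriv (deriv (log_lik a 1 z)) e - deriv (deriv (log_lik a 0 z)) e"

lemma llr_derivs:
  assumes "a \<in> {0, 1}"
  shows "(llr a z has_real_derivative llr1 a z e) (at e)"
    and "(llr1 a z has_real_derivative llr2 a z e) (at e)"
    and "isCont (llr2 a z) e"
proof -
  note d = log_lik_derivs[OF assms, of 1] log_lik_derivs[OF assms, of 0]
  show "(llr a z has_real_derivative llr1 a z e) (at e)"
    unfolding llr_def[abs_def] llr1_def by (intro DERIV_diff d) auto
  show "(llr1 a z has_real_derivative llr2 a z e) (at e)"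
    unfolding llr1_def[abs_def] llr2_def by (intro DERIV_diff d) auto
  show "isCont (llr2 a z) e"
    unfolding llr2_def[abs_def] by (intro continuous_diff d) auto
qed

lemma llr_bounds:
  assumes "a \<in> {0, 1}" "-1 < e" "e < 1"
  shows "\<bar>llr1 a z e\<bar> \<le> 2 * envelope z" "\<bar>llr2 a z e\<bar> \<le> 2 * envelope z"
  using envelope_upper[OF assms(2,3,1), of 0 z] envelope_upper[OF assms(2,3,1), of 1 z]
  by (simp_all add: llr1_def llr2_def)

lemma llr_measurable:
  assumes "a \<in> {0, 1}"
  shows "(\<lambda>z. llr a z e) \<in> borel_measurable borel" "(\<lambda>z. llr1 a z e) \<in> borel_measurable borel"
    "(\<lambda>z. llr2 a z e) \<in> borel_measurable borel"
  unfolding llr_def llr1_def llr2_def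
  by (intro borel_measurable_diff log_lik_measurable assms; simp)+

lemma llr_zero: "llr a z 0 = 0"
  by (simp add: llr_def ell_def theta_zero[simplified])

abbreviation score where "score x \<tau> \<equiv> deriv (\<lambda>u. ln (f x u)) \<tau>"

lemma zero_in_Theta: "0 \<in> \<Theta>" using theta_range[of 0 0] theta_zero by simp

text \<open>
  Reads off, from the class \<open>C^2\<close> in the plane, the derivative in the parameter and its joint continuity.
\<close>

lemma score:
  shows "\<tau> \<in> \<Theta> \<Longrightarrow> ((\<lambda>u. ln (f x u)) has_real_derivative score x \<tau>) (at \<tau>)"
    and "continuous_on (UNIV \<times> \<Theta>) (\<lambda>(x, \<tau>). score x \<tau>)"
proof -
  let ?h = "\<lambda>(x, \<tau>). ln (f x \<tau>)"
  have B: "(0, 1) \<in> (Basis :: (real \<times> real) set)" by (simp add: Basis_prod_def)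
  have shift: "((\<lambda>s. ln (f x (\<tau> + s))) has_field_derivative D) (at 0) \<longleftrightarrow> ((\<lambda>u. ln (f x u)) has_field_derivative D) (at \<tau>)" for D x \<tau>
    using DERIV_at_within_shift[of "\<lambda>u. ln (f x u)" D \<tau> 0 UNIV] by (simp add: add.commute)
  show "((\<lambda>u. ln (f x u)) has_real_derivative score x \<tau>) (at \<tau>)" if "\<tau> \<in> \<Theta>"
  proof -
    have "(\<lambda>s. partial_derivs [] ?h ((x, \<tau>) + s *\<^sub>R (0, 1))) differentiable (at 0)"
      using lambda_C2 that B unfolding C_class_def partials_exist_def
      by (elim conjE allE[of _ "[]"] allE[of _ "(0, 1)"] allE[of _ "(x, \<tau>)"]) auto
    then have "(\<lambda>s. ln (f x (\<tau> + s))) differentiable (at 0)" by (simp add: partial_derivs_def)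
    then have "(\<lambda>u. ln (f x u)) differentiable (at \<tau>)" unfolding real_differentiable_def shift .
    then show ?thesis by (simp add: DERIV_deriv_iff_real_differentiable)
  qed
  have "partial_derivs [(0, 1)] ?h (x, \<tau>) = score x \<tau>" for x \<tau>
    using shift[of x \<tau>] by (simp add: partial_derivs_def partial_deriv_def deriv_def)
  then have eq: "partial_derivs [(0, 1)] ?h = (\<lambda>(x, \<tau>). score x \<tau>)" by auto
  have "\<forall>bs. set bs \<subseteq> Basis \<and> length bs \<le> 2 \<longrightarrow> continuous_on (UNIV \<times> \<Theta>) (partial_derivs bs ?h)"
    using lambda_C2 unfolding C_class_def by blast
  then have "continuous_on (UNIV \<times> \<Theta>) (partial_derivs [(0, 1)] ?h)"
    by (elim allE[of _ "[(0, 1)]"]) (use B in auto)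
  then show "continuous_on (UNIV \<times> \<Theta>) (\<lambda>(x, \<tau>). score x \<tau>)" unfolding eq .
qed

lemma theta_deriv: "a \<in> {0, 1} \<Longrightarrow> (\<theta> a has_real_derivative deriv (\<theta> a) e) (at e)"
  using C_class_imp_Ck[OF theta_C2, of a] Ck_SucD(1)[of 1 "\<theta> a"] by (simp add: numeral_2_eq_2)

text \<open>
  By the mean value theorem in the parameter, \<open>llr a z e = score (\<phi> z (\<theta> a e)) \<xi> \<cdot> (\<theta> 1 e - \<theta> 0 e)\<close> with
  \<open>\<bar>\<xi>\<bar> \<le> \<bar>\<theta> 0 e\<bar> + \<bar>\<theta> 1 e\<bar>\<close>; the argument of the score tends to \<open>(\<phi> z 0, 0)\<close>, whatever \<open>a\<close> is. Joint continuity of the score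
  thus replaces the chain rule in two variables.
\<close>

lemma llr1_zero:
  assumes a: "a \<in> {0, 1}"
  shows "llr1 a z 0 = (deriv (\<theta> 1) 0 - deriv (\<theta> 0) 0) * score (\<phi> z 0) 0"
proof -
  obtain r where r: "0 < r" "ball 0 r \<subseteq> \<Theta>" using Theta zero_in_Theta openE by blast
  have t0: "\<theta> c 0 = 0" if "c \<in> {0, 1}" for c using theta_zero that by auto
  have tc: "(\<theta> c \<longlongrightarrow> 0) (at 0)" if "c \<in> {0, 1}" for c
    using DERIV_isCont[OF theta_deriv[OF that, of 0]] t0[OF that] by (simp add: isCont_def)
  have "\<exists>\<xi>. \<bar>\<xi>\<bar> \<le> \<bar>\<theta> 0 e\<bar> + \<bar>\<theta> 1 e\<bar> \<and> (\<bar>\<theta> 0 e\<bar> < r \<and> \<bar>\<theta> 1 e\<bar> < r \<longrightarrow>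
      llr a z e = score (\<phi> z (\<theta> a e)) \<xi> * (\<theta> 1 e - \<theta> 0 e))" for e
  proof (cases "\<bar>\<theta> 0 e\<bar> < r \<and> \<bar>\<theta> 1 e\<bar> < r")
    case True
    let ?L = "\<lambda>u. ln (f (\<phi> z (\<theta> a e)) u)"
    have D: "(?L has_real_derivative score (\<phi> z (\<theta> a e)) u) (at u)" if "\<bar>u\<bar> < r" for u
      by (rule score(1)) (use r that in auto)
    have de: "llr a z e = ?L (\<theta> 1 e) - ?L (\<theta> 0 e)" by (simp add: llr_def ell_def)
    consider "\<theta> 0 e = \<theta> 1 e" | "\<theta> 0 e < \<theta> 1 e" | "\<theta> 1 e < \<theta> 0 e" by linarith
    then show ?thesis
    proof cases
      case 1
      then show ?thesis unfolding de by (intro exI[of _ 0]) simp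
    next
      case 2
      then obtain \<xi> where "\<theta> 0 e < \<xi>" "\<xi> < \<theta> 1 e" "?L (\<theta> 1 e) - ?L (\<theta> 0 e) = (\<theta> 1 e - \<theta> 0 e) * score (\<phi> z (\<theta> a e)) \<xi>"
        using MVT2[of "\<theta> 0 e" "\<theta> 1 e" ?L "\<lambda>u. score (\<phi> z (\<theta> a e)) u"] D True by (auto simp: abs_less_iff)
      then show ?thesis unfolding de by (intro exI[of _ \<xi>]) (auto simp: mult.commute)
    next
      case 3
      then obtain \<xi> where "\<theta> 1 e < \<xi>" "\<xi> < \<theta> 0 e" "?L (\<theta> 0 e) - ?L (\<theta> 1 e) = (\<theta> 0 e - \<theta> 1 e) * score (\<phi> z (\<theta> a e)) \<xi>"
        using MVT2[of "\<theta> 1 e" "\<theta> 0 e" ?L "\<lambda>u. score (\<phi> z (\<theta> a e)) u"] D True by (auto simp: abs_less_iff)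
      then show ?thesis unfolding de by (intro exI[of _ \<xi>]) (auto simp: algebra_simps)
    qed
  qed (intro exI[of _ 0], auto)
  then obtain \<xi> where \<xi>: "\<And>e. \<bar>\<xi> e\<bar> \<le> \<bar>\<theta> 0 e\<bar> + \<bar>\<theta> 1 e\<bar>"
    "\<And>e. \<bar>\<theta> 0 e\<bar> < r \<Longrightarrow> \<bar>\<theta> 1 e\<bar> < r \<Longrightarrow> llr a z e = score (\<phi> z (\<theta> a e)) (\<xi> e) * (\<theta> 1 e - \<theta> 0 e)"
    by metis
  have lim0: "((\<lambda>e. \<bar>\<theta> 0 e\<bar> + \<bar>\<theta> 1 e\<bar>) \<longlongrightarrow> \<bar>0\<bar> + \<bar>0\<bar>) (at 0)" by (intro tendsto_intros tc) auto
  have lim\<xi>: "(\<xi> \<longlongrightarrow> 0) (at 0)"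
  proof (rule Lim_null_comparison[rotated])
    show "\<forall>\<^sub>F e in at 0. norm (\<xi> e) \<le> \<bar>\<theta> 0 e\<bar> + \<bar>\<theta> 1 e\<bar>"
      unfolding real_norm_def by (intro always_eventually allI \<xi>(1))
  qed (use lim0 in simp)
  have "continuous_on \<Theta> (\<phi> z)"
  proof -
    have "\<forall>bs. set bs \<subseteq> Basis \<and> length bs \<le> 2 \<longrightarrow> continuous_on \<Theta> (partial_derivs bs (\<phi> z))"
      using phi_C2[of z] unfolding C_class_def by blast
    then show ?thesis by (elim allE[of _ "[]"]) (simp add: partial_derivs_def)
  qed
  then have "isCont (\<phi> z) 0" using Theta zero_in_Theta continuous_on_eq_continuous_at by blast
  then have lim\<phi>: "((\<lambda>e. \<phi> z (\<theta> a e)) \<longlongrightarrow> \<phi> z 0) (at 0)"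
    by (rule isCont_tendsto_compose[OF _ tc[OF a]])
  have "isCont (\<lambda>(x, \<tau>). score x \<tau>) (\<phi> z 0, 0)"
    using score(2) Theta zero_in_Theta continuous_on_eq_continuous_at[of "UNIV \<times> \<Theta>"]
    by (auto simp: open_Times)
  from isCont_tendsto_compose[OF this tendsto_Pair[OF lim\<phi> lim\<xi>]]
  have lims: "((\<lambda>e. score (\<phi> z (\<theta> a e)) (\<xi> e)) \<longlongrightarrow> score (\<phi> z 0) 0) (at 0)" by simp
  have "((\<lambda>e. \<theta> 1 e - \<theta> 0 e) has_real_derivative deriv (\<theta> 1) 0 - deriv (\<theta> 0) 0) (at 0)"
    by (intro DERIV_diff theta_deriv) auto
  then have limq: "((\<lambda>e. (\<theta> 1 e - \<theta> 0 e) / e) \<longlongrightarrow> deriv (\<theta> 1) 0 - deriv (\<theta> 0) 0) (at 0)"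
    by (simp add: has_field_derivative_iff t0[simplified])
  have "((\<lambda>e. (llr a z e - llr a z 0) / (e - 0)) \<longlongrightarrow> score (\<phi> z 0) 0 * (deriv (\<theta> 1) 0 - deriv (\<theta> 0) 0)) (at 0)"
  proof (rule Lim_transform_eventually[OF tendsto_mult[OF lims limq]])
    have "\<forall>\<^sub>F e in at 0. \<bar>\<theta> c e\<bar> < r" if "c \<in> {0, 1}" for c
      using tendsto_rabs[OF tc[OF that]] r by (intro order_tendstoD(2)) auto
    from this[of 0] this[of 1] have "\<forall>\<^sub>F e in at 0. \<bar>\<theta> 0 e\<bar> < r \<and> \<bar>\<theta> 1 e\<bar> < r"
      by (auto intro: eventually_conj)
    then show "\<forall>\<^sub>F e in at 0. score (\<phi> z (\<theta> a e)) (\<xi> e) * ((\<theta> 1 e - \<theta> 0 e) / e) = (llr a z e - llr a z 0) / (e - 0)"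
      by eventually_elim (simp add: \<xi>(2) llr_zero)
  qed
  then have "(llr a z has_real_derivative score (\<phi> z 0) 0 * (deriv (\<theta> 1) 0 - deriv (\<theta> 0) 0)) (at 0)"
    unfolding has_field_derivative_iff .
  from DERIV_unique[OF llr_derivs(1)[OF a] this] show ?thesis by (simp add: mult.commute)
qed

lemma f_measurable: "\<tau> \<in> \<Theta> \<Longrightarrow> (\<lambda>x. f x \<tau>) \<in> borel_measurable borel"
proof -
  assume \<tau>: "\<tau> \<in> \<Theta>"
  have "(\<lambda>x. ennreal (f x \<tau>)) \<in> borel_measurable lborel" using density[OF \<tau>, of 0] by (simp add: distributed_def)
  then have "(\<lambda>x. enn2real (ennreal (f x \<tau>))) \<in> borel_measurable borel" by simp
  then show ?thesis using lambda_real[OF \<tau>] by (simp add: less_imp_le)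
qed

text \<open>
  \<open>llr a z e = W (\<phi> z (\<theta> a e))\<close> for a single function \<open>W\<close> of the observation, and \<open>exp W\<close> is the quotient of the densities
  in the states \<open>1\<close> and \<open>0\<close>.
\<close>

lemma change_of_density:
  assumes U [measurable]: "U \<in> borel_measurable borel"
  shows "expectation (\<lambda>\<omega>. U (llr 1 (Z t \<omega>) e)) = expectation (\<lambda>\<omega>. exp (llr 0 (Z t \<omega>) e) * U (llr 0 (Z t \<omega>) e))"
proof -
  define W where "W x = ln (f x (\<theta> 1 e)) - ln (f x (\<theta> 0 e))" for x
  have T: "\<theta> 0 e \<in> \<Theta>" "\<theta> 1 e \<in> \<Theta>" using theta_range by auto
  note [measurable] = f_measurable[OF T(1)] f_measurable[OF T(2)]
  note pos = lambda_real[OF T(1)] lambda_real[OF T(2)]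
  have [measurable]: "W \<in> borel_measurable borel" unfolding W_def[abs_def] by measurable
  have dW: "llr a z e = W (\<phi> z (\<theta> a e))" for a z by (simp add: llr_def ell_def W_def)
  have "expectation (\<lambda>\<omega>. U (llr 1 (Z t \<omega>) e)) = (\<integral>x. f x (\<theta> 1 e) * U (W x) \<partial>lborel)"
    unfolding dW by (rule distributed_integral[OF density[OF T(2)], symmetric]) (use pos in \<open>auto simp: less_imp_le\<close>)
  also have "\<dots> = (\<integral>x. f x (\<theta> 0 e) * (exp (W x) * U (W x)) \<partial>lborel)"
    using pos by (intro Bochner_Integration.integral_cong refl) (simp add: W_def exp_diff less_imp_neq[symmetric])
  also have "\<dots> = expectation (\<lambda>\<omega>. exp (llr 0 (Z t \<omega>) e) * U (llr 0 (Z t \<omega>) e))"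
    unfolding dW by (rule distributed_integral[OF density[OF T(1)]]) (use pos in \<open>auto simp: less_imp_le\<close>)
  finally show ?thesis .
qed

lemma llr_integrable:
  assumes "a \<in> {0, 1}"
  shows "integrable M (\<lambda>\<omega>. llr1 a (Z t \<omega>) 0)" "integrable M (\<lambda>\<omega>. (llr1 a (Z t \<omega>) 0)\<^sup>2)"
    "integrable M (\<lambda>\<omega>. llr2 a (Z t \<omega>) 0)"
proof -
  note [measurable] = llr_measurable[OF assms]
  have 2: "integrable M (\<lambda>\<omega>. 2 * envelope (Z t \<omega>))" using envelope_integrable by simp
  have 4: "integrable M (\<lambda>\<omega>. 4 * (envelope (Z t \<omega>))\<^sup>2)" using envelope_sq_integrable by simp
  show "integrable M (\<lambda>\<omega>. llr1 a (Z t \<omega>) 0)" "integrable M (\<lambda>\<omega>. llr2 a (Z t \<omega>) 0)"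
    by (rule Bochner_Integration.integrable_bound[OF 2], measurable,
       use llr_bounds[OF assms, of 0] envelope_nonneg in simp)+
  show "integrable M (\<lambda>\<omega>. (llr1 a (Z t \<omega>) 0)\<^sup>2)"
  proof (rule Bochner_Integration.integrable_bound[OF 4])
    have "(llr1 a z 0)\<^sup>2 \<le> 4 * (envelope z)\<^sup>2" for z
      using power_mono[OF llr_bounds(1)[OF assms, of 0 z], of 2] by (simp add: power_mult_distrib)
    then show "AE \<omega> in M. norm ((llr1 a (Z t \<omega>) 0)\<^sup>2) \<le> norm (4 * (envelope (Z t \<omega>))\<^sup>2)" by simp
  qed measurable
qed

text \<open>
  Both sides of \<open>change_of_density\<close>, expanded to second order at \<open>e = 0\<close>. Boundedness of \<open>U\<close>, \<open>V = exp \<cdot> U\<close> and of their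
  derivatives makes the square of the envelope a majorant; \<open>exp d\<close> by itself need not have an integrable one.
\<close>

lemma change_of_density_expansion:
  fixes U V U1 V1 U2 V2 :: "real \<Rightarrow> real" and t :: int
  assumes UV: "\<And>w. V w = exp w * U w"
    and d: "\<And>w. (U has_real_derivative U1 w) (at w)" "\<And>w. (V has_real_derivative V1 w) (at w)"
      "\<And>w. (U1 has_real_derivative U2 w) (at w)" "\<And>w. (V1 has_real_derivative V2 w) (at w)"
    and c: "isCont U2 0" "isCont V2 0"
    and b: "\<And>w. \<bar>U w\<bar> \<le> 1" "\<And>w. \<bar>V w\<bar> \<le> 1" "\<And>w. \<bar>U1 w\<bar> \<le> 1" "\<And>w. \<bar>V1 w\<bar> \<le> 1" "\<And>w. \<bar>U2 w\<bar> \<le> 1" "\<And>w. \<bar>V2 w\<bar> \<le> 1"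
  defines "X \<equiv> \<lambda>a \<omega>. llr1 a (Z t \<omega>) 0" and "Y \<equiv> \<lambda>a \<omega>. llr2 a (Z t \<omega>) 0"
  shows "U1 0 * expectation (X 1) = V1 0 * expectation (X 0)"
    and "U2 0 * expectation (\<lambda>\<omega>. (X 1 \<omega>)\<^sup>2) + U1 0 * expectation (Y 1)
       = V2 0 * expectation (\<lambda>\<omega>. (X 0 \<omega>)\<^sup>2) + V1 0 * expectation (Y 0)"
proof -
  define h where "h \<omega> e = U (llr 1 (Z t \<omega>) e) - V (llr 0 (Z t \<omega>) e)" for \<omega> e
  define h1 where "h1 \<omega> e = U1 (llr 1 (Z t \<omega>) e) * llr1 1 (Z t \<omega>) e - V1 (llr 0 (Z t \<omega>) e) * llr1 0 (Z t \<omega>) e" for \<omega> e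
  define h2 where "h2 \<omega> e = (U2 (llr 1 (Z t \<omega>) e) * (llr1 1 (Z t \<omega>) e)\<^sup>2 + U1 (llr 1 (Z t \<omega>) e) * llr2 1 (Z t \<omega>) e)
    - (V2 (llr 0 (Z t \<omega>) e) * (llr1 0 (Z t \<omega>) e)\<^sup>2 + V1 (llr 0 (Z t \<omega>) e) * llr2 0 (Z t \<omega>) e)" for \<omega> e
  define C where "C \<omega> = 8 * (envelope (Z t \<omega>))\<^sup>2 + 4 * envelope (Z t \<omega>)" for \<omega>
  have one: "1 \<in> {0, 1::nat}" and zero: "0 \<in> {0, 1::nat}" by auto
  note D1 = llr_derivs[OF one] and D0 = llr_derivs[OF zero]
  note [measurable] = llr_measurable[OF one] llr_measurable[OF zero]
  have cont: "continuous_on UNIV U" "continuous_on UNIV V"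
    using d by (auto intro: DERIV_continuous_on has_field_derivative_at_within)
  then have [measurable]: "U \<in> borel_measurable borel" "V \<in> borel_measurable borel"
    by (auto intro: borel_measurable_continuous_onI)
  have iU: "integrable M (\<lambda>\<omega>. U (llr 1 (Z t \<omega>) e))" and iV: "integrable M (\<lambda>\<omega>. V (llr 0 (Z t \<omega>) e))" for e
    by (rule integrable_const_bound[where B = 1], use b in simp, measurable)+
  have prod: "\<bar>u * x\<bar> \<le> c" if "\<bar>u\<bar> \<le> 1" "\<bar>x\<bar> \<le> c" for u x c :: real
    using mult_mono[OF that] by (simp add: abs_mult)
  have eq0: "(\<lambda>\<omega>. h1 \<omega> 0) = (\<lambda>\<omega>. U1 0 * X 1 \<omega> - V1 0 * X 0 \<omega>)"
    "(\<lambda>\<omega>. h2 \<omega> 0) = (\<lambda>\<omega>. (U2 0 * (X 1 \<omega>)\<^sup>2 + U1 0 * Y 1 \<omega>) - (V2 0 * (X 0 \<omega>)\<^sup>2 + V1 0 * Y 0 \<omega>))"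
    by (simp_all add: h1_def h2_def X_def Y_def llr_zero)
  have sq: "(llr1 a z e)\<^sup>2 \<le> 4 * (envelope z)\<^sup>2" if "a \<in> {0, 1}" "-1 < e" "e < 1" for a z e
    using power_mono[OF llr_bounds(1)[OF that, of z], of 2] by (simp add: power_mult_distrib)
  have "expectation (\<lambda>\<omega>. h1 \<omega> 0) = 0 \<and> expectation (\<lambda>\<omega>. h2 \<omega> 0) = 0"
  proof (rule expectation_derivs_zero[of h h1 h2 C])
    show "expectation (\<lambda>\<omega>. h \<omega> e) = 0" for e
      unfolding h_def using change_of_density[of U t e] iU iV by (simp add: UV)
    show "(\<lambda>\<omega>. h \<omega> e) \<in> borel_measurable M" for e unfolding h_def by measurable
    show "(\<lambda>\<omega>. h1 \<omega> 0) \<in> borel_measurable M" "(\<lambda>\<omega>. h2 \<omega> 0) \<in> borel_measurable M"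
      unfolding eq0 X_def Y_def by measurable
    show "(h \<omega> has_real_derivative h1 \<omega> e) (at e)" for \<omega> e
      unfolding h_def[abs_def] h1_def by (intro DERIV_diff DERIV_chain2[OF d(1)] DERIV_chain2[OF d(2)] D1 D0)
    show "(h1 \<omega> has_real_derivative h2 \<omega> e) (at e)" for \<omega> e
      unfolding h1_def[abs_def] h2_def
      by (rule DERIV_cong[OF DERIV_diff[OF DERIV_mult[OF DERIV_chain2[OF d(3) D1(1)] D1(2)] DERIV_mult[OF DERIV_chain2[OF d(4) D0(1)] D0(2)]]])
         (simp add: power2_eq_square algebra_simps)
    show "isCont (h2 \<omega>) 0" for \<omega>
    proof -
      have "isCont (\<lambda>e. U2 (llr 1 (Z t \<omega>) e)) 0" "isCont (\<lambda>e. V2 (llr 0 (Z t \<omega>) e)) 0"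
        using isCont_o2[OF DERIV_isCont[OF D1(1)[of "Z t \<omega>" 0]], where g = U2]
          isCont_o2[OF DERIV_isCont[OF D0(1)[of "Z t \<omega>" 0]], where g = V2] c
        by (simp_all add: llr_zero)
      moreover have "isCont (\<lambda>e. U1 (llr 1 (Z t \<omega>) e)) 0" "isCont (\<lambda>e. V1 (llr 0 (Z t \<omega>) e)) 0"
        by (rule DERIV_isCont, rule DERIV_chain2, rule d, rule D1 D0)+
      moreover have "isCont (llr1 1 (Z t \<omega>)) 0" "isCont (llr1 0 (Z t \<omega>)) 0"
        using DERIV_isCont[OF D1(2)] DERIV_isCont[OF D0(2)] by auto
      ultimately show ?thesis unfolding h2_def[abs_def]
        by (intro continuous_diff continuous_add continuous_mult continuous_power D1(3) D0(3))
    qed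
    show "integrable M C" unfolding C_def
      by (intro Bochner_Integration.integrable_add integrable_mult_right envelope_sq_integrable envelope_integrable)
    show "\<bar>h1 \<omega> e\<bar> \<le> C \<omega>" if "-1 < e" "e < 1" for \<omega> e
    proof -
      have "\<bar>h1 \<omega> e\<bar> \<le> 2 * envelope (Z t \<omega>) + 2 * envelope (Z t \<omega>)"
        unfolding h1_def by (intro order.trans[OF abs_triangle_ineq4] add_mono prod b llr_bounds that one zero)
      then show ?thesis unfolding C_def using zero_le_power2[of "envelope (Z t \<omega>)"] by linarith
    qed
    show "\<bar>h2 \<omega> e\<bar> \<le> C \<omega>" if "-1 < e" "e < 1" for \<omega> e
    proof -
      have sq': "\<bar>(llr1 1 (Z t \<omega>) e)\<^sup>2\<bar> \<le> 4 * (envelope (Z t \<omega>))\<^sup>2" "\<bar>(llr1 0 (Z t \<omega>) e)\<^sup>2\<bar> \<le> 4 * (envelope (Z t \<omega>))\<^sup>2"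
        using sq[OF one that] sq[OF zero that] by simp_all
      have "\<bar>h2 \<omega> e\<bar> \<le> (4 * (envelope (Z t \<omega>))\<^sup>2 + 2 * envelope (Z t \<omega>)) + (4 * (envelope (Z t \<omega>))\<^sup>2 + 2 * envelope (Z t \<omega>))"
        unfolding h2_def
        by (intro order.trans[OF abs_triangle_ineq4] order.trans[OF abs_triangle_ineq] add_mono prod b sq' llr_bounds that one zero)
      then show ?thesis unfolding C_def by linarith
    qed
    show "integrable M (\<lambda>\<omega>. h \<omega> 0)" unfolding h_def by (intro Bochner_Integration.integrable_diff iU iV)
  qed
  moreover have "integrable M (X 1)" "integrable M (X 0)" "integrable M (Y 1)" "integrable M (Y 0)"
     "integrable M (\<lambda>\<omega>. (X 1 \<omega>)\<^sup>2)" "integrable M (\<lambda>\<omega>. (X 0 \<omega>)\<^sup>2)"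
    unfolding X_def Y_def using llr_integrable by auto
  ultimately show "U1 0 * expectation (X 1) = V1 0 * expectation (X 0)"
    "U2 0 * expectation (\<lambda>\<omega>. (X 1 \<omega>)\<^sup>2) + U1 0 * expectation (Y 1)
       = V2 0 * expectation (\<lambda>\<omega>. (X 0 \<omega>)\<^sup>2) + V1 0 * expectation (Y 0)"
    unfolding eq0 by simp_all
qed

text \<open>
  Two choices of \<open>U\<close> determine the three moments. With \<open>s\<close> the logistic function, which is \<open>tilt (1/2)\<close>, take
  \<open>U = 1 - s\<close>, \<open>exp \<cdot> U = s\<close> and \<open>U = (1 - s)\<^sup>2\<close>, \<open>exp \<cdot> U = s (1 - s)\<close>. The first derivatives of
  \<open>llr 0\<close> and \<open>llr 1\<close> at \<open>0\<close> coincide. The first choice shows that their mean vanishes and that the second derivatives have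
  opposite means; the second one identifies the latter with the variance.
\<close>

lemma llr_moments:
  shows "expectation (\<lambda>\<omega>. llr1 0 (Z t \<omega>) 0) = 0"
    and "expectation (\<lambda>\<omega>. llr2 1 (Z t \<omega>) 0) = expectation (\<lambda>\<omega>. (llr1 0 (Z t \<omega>) 0)\<^sup>2)"
    and "expectation (\<lambda>\<omega>. llr2 0 (Z t \<omega>) 0) = - expectation (\<lambda>\<omega>. (llr1 0 (Z t \<omega>) 0)\<^sup>2)"
proof -
  let ?s = "tilt (1/2)" and ?v = "tilt_var (1/2)"
  have h: "0 < (1/2::real)" "(1/2::real) < 1" by simp_all
  note ds = tilt_deriv[OF h] and dv = tilt_var_deriv[OF h]
  have s0: "?s 0 = 1/2" "?v 0 = 1/4" by (simp_all add: tilt_def tilt_var_def)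
  note bs = tilt_bounds[OF h] and bv = tilt_var_bounds[OF h]
  have cs: "isCont ?s w" "isCont ?v w" for w using DERIV_isCont[OF ds] DERIV_isCont[OF dv] by auto
  have exps: "exp w * (1 - ?s w) = ?s w" for w
    using denom_pos[OF h, of w] by (simp add: tilt_def field_simps)
  have same: "llr1 1 z 0 = llr1 0 z 0" for z by (simp add: llr1_zero)
  have absv: "\<bar>?v w\<bar> \<le> 1/4" for w using bv[of w] by simp
  have abs2: "\<bar>1 - 2 * ?s w\<bar> \<le> 1" for w using bs[of w] by simp
  have vd: "\<bar>?v w * (1 - 2 * ?s w)\<bar> \<le> 1/4" for w by (rule tilt_var_deriv_bound[OF h])
  have s1: "\<bar>1 - ?s w\<bar> \<le> 1" for w using bs[of w] by simp
  have vv: "\<bar>?v w * ?v w\<bar> \<le> 1/4 * (1/4)" for w unfolding abs_mult by (intro mult_mono absv) auto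
  have A: "- (1/4) * expectation (\<lambda>\<omega>. llr1 0 (Z t \<omega>) 0) = 1/4 * expectation (\<lambda>\<omega>. llr1 0 (Z t \<omega>) 0)"
    "- (1/4) * expectation (\<lambda>\<omega>. llr2 1 (Z t \<omega>) 0) = 1/4 * expectation (\<lambda>\<omega>. llr2 0 (Z t \<omega>) 0)"
  proof -
    have d: "((\<lambda>w. 1 - ?s w) has_real_derivative - ?v w) (at w)"
      "((\<lambda>w. - ?v w) has_real_derivative - (?v w * (1 - 2 * ?s w))) (at w)" for w
      using DERIV_diff[OF DERIV_const ds, of 1 w] DERIV_minus[OF dv, of w] by simp_all
    have c: "isCont (\<lambda>w. - (?v w * (1 - 2 * ?s w))) 0" "isCont (\<lambda>w. ?v w * (1 - 2 * ?s w)) 0"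
      by (intro continuous_intros cs)+
    have b: "\<bar>?s w\<bar> \<le> 1" "\<bar>?v w\<bar> \<le> 1" "\<bar>- ?v w\<bar> \<le> 1" for w
      using bs[of w] absv[of w] by simp_all
    have b': "\<bar>?v w * (1 - 2 * ?s w)\<bar> \<le> 1" "\<bar>- (?v w * (1 - 2 * ?s w))\<bar> \<le> 1" for w
      using vd[of w] unfolding abs_minus_cancel by linarith+
    note E = change_of_density_expansion[OF exps[symmetric] d(1) ds d(2) dv c s1 b(1,3,2) b'(2,1), of t]
    show "- (1/4) * expectation (\<lambda>\<omega>. llr1 0 (Z t \<omega>) 0) = 1/4 * expectation (\<lambda>\<omega>. llr1 0 (Z t \<omega>) 0)"
      using E(1) by (simp add: s0 same del: One_nat_def)
    show "- (1/4) * expectation (\<lambda>\<omega>. llr2 1 (Z t \<omega>) 0) = 1/4 * expectation (\<lambda>\<omega>. llr2 0 (Z t \<omega>) 0)"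
      using E(2) by (simp add: s0)
  qed
  show "expectation (\<lambda>\<omega>. llr1 0 (Z t \<omega>) 0) = 0" using A(1) by simp
  have B: "1/8 * expectation (\<lambda>\<omega>. (llr1 0 (Z t \<omega>) 0)\<^sup>2) - 1/4 * expectation (\<lambda>\<omega>. llr2 1 (Z t \<omega>) 0)
    = - (1/8) * expectation (\<lambda>\<omega>. (llr1 0 (Z t \<omega>) 0)\<^sup>2)"
  proof -
    let ?U1 = "\<lambda>w. - 2 * ((1 - ?s w) * ?v w)"
      and ?U2 = "\<lambda>w. 2 * (?v w * ?v w) - 2 * ((1 - ?s w) * (?v w * (1 - 2 * ?s w)))"
      and ?V2 = "\<lambda>w. ?v w * (1 - 2 * ?s w) * (1 - 2 * ?s w) - 2 * (?v w * ?v w)"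
    have UV: "?v w = exp w * (1 - ?s w)\<^sup>2" for w
      using exps[of w] by (simp add: tilt_var_def power2_eq_square mult.assoc[symmetric])
    have d1: "((\<lambda>w. (1 - ?s w)\<^sup>2) has_real_derivative ?U1 w) (at w)" for w
      by (rule DERIV_cong[OF DERIV_power[OF DERIV_diff[OF DERIV_const ds]]]) simp
    have d2: "(?U1 has_real_derivative ?U2 w) (at w)" for w
      by (rule DERIV_cong[OF DERIV_cmult[OF DERIV_mult[OF DERIV_diff[OF DERIV_const ds] dv]]]) (simp add: algebra_simps)
    have d3: "((\<lambda>w. ?v w * (1 - 2 * ?s w)) has_real_derivative ?V2 w) (at w)" for w
      by (rule DERIV_cong[OF DERIV_mult[OF dv DERIV_diff[OF DERIV_const DERIV_cmult[OF ds]]]]) (simp add: algebra_simps)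
    have c: "isCont ?U2 0" "isCont ?V2 0" by (intro continuous_intros cs)+
    have sv: "\<bar>(1 - ?s w) * ?v w\<bar> \<le> 1 * (1/4)" for w unfolding abs_mult by (intro mult_mono s1 absv) auto
    have ssv: "\<bar>(1 - ?s w) * (?v w * (1 - 2 * ?s w))\<bar> \<le> 1 * (1/4)" for w
      unfolding abs_mult[of "1 - ?s w"] by (intro mult_mono s1 vd) auto
    have vss: "\<bar>?v w * (1 - 2 * ?s w) * (1 - 2 * ?s w)\<bar> \<le> 1/4 * 1" for w
      using mult_mono[OF vd[of w] abs2[of w]] by (simp add: abs_mult)
    have "\<bar>(1 - ?s w)\<^sup>2\<bar> \<le> 1" for w using power_mono[OF s1[of w], of 2] by simp
    moreover have "\<bar>?v w\<bar> \<le> 1" for w using absv[of w] by simp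
    moreover have "\<bar>?U1 w\<bar> \<le> 1" for w using sv[of w] unfolding abs_le_iff by linarith
    moreover have "\<bar>?v w * (1 - 2 * ?s w)\<bar> \<le> 1" for w using vd[of w] by simp
    moreover have "\<bar>?U2 w\<bar> \<le> 1" for w using ssv[of w] vv[of w] unfolding abs_le_iff by linarith
    moreover have "\<bar>?V2 w\<bar> \<le> 1" for w using vss[of w] vv[of w] unfolding abs_le_iff by linarith
    ultimately have "?U2 0 * expectation (\<lambda>\<omega>. (llr1 1 (Z t \<omega>) 0)\<^sup>2) + ?U1 0 * expectation (\<lambda>\<omega>. llr2 1 (Z t \<omega>) 0)
       = ?V2 0 * expectation (\<lambda>\<omega>. (llr1 0 (Z t \<omega>) 0)\<^sup>2) + ?v 0 * (1 - 2 * ?s 0) * expectation (\<lambda>\<omega>. llr2 0 (Z t \<omega>) 0)"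
      by (rule change_of_density_expansion(2)[OF UV d1 dv d2 d3 c])
    then show ?thesis by (simp add: s0 same del: One_nat_def)
  qed
  show "expectation (\<lambda>\<omega>. llr2 1 (Z t \<omega>) 0) = expectation (\<lambda>\<omega>. (llr1 0 (Z t \<omega>) 0)\<^sup>2)"
    and "expectation (\<lambda>\<omega>. llr2 0 (Z t \<omega>) 0) = - expectation (\<lambda>\<omega>. (llr1 0 (Z t \<omega>) 0)\<^sup>2)"
    using A(2) B by linarith+
qed

text \<open>
  The variance of \<open>d\<^sub>t'(0)\<close>, whose mean is \<open>0\<close>.
\<close>

definition V where "V = expectation (\<lambda>\<omega>. (llr1 0 (Z 0 \<omega>) 0)\<^sup>2)"

lemma llr1_sq_expectation: "expectation (\<lambda>\<omega>. (llr1 0 (Z t \<omega>) 0)\<^sup>2) = (deriv (\<theta> 1) 0 - deriv (\<theta> 0) 0)\<^sup>2 * fisher_info f 0"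
proof -
  have "continuous_on UNIV ((\<lambda>(x, \<tau>). score x \<tau>) \<circ> (\<lambda>x. (x, 0)))"
    using score(2) zero_in_Theta by (intro continuous_on_compose continuous_intros) (auto elim: continuous_on_subset)
  then have [measurable]: "(\<lambda>x. score x 0) \<in> borel_measurable borel"
    by (intro borel_measurable_continuous_onI) (simp add: comp_def)
  have "expectation (\<lambda>\<omega>. (score (\<phi> (Z t \<omega>) 0) 0)\<^sup>2) = (\<integral>x. f x 0 * (score x 0)\<^sup>2 \<partial>lborel)"
    by (rule distributed_integral[OF density[OF zero_in_Theta], symmetric])
       (use lambda_real[OF zero_in_Theta] in \<open>auto simp: less_imp_le\<close>)
  then show ?thesis by (simp add: llr1_zero power_mult_distrib fisher_info_def mult.commute)
qed

text \<open>
  This is \<open>d\<^sub>t'(0)\<close> in either state, by \<open>llr1_same\<close>.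
\<close>

abbreviation "X t \<omega> \<equiv> llr1 0 (Z t \<omega>) 0"

lemma states: "1 \<in> {0, 1::nat}" "0 \<in> {0, 1::nat}" by auto

lemma llr1_same: "a \<in> {0,1} \<Longrightarrow> llr1 a z 0 = llr1 0 z 0" by (simp add: llr1_zero)

lemma log_lr_eq: "log_lr f \<phi> \<theta> \<eta> Z t e \<omega> = llr (\<eta> t \<omega>) (Z t \<omega>) e"
  by (simp add: log_lr_def psi_def obs_def llr_def ell_def)

lemma X_sq: "expectation (\<lambda>\<omega>. (X t \<omega>)\<^sup>2) = V"
  unfolding V_def llr1_sq_expectation ..

abbreviation "F \<equiv> path_algebra M (count_space {0, 1}) \<eta>"
abbreviation "G \<equiv> path_algebra M borel Z"

lemma path_coordinate:
  assumes "\<And>t. Y t \<in> measurable M N"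
  shows "Y t \<in> measurable (path_algebra M N Y) N"
proof -
  have "(\<lambda>\<omega> t. Y t \<omega>) \<in> space M \<rightarrow> space (PiM UNIV (\<lambda>_::int. N))"
    using measurable_space[OF assms] by (auto simp: space_PiM)
  then have "(\<lambda>\<omega> t. Y t \<omega>) \<in> measurable (path_algebra M N Y) (PiM UNIV (\<lambda>_::int. N))"
    unfolding path_algebra_def by (rule measurable_vimage_algebra1)
  from measurable_compose[OF this measurable_component_singleton[of t]] show ?thesis by simp
qed

lemma space_path: "space (path_algebra M N Y) = space M" by (simp add: path_algebra_def)

lemma F_events: "A \<in> sets F \<Longrightarrow> A \<in> events"
  using indep by (auto simp: indep_sets2_eq)

lemma subalgebra_F: "subalgebra M F"
  using F_events by (auto simp: subalgebra_def space_path)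

lemma eta_F [measurable]: "\<eta> t \<in> measurable F (count_space UNIV)"
  by (rule measurable_compose[OF path_coordinate[of \<eta>, OF eta_rv]]) simp

lemma Z_G [measurable]: "Z t \<in> measurable G borel"
  by (rule path_coordinate) (rule Z_rv)

text \<open>
  Independence of \<open>Z\<close> and \<open>\<eta>\<close> in the form in which conditional expectations given \<open>\<eta>\<close> are computed.
\<close>

lemma indep_integral:
  fixes H :: "'w \<Rightarrow> real"
  assumes A: "A \<in> sets F" and H: "H \<in> borel_measurable G" "integrable M H"
  shows "expectation (\<lambda>\<omega>. indicator A \<omega> * H \<omega>) = prob A * expectation H"
proof -
  have [measurable]: "A \<in> events" by (rule F_events[OF A])
  have HM: "H \<in> borel_measurable M" using H(2) by auto
  have "indep_var borel H borel (indicator A :: _ \<Rightarrow> real)"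
    unfolding indep_var_eq
  proof (intro conjI HM)
    show "random_variable borel (indicator A :: _ \<Rightarrow> real)" by measurable
    have iA: "(indicator A :: _ \<Rightarrow> real) \<in> borel_measurable F" using A by measurable
    have 1: "sigma_sets (space M) {h -` B \<inter> space M |B. B \<in> sets borel} \<subseteq> sets N"
      if "h \<in> borel_measurable N" "space N = space M" for N and h :: "'w \<Rightarrow> real"
    proof -
      have "{h -` B \<inter> space N |B. B \<in> sets borel} \<subseteq> sets N" using measurable_sets[OF that(1)] by auto
      from sets.sigma_sets_subset[OF this] show ?thesis using that(2) by simp
    qed
    show "indep_set (sigma_sets (space M) {H -` A \<inter> space M |A. A \<in> sets borel})
        (sigma_sets (space M) {indicator A -` B \<inter> space M |B. B \<in> sets (borel :: real measure)})"
      using 1[OF H(1) space_path] 1[OF iA space_path] indep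
      unfolding indep_sets2_eq by blast
  qed
  from indep_var_lebesgue_integral[OF this H(2)]
  have "expectation (\<lambda>\<omega>. H \<omega> * indicator A \<omega>) = expectation H * expectation (indicator A)"
    by (simp add: less_top[symmetric])
  then show ?thesis by (simp add: mult.commute)
qed

lemma X_G: "X t \<in> borel_measurable G"
  by (rule measurable_compose[OF Z_G llr_measurable(2)[OF states(2)]])

lemma X_product:
  fixes s t :: int
  shows "integrable M (\<lambda>\<omega>. X s \<omega> * X t \<omega>)"
    and "expectation (\<lambda>\<omega>. X s \<omega> * X t \<omega>) = (if s = t then V else 0)"
proof -
  note i = llr_integrable[OF states(2)]
  have m: "X t \<in> borel_measurable M" for t using i(1)[of t] by auto
  show "integrable M (\<lambda>\<omega>. X s \<omega> * X t \<omega>)"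
  proof (rule Bochner_Integration.integrable_bound[of M "\<lambda>\<omega>. (X s \<omega>)\<^sup>2 + (X t \<omega>)\<^sup>2"])
    have "\<bar>x * y\<bar> \<le> x\<^sup>2 + y\<^sup>2" for x y :: real
      using zero_le_power2[of "x - y"] zero_le_power2[of "x + y"] zero_le_power2[of x] zero_le_power2[of y]
      unfolding power2_diff power2_sum abs_le_iff by linarith
    then show "AE \<omega> in M. norm (X s \<omega> * X t \<omega>) \<le> norm ((X s \<omega>)\<^sup>2 + (X t \<omega>)\<^sup>2)" by simp
  qed (use i m in auto)
  show "expectation (\<lambda>\<omega>. X s \<omega> * X t \<omega>) = (if s = t then V else 0)"
  proof (cases "s = t")
    case True then show ?thesis using X_sq[of t] by (simp add: power2_eq_square)
  next
    case False
    have "indep_vars (\<lambda>_. borel) X UNIV"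
      using indep_vars_compose2[OF Z_indep, of "\<lambda>_ z. llr1 0 z 0" "\<lambda>_. borel"] llr_measurable(2)[OF states(2)]
      by simp
    from indep_vars_subset[OF this, of "{s, t}"]
    have "expectation (\<lambda>\<omega>. \<Prod>i\<in>{s, t}. X i \<omega>) = (\<Prod>i\<in>{s, t}. expectation (X i))"
      by (intro indep_vars_lebesgue_integral i) auto
    then show ?thesis using False by (simp add: llr_moments(1))
  qed
qed

lemma linear_X_square:
  fixes c :: "nat \<Rightarrow> real"
  assumes "A \<in> sets F" and fin: "finite I"
  shows "integrable M (\<lambda>\<omega>. (\<Sum>t\<in>I. c t * X (int t) \<omega>)\<^sup>2)"
    and "expectation (\<lambda>\<omega>. indicator A \<omega> * (\<Sum>t\<in>I. c t * X (int t) \<omega>)\<^sup>2) = prob A * (V * (\<Sum>t\<in>I. (c t)\<^sup>2))"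
proof -
  have eq: "(\<lambda>\<omega>. (\<Sum>t\<in>I. c t * X (int t) \<omega>)\<^sup>2) = (\<lambda>\<omega>. \<Sum>s\<in>I. \<Sum>t\<in>I. (c s * c t) * (X (int s) \<omega> * X (int t) \<omega>))"
    by (simp add: power2_eq_square sum_product mult_ac)
  show int: "integrable M (\<lambda>\<omega>. (\<Sum>t\<in>I. c t * X (int t) \<omega>)\<^sup>2)"
    unfolding eq by (intro Bochner_Integration.integrable_sum integrable_mult_right X_product)
  have "expectation (\<lambda>\<omega>. (\<Sum>t\<in>I. c t * X (int t) \<omega>)\<^sup>2) = (\<Sum>s\<in>I. \<Sum>t\<in>I. (c s * c t) * (if int s = int t then V else 0))"
    unfolding eq
    by (simp only: Bochner_Integration.integral_sum integral_mult_right_zero X_product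
        Bochner_Integration.integrable_sum integrable_mult_right)
  also have "\<dots> = V * (\<Sum>t\<in>I. (c t)\<^sup>2)"
    using fin by (simp add: sum_distrib_left power2_eq_square mult_ac if_distrib[of "\<lambda>x. _ * x"] cong: if_cong)
  finally have E: "expectation (\<lambda>\<omega>. (\<Sum>t\<in>I. c t * X (int t) \<omega>)\<^sup>2) = V * (\<Sum>t\<in>I. (c t)\<^sup>2)" .
  have "(\<lambda>\<omega>. (\<Sum>t\<in>I. c t * X (int t) \<omega>)\<^sup>2) \<in> borel_measurable G"
    by (intro borel_measurable_power borel_measurable_sum borel_measurable_times borel_measurable_const X_G)
  from indep_integral[OF assms(1) this int] E
  show "expectation (\<lambda>\<omega>. indicator A \<omega> * (\<Sum>t\<in>I. c t * X (int t) \<omega>)\<^sup>2) = prob A * (V * (\<Sum>t\<in>I. (c t)\<^sup>2))" by simp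
qed

lemma linear_X:
  fixes c :: "nat \<Rightarrow> real"
  assumes "A \<in> sets F"
  shows "integrable M (\<lambda>\<omega>. \<Sum>t\<in>I. c t * X (int t) \<omega>)"
    and "expectation (\<lambda>\<omega>. indicator A \<omega> * (\<Sum>t\<in>I. c t * X (int t) \<omega>)) = 0"
proof -
  note i = llr_integrable(1)[OF states(2)]
  show int: "integrable M (\<lambda>\<omega>. \<Sum>t\<in>I. c t * X (int t) \<omega>)"
    by (intro Bochner_Integration.integrable_sum integrable_mult_right i)
  have "(\<lambda>\<omega>. \<Sum>t\<in>I. c t * X (int t) \<omega>) \<in> borel_measurable G"
    by (intro borel_measurable_sum borel_measurable_times borel_measurable_const X_G)
  from indep_integral[OF assms(1) this int]
  show "expectation (\<lambda>\<omega>. indicator A \<omega> * (\<Sum>t\<in>I. c t * X (int t) \<omega>)) = 0"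
    by (simp add: Bochner_Integration.integral_sum i llr_moments(1))
qed

abbreviation "Y2 t \<omega> \<equiv> llr2 (\<eta> t \<omega>) (Z t \<omega>) 0"

lemma Y2_split: "\<omega> \<in> space M \<Longrightarrow> Y2 t \<omega> = of_bool (\<eta> t \<omega> = 0) * llr2 0 (Z t \<omega>) 0 + of_bool (\<eta> t \<omega> = 1) * llr2 1 (Z t \<omega>) 0"
  using eta_cases[of \<omega> t] by auto

text \<open>
  Splitting \<open>A\<close> by the value of \<open>\<eta> t\<close> separates the noise from the chain; the two means of \<open>llr2\<close> are \<open>- V\<close> and \<open>V\<close>.
\<close>

lemma Y2:
  shows "integrable M (Y2 t)"
    and "A \<in> sets F \<Longrightarrow> expectation (\<lambda>\<omega>. indicator A \<omega> * Y2 t \<omega>) = expectation (\<lambda>\<omega>. indicator A \<omega> * (V * (2 * real (\<eta> t \<omega>) - 1)))"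
proof -
  have ind: "of_bool (\<eta> t \<omega> = a) = (indicator {\<omega>\<in>space M. \<eta> t \<omega> = a} \<omega> :: real)" if "\<omega> \<in> space M" for \<omega> a
    using that by (simp add: indicator_def)
  have ev [measurable]: "{\<omega>\<in>space M. \<eta> t \<omega> = a} \<in> events" for a by measurable
  have evF: "{\<omega>\<in>space M. \<eta> t \<omega> = a} \<in> sets F" for a
  proof -
    have "{\<omega>\<in>space F. \<eta> t \<omega> = a} \<in> sets F" by measurable
    then show ?thesis by (simp add: space_path)
  qed
  have i: "integrable M (\<lambda>\<omega>. indicator B \<omega> * llr2 a (Z t \<omega>) 0)" if "B \<in> events" "a \<in> {0,1}" for a B
    using integrable_real_mult_indicator[OF that(1) llr_integrable(3)[OF that(2)]] by (simp add: mult.commute)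
  show "integrable M (Y2 t)"
    by (subst Bochner_Integration.integrable_cong[OF refl Y2_split]; simp add: ind)
       (subst Bochner_Integration.integrable_cong[OF refl, where g = "\<lambda>\<omega>. indicator {\<omega>\<in>space M. \<eta> t \<omega> = 0} \<omega> * llr2 0 (Z t \<omega>) 0 + indicator {\<omega>\<in>space M. \<eta> t \<omega> = 1} \<omega> * llr2 1 (Z t \<omega>) 0"],
        simp add: ind, intro Bochner_Integration.integrable_add i ev; simp)
  assume A: "A \<in> sets F"
  note AM [measurable] = F_events[OF A]
  let ?B = "\<lambda>a. A \<inter> {\<omega>\<in>space M. \<eta> t \<omega> = a}"
  have BF: "?B a \<in> sets F" for a using A evF by auto
  have mG: "(\<lambda>\<omega>. llr2 a (Z t \<omega>) 0) \<in> borel_measurable G" if "a \<in> {0,1}" for a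
    by (rule measurable_compose[OF Z_G llr_measurable(3)[OF that]])
  have E: "expectation (\<lambda>\<omega>. indicator (?B a) \<omega> * llr2 a (Z t \<omega>) 0) = prob (?B a) * ((2 * real a - 1) * V)" if "a \<in> {0,1}" for a
    using indep_integral[OF BF mG[OF that] llr_integrable(3)[OF that], of a] that
    by (auto simp: llr_moments(2,3) X_sq simp del: One_nat_def)
  have "expectation (\<lambda>\<omega>. indicator A \<omega> * Y2 t \<omega>)
    = expectation (\<lambda>\<omega>. indicator (?B 0) \<omega> * llr2 0 (Z t \<omega>) 0 + indicator (?B 1) \<omega> * llr2 1 (Z t \<omega>) 0)"
    by (intro Bochner_Integration.integral_cong refl) (auto simp: Y2_split indicator_def)
  also have "\<dots> = prob (?B 0) * ((2 * real 0 - 1) * V) + prob (?B 1) * ((2 * real 1 - 1) * V)"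
    using BF F_events by (subst Bochner_Integration.integral_add) (auto intro!: i simp only: E states)
  also have "\<dots> = expectation (\<lambda>\<omega>. indicator (?B 0) \<omega> * (- V) + indicator (?B 1) \<omega> * V)"
    using BF F_events by (subst Bochner_Integration.integral_add) (auto simp: less_top[symmetric])
  also have "\<dots> = expectation (\<lambda>\<omega>. indicator A \<omega> * (V * (2 * real (\<eta> t \<omega>) - 1)))"
  proof (intro Bochner_Integration.integral_cong refl)
    fix \<omega> assume "\<omega> \<in> space M"
    then show "indicator (?B 0) \<omega> * (- V) + indicator (?B 1) \<omega> * V = indicator A \<omega> * (V * (2 * real (\<eta> t \<omega>) - 1))"
      using eta_cases[of \<omega> t] by (auto simp: indicator_def)
  qed
  finally show "expectation (\<lambda>\<omega>. indicator A \<omega> * Y2 t \<omega>) = expectation (\<lambda>\<omega>. indicator A \<omega> * (V * (2 * real (\<eta> t \<omega>) - 1)))" .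
qed

definition path_llr where "path_llr \<omega> k e = llr (\<eta> (int k) \<omega>) (Z (int k) \<omega>) e"
definition path_llr1 where "path_llr1 \<omega> k e = llr1 (\<eta> (int k) \<omega>) (Z (int k) \<omega>) e"
definition path_llr2 where "path_llr2 \<omega> k e = llr2 (\<eta> (int k) \<omega>) (Z (int k) \<omega>) e"

text \<open>
  The log-likelihood ratio and its first two derivatives in \<open>\<epsilon>\<close> for finite horizon, along a fixed realization \<open>\<omega>\<close>.
\<close>

abbreviation "R0 \<omega> \<equiv> filter.rho (path_llr \<omega>)"
abbreviation "R1 \<omega> \<equiv> filter.rho1 (path_llr \<omega>) (path_llr1 \<omega>)"
abbreviation "R2 \<omega> \<equiv> filter.rho2 (path_llr \<omega>) (path_llr1 \<omega>) (path_llr2 \<omega>)"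

lemma path_llr_derivs:
  assumes "\<omega> \<in> space M"
  shows "(path_llr \<omega> k has_real_derivative path_llr1 \<omega> k e) (at e)" "(path_llr1 \<omega> k has_real_derivative path_llr2 \<omega> k e) (at e)"
  unfolding path_llr_def[abs_def] path_llr1_def[abs_def] path_llr2_def using llr_derivs[OF eta_cases[OF assms]] by auto

lemma log_ratio_eq:
  "log_ratio M f \<phi> \<theta> \<eta> Z e \<omega> n = R0 \<omega> n 0 e"
proof -
  let ?w = "\<lambda>s c. psi f \<phi> \<theta> \<eta> Z (int s) e c \<omega>"
  have s: "sigma_exp M f \<phi> \<theta> \<eta> Z n e a \<omega> = future_weight ?w n 0 a" if "a \<in> {0, 1}" for a
    unfolding sigma_exp_def Let_def using path_integral[OF that, where w = ?w and n = n] by simp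
  have "ln (future_weight ?w n 0 1 / future_weight ?w n 0 0) = R0 \<omega> n 0 e"
  proof (rule ln_future_weight_ratio)
    show "0 < ?w s c" if "c \<in> {0, 1}" for s c
      unfolding psi_def by (rule lambda_real[OF theta_range[OF that]])
    show "path_llr \<omega> s e = ln (?w s 1) - ln (?w s 0)" for s
      unfolding path_llr_def log_lr_eq[symmetric] log_lr_def ..
  qed
  then show ?thesis unfolding log_ratio_def s[OF states(1)] s[OF states(2)] .
qed

abbreviation "r \<equiv> r_lim M f \<phi> \<theta> \<eta> Z"

lemma r_eq: "r e \<omega> = lim (\<lambda>n. R0 \<omega> n 0 e)"
  unfolding r_lim_def by (simp add: log_ratio_eq[abs_def])

abbreviation "\<gamma> \<equiv> 1 - \<kappa>\<^sup>2"

lemma gamma: "0 < \<gamma>" "\<gamma> < 1" using filter.gamma by auto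

text \<open>
  The bound of \<open>differences_bound\<close> with \<open>\<mu> j = 2 envelope (Z j)\<close>; the factor \<open>2\<close> comes from the two terms of \<open>llr\<close>.
\<close>

definition \<Delta> where
  "\<Delta> m \<omega> = 4 * filter.K / \<gamma> * (1 + (\<Sum>j\<le>Suc m. 2 * envelope (Z (int j) \<omega>)))\<^sup>2 * (real m + 1)\<^sup>2 * \<gamma> ^ m"

lemma K_nonneg: "0 \<le> 4 * filter.K / \<gamma>"
proof -
  have "1 \<le> filter.K" by (rule filter.K(1)[of "\<lambda>_ _. 0" 0 "\<lambda>_. 0" "\<lambda>_ _. 0"]) auto
  then show ?thesis using gamma by auto
qed

lemma \<Delta>_nonneg: "0 \<le> \<Delta> m \<omega>"
  unfolding \<Delta>_def using K_nonneg gamma by (intro mult_nonneg_nonneg) auto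

lemma differences:
  assumes "\<omega> \<in> space M" "-1 < e" "e < 1"
  shows "\<bar>R0 \<omega> (Suc m) 0 e - R0 \<omega> m 0 e\<bar> \<le> \<Delta> m \<omega>"
    and "\<bar>R1 \<omega> (Suc m) 0 e - R1 \<omega> m 0 e\<bar> \<le> \<Delta> m \<omega>"
    and "\<bar>R2 \<omega> (Suc m) 0 e - R2 \<omega> m 0 e\<bar> \<le> \<Delta> m \<omega>"
proof -
  let ?\<mu> = "\<lambda>k. 2 * envelope (Z (int k) \<omega>)"
  have b: "\<bar>path_llr1 \<omega> k e\<bar> \<le> ?\<mu> k" "\<bar>path_llr2 \<omega> k e\<bar> \<le> ?\<mu> k" for k
    unfolding path_llr1_def path_llr2_def by (intro llr_bounds eta_cases assms)+
  have "real ((m + 1)\<^sup>2) = (real m + 1)\<^sup>2" by (simp add: add.commute)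
  note D = filter.differences_bound[of "path_llr1 \<omega>" e ?\<mu> "path_llr2 \<omega>", OF b, of "path_llr \<omega>" m, unfolded this]
  show "\<bar>R0 \<omega> (Suc m) 0 e - R0 \<omega> m 0 e\<bar> \<le> \<Delta> m \<omega>" unfolding \<Delta>_def by (rule D(1))
  show "\<bar>R1 \<omega> (Suc m) 0 e - R1 \<omega> m 0 e\<bar> \<le> \<Delta> m \<omega>" unfolding \<Delta>_def by (rule D(2))
  show "\<bar>R2 \<omega> (Suc m) 0 e - R2 \<omega> m 0 e\<bar> \<le> \<Delta> m \<omega>" unfolding \<Delta>_def by (rule D(3))
qed

text \<open>
  By the inequality of Cauchy and Schwarz, the squared sum has expectation of order \<open>m\<^sup>2\<close>, so \<open>E \<Delta> m\<close> is of order \<open>m^4 \<gamma>^m\<close>.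
\<close>

lemma \<Delta>_summable: "AE \<omega> in M. summable (\<lambda>m. \<Delta> m \<omega>)"
  and \<Delta>_integrable: "integrable M (\<lambda>\<omega>. \<Sum>m. \<Delta> m \<omega>)"
proof -
  define E where "E = expectation (\<lambda>\<omega>. (2 * envelope (Z 0 \<omega>))\<^sup>2)"
  have E0: "0 \<le> E" unfolding E_def by simp
  define a where "a m = 4 * filter.K / \<gamma> * (real m + 1)\<^sup>2 * \<gamma> ^ m" for m
  have a0: "0 \<le> a m" for m unfolding a_def using K_nonneg gamma by (intro mult_nonneg_nonneg) auto
  define S where "S m \<omega> = (\<Sum>j\<le>Suc m. 2 * envelope (Z (int j) \<omega>))" for m \<omega>
  have \<Delta>: "\<Delta> m \<omega> = a m * (1 + S m \<omega>)\<^sup>2" for m \<omega> unfolding \<Delta>_def a_def S_def by (simp add: mult_ac)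
  let ?Q = "\<lambda>m \<omega>. 2 + 2 * ((real m + 2) * (\<Sum>j\<le>Suc m. (2 * envelope (Z (int j) \<omega>))\<^sup>2))"
  have Q: "(1 + S m \<omega>)\<^sup>2 \<le> ?Q m \<omega>" for m \<omega>
  proof -
    \<comment> \<open>(1 + x)^2 <= 2 + 2 x^2 and Cauchy-Schwarz with the m + 2 summands.\<close>
    have "(1 + S m \<omega>)\<^sup>2 \<le> 2 + 2 * (S m \<omega>)\<^sup>2"
      using zero_le_power2[of "1 - S m \<omega>"] by (simp add: power2_eq_square algebra_simps)
    also have "(S m \<omega>)\<^sup>2 \<le> (\<Sum>j\<le>Suc m. (2 * envelope (Z (int j) \<omega>))\<^sup>2) * card {..Suc m}"
      unfolding S_def by (rule sum_squared_le_sum_of_squares)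
    also have "real (card {..Suc m}) = real m + 2" by simp
    finally show ?thesis by (simp only: mult.commute)
  qed
  have i: "integrable M (\<lambda>\<omega>. (2 * envelope (Z t \<omega>))\<^sup>2)" for t
    using envelope_sq_integrable[of t] by (simp add: power_mult_distrib)
  have iQ: "integrable M (?Q m)" for m
    by (intro Bochner_Integration.integrable_add Bochner_Integration.integrable_sum integrable_mult_right i) simp
  have eQ: "expectation (?Q m) = 2 + 2 * ((real m + 2) * ((real m + 2) * E))" for m
  proof -
    have "expectation (\<lambda>\<omega>. (2 * envelope (Z t \<omega>))\<^sup>2) = E" for t
      unfolding E_def power_mult_distrib using envelope_sq_ident[of t] by simp
    note E = this
    have "expectation (?Q m) = expectation (\<lambda>\<omega>. 2) + expectation (\<lambda>\<omega>. 2 * ((real m + 2) * (\<Sum>j\<le>Suc m. (2 * envelope (Z (int j) \<omega>))\<^sup>2)))"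
      by (intro Bochner_Integration.integral_add integrable_mult_right Bochner_Integration.integrable_sum i) simp
    also have "expectation (\<lambda>\<omega>. \<Sum>j\<le>Suc m. (2 * envelope (Z (int j) \<omega>))\<^sup>2) = (\<Sum>j\<le>Suc m. E)"
      by (subst Bochner_Integration.integral_sum) (simp_all only: i E)
    then have "expectation (\<lambda>\<omega>. 2 * ((real m + 2) * (\<Sum>j\<le>Suc m. (2 * envelope (Z (int j) \<omega>))\<^sup>2))) = 2 * ((real m + 2) * ((real m + 2) * E))"
      by (simp only: integral_mult_right_zero) simp
    finally show ?thesis by (simp add: prob_space)
  qed
  have int: "integrable M (\<Delta> m)" for m
  proof (rule Bochner_Integration.integrable_bound[of M "\<lambda>\<omega>. a m * ?Q m \<omega>"])
    show "integrable M (\<lambda>\<omega>. a m * ?Q m \<omega>)" by (intro integrable_mult_right iQ)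
    show "AE \<omega> in M. norm (\<Delta> m \<omega>) \<le> norm (a m * ?Q m \<omega>)"
    proof (rule AE_I2)
      fix \<omega>
      have "a m * (1 + S m \<omega>)\<^sup>2 \<le> a m * ?Q m \<omega>" by (intro mult_left_mono Q a0)
      moreover have "0 \<le> a m * (1 + S m \<omega>)\<^sup>2" using a0 by simp
      ultimately show "norm (\<Delta> m \<omega>) \<le> norm (a m * ?Q m \<omega>)" unfolding \<Delta> real_norm_def by linarith
    qed
    show "\<Delta> m \<in> borel_measurable M" unfolding \<Delta>_def[abs_def] by measurable
  qed
  let ?c = "\<lambda>m. (4 * filter.K / \<gamma> * (2 * (1 + E))) * ((real m + 2) ^ 4 * \<gamma> ^ m)"
  have bound: "expectation (\<Delta> m) \<le> ?c m" for m
  proof -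
    have "expectation (\<Delta> m) \<le> expectation (\<lambda>\<omega>. a m * ?Q m \<omega>)"
      unfolding \<Delta>[abs_def] by (intro integral_mono) (use int[of m] iQ a0 Q in \<open>auto simp: \<Delta>[abs_def] intro: mult_left_mono\<close>)
    also have "\<dots> = a m * (2 + 2 * ((real m + 2) * ((real m + 2) * E)))" using eQ by simp
    also have "\<dots> \<le> (4 * filter.K / \<gamma> * (real m + 2)\<^sup>2 * \<gamma> ^ m) * (2 * (1 + E) * (real m + 2)\<^sup>2)"
    proof (intro mult_mono)
      show "a m \<le> 4 * filter.K / \<gamma> * (real m + 2)\<^sup>2 * \<gamma> ^ m"
        unfolding a_def using K_nonneg gamma by (intro mult_right_mono mult_left_mono power_mono) auto
      have "1 \<le> (real m + 2)\<^sup>2" by (simp add: power2_eq_square algebra_simps)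
      then show "2 + 2 * ((real m + 2) * ((real m + 2) * E)) \<le> 2 * (1 + E) * (real m + 2)\<^sup>2"
        using E0 by (simp add: power2_eq_square algebra_simps)
      show "0 \<le> 4 * filter.K / \<gamma> * (real m + 2)\<^sup>2 * \<gamma> ^ m"
        using K_nonneg gamma by (intro mult_nonneg_nonneg) auto
    qed (use E0 in auto)
    also have "\<dots> = ?c m" by (simp add: power2_eq_square power4_eq_xxxx mult_ac)
    finally show ?thesis .
  qed
  have c: "summable ?c" by (intro summable_mult summable_poly_geometric gamma)
  note A = AE_summable_of_expectations[of \<Delta>, OF int \<Delta>_nonneg bound c]
  show "AE \<omega> in M. summable (\<lambda>m. \<Delta> m \<omega>)" by (rule A(1))
  show "integrable M (\<lambda>\<omega>. \<Sum>m. \<Delta> m \<omega>)" by (rule A(2))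
qed

lemma rho_zero_start: "R0 \<omega> 0 k e = 0" "R1 \<omega> 0 k e = 0" "R2 \<omega> 0 k e = 0"
  by (simp_all only: filter.rho.simps filter.rho1.simps filter.rho2.simps)

lemma r_derivs:
  assumes \<omega>: "\<omega> \<in> space M" and s: "summable (\<lambda>m. \<Delta> m \<omega>)" and e: "-1 < e" "e < 1"
  shows "((\<lambda>e. r e \<omega>) has_real_derivative lim (\<lambda>n. R1 \<omega> n 0 e)) (at e)"
    and "((\<lambda>e. lim (\<lambda>n. R1 \<omega> n 0 e)) has_real_derivative lim (\<lambda>n. R2 \<omega> n 0 e)) (at e)"
proof -
  have S: "open {-1<..<1::real}" "convex {-1<..<1::real}" "e \<in> {-1<..<1}" using e by auto
  note D = differences[OF \<omega>]
  show "((\<lambda>e. r e \<omega>) has_real_derivative lim (\<lambda>n. R1 \<omega> n 0 e)) (at e)"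
    unfolding r_eq
    by (rule lim_deriv_of_summable_differences[OF filter.rho_deriv[OF path_llr_derivs(1)[OF \<omega>]] _ _ S _ _ s])
       (simp_all only: rho_zero_start D greaterThanLessThan_iff)
  show "((\<lambda>e. lim (\<lambda>n. R1 \<omega> n 0 e)) has_real_derivative lim (\<lambda>n. R2 \<omega> n 0 e)) (at e)"
    by (rule lim_deriv_of_summable_differences[OF filter.rho1_deriv[OF path_llr_derivs(1)[OF \<omega>] path_llr_derivs(2)[OF \<omega>]] _ _ S _ _ s])
       (simp_all only: rho_zero_start D greaterThanLessThan_iff)
qed

lemma r_derivs_zero:
  assumes \<omega>: "\<omega> \<in> space M" and s: "summable (\<lambda>m. \<Delta> m \<omega>)"
  shows "\<forall>\<^sub>F \<epsilon> in nhds 0. (\<lambda>e. r e \<omega>) differentiable (at \<epsilon>)"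
    and "deriv (\<lambda>e. r e \<omega>) differentiable (at 0)"
    and "deriv (\<lambda>e. r e \<omega>) 0 = lim (\<lambda>n. R1 \<omega> n 0 0)"
    and "deriv (deriv (\<lambda>e. r e \<omega>)) 0 = lim (\<lambda>n. R2 \<omega> n 0 0)"
proof -
  note D = r_derivs[OF \<omega> s]
  have "\<forall>\<^sub>F e in nhds 0. e \<in> {-1<..<1::real}" by (intro eventually_nhds_in_open) auto
  then show "\<forall>\<^sub>F \<epsilon> in nhds 0. (\<lambda>e. r e \<omega>) differentiable (at \<epsilon>)"
    by eventually_elim (use D(1) in \<open>auto simp: real_differentiable_def\<close>)
  have d: "deriv (\<lambda>e. r e \<omega>) e = lim (\<lambda>n. R1 \<omega> n 0 e)" if "e \<in> {-1<..<1}" for e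
    using D(1) that by (intro DERIV_imp_deriv) auto
  have "(deriv (\<lambda>e. r e \<omega>) has_real_derivative lim (\<lambda>n. R2 \<omega> n 0 0)) (at 0)"
    by (rule has_field_derivative_transform_within_open[OF D(2), of 0 "{-1<..<1}"]) (use d in auto)
  then show "deriv (\<lambda>e. r e \<omega>) differentiable (at 0)"
    "deriv (deriv (\<lambda>e. r e \<omega>)) 0 = lim (\<lambda>n. R2 \<omega> n 0 0)"
    by (auto simp: real_differentiable_def intro: DERIV_imp_deriv)
  show "deriv (\<lambda>e. r e \<omega>) 0 = lim (\<lambda>n. R1 \<omega> n 0 0)" using d[of 0] by simp
qed

lemma path_llr_at_0: "path_llr \<omega> k 0 = 0" by (simp add: path_llr_def llr_zero)

lemma R0_at_0: "R0 \<omega> m k 0 = 0"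
proof (induction m arbitrary: k)
  case (Suc m)
  have "log_mgf a 0 = 0" for a by (simp add: log_mgf_def)
  then show ?case unfolding filter.rho.simps Suc path_llr_at_0 by simp
qed (simp only: rho_zero_start)

lemma D_rec': "Suc k \<le> t \<Longrightarrow> D k t = (up_prob k 1 - up_prob k 0) * D (Suc k) t"
  and trans_sum_rec': "Suc k \<le> t \<Longrightarrow> trans_sum k t = trans_sum (Suc k) t - (1 - up_prob k 1 - up_prob k 0) * D (Suc k) t"
  using D_rec[of k "t - Suc k"] trans_sum_rec[of k "t - Suc k"] by simp_all

lemma R1_step: "R1 \<omega> (Suc m) k 0 = (up_prob k 1 - up_prob k 0) * (path_llr1 \<omega> (Suc k) 0 + R1 \<omega> m (Suc k) 0)"
  unfolding filter.rho1.simps R0_at_0 by (simp add: path_llr_def llr_zero tilt_def)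

lemma R2_step: "R2 \<omega> (Suc m) k 0 = (up_prob k 1 - up_prob k 0) * (1 - up_prob k 1 - up_prob k 0) * (path_llr1 \<omega> (Suc k) 0 + R1 \<omega> m (Suc k) 0)\<^sup>2
    + (up_prob k 1 - up_prob k 0) * (path_llr2 \<omega> (Suc k) 0 + R2 \<omega> m (Suc k) 0)"
  unfolding filter.rho2.simps R0_at_0 by (simp add: path_llr_def llr_zero tilt_def tilt_var_def algebra_simps)

lemma path_llr1_at_0: "\<omega> \<in> space M \<Longrightarrow> path_llr1 \<omega> k 0 = X (int k) \<omega>"
  unfolding path_llr1_def by (rule llr1_same[OF eta_cases])

lemma sum_first: "(\<Sum>t\<in>{Suc k..k + Suc m}. h t) = h (Suc k) + (\<Sum>t\<in>{Suc (Suc k)..Suc k + m}. h t)" for h :: "nat \<Rightarrow> real"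
  using sum.atLeast_Suc_atMost[of "Suc k" "k + Suc m" h] by simp

lemma R1_at_0: "\<omega> \<in> space M \<Longrightarrow> R1 \<omega> m k 0 = (\<Sum>t\<in>{Suc k..k+m}. D k t * X (int t) \<omega>)"
proof (induction m arbitrary: k)
  case (Suc m)
  have "R1 \<omega> (Suc m) k 0 = (up_prob k 1 - up_prob k 0) * (\<Sum>t\<in>{Suc k..k + Suc m}. D (Suc k) t * X (int t) \<omega>)"
    unfolding R1_step Suc.IH[OF Suc.prems] path_llr1_at_0[OF Suc.prems] sum_first D_refl by simp
  also have "\<dots> = (\<Sum>t\<in>{Suc k..k + Suc m}. D k t * X (int t) \<omega>)"
    unfolding sum_distrib_left by (intro sum.cong refl) (simp add: D_rec')
  finally show ?case .
qed (simp only: rho_zero_start, simp)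

lemma R1_next_at_0:
  assumes "\<omega> \<in> space M"
  shows "path_llr1 \<omega> (Suc k) 0 + R1 \<omega> m (Suc k) 0 = (\<Sum>t\<in>{Suc k..k + Suc m}. D (Suc k) t * X (int t) \<omega>)"
  unfolding R1_at_0[OF assms] path_llr1_at_0[OF assms] sum_first D_refl by simp

lemma R2_at_0_step:
  assumes "\<omega> \<in> space M"
  shows "R2 \<omega> (Suc m) k 0 = (up_prob k 1 - up_prob k 0) * (1 - up_prob k 1 - up_prob k 0) * (\<Sum>t\<in>{Suc k..k + Suc m}. D (Suc k) t * X (int t) \<omega>)\<^sup>2
    + (up_prob k 1 - up_prob k 0) * (Y2 (int (Suc k)) \<omega> + R2 \<omega> m (Suc k) 0)"
  unfolding R2_step R1_next_at_0[OF assms] path_llr2_def ..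

lemma R1_integrable: "integrable M (\<lambda>\<omega>. R1 \<omega> m k 0)"
  by (subst Bochner_Integration.integrable_cong[OF refl R1_at_0]) (assumption, rule linear_X(1)[OF sets.top])

text \<open>
  The recursion adds only squares of linear combinations of the \<open>X t\<close> and second derivatives at single times.
\<close>

lemma R2_integrable: "integrable M (\<lambda>\<omega>. R2 \<omega> m k 0)"
proof (induction m arbitrary: k)
  case (Suc m)
  show ?case
    by (subst Bochner_Integration.integrable_cong[OF refl R2_at_0_step])
       (assumption, intro Bochner_Integration.integrable_add integrable_mult_right Suc Y2(1) linear_X_square(1)[OF sets.top], simp)
qed (simp only: rho_zero_start, simp)

text \<open>
  \<open>E[\<rho>\<^sub>k'' | \<eta>]\<close> for horizon \<open>m\<close>.
\<close>

definition cond_mean where "cond_mean m k \<omega> = V * (\<Sum>t\<in>{Suc k..k+m}. D k t * (2 * real (\<eta> (int t) \<omega>) - trans_sum k t))"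

lemma eta_F_real: "(\<lambda>\<omega>. real (\<eta> t \<omega>)) \<in> borel_measurable F"
  by (rule measurable_compose[OF eta_F]) simp

lemma cond_mean_F: "cond_mean m k \<in> borel_measurable F"
  unfolding cond_mean_def[abs_def]
  by (intro borel_measurable_times borel_measurable_sum borel_measurable_diff borel_measurable_const eta_F_real)

lemma eta_integrable: "integrable M (\<lambda>\<omega>. real (\<eta> t \<omega>))"
proof (rule integrable_const_bound[where B = 1])
  show "AE \<omega> in M. norm (real (\<eta> t \<omega>)) \<le> 1" using eta_cases[of _ t] by (intro AE_I2) fastforce
  show "(\<lambda>\<omega>. real (\<eta> t \<omega>)) \<in> borel_measurable M" by (rule measurable_compose[OF eta_measurable]) simp
qed

lemma cond_mean_integrable: "integrable M (cond_mean m k)"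
  unfolding cond_mean_def[abs_def]
  by (intro integrable_mult_right Bochner_Integration.integrable_sum Bochner_Integration.integrable_diff eta_integrable) auto

lemma restricted_integrable:
  fixes H :: "'w \<Rightarrow> real"
  assumes "A \<in> sets F" "integrable M H" shows "integrable M (\<lambda>\<omega>. indicator A \<omega> * H \<omega>)"
  using integrable_real_mult_indicator[OF F_events[OF assms(1)] assms(2)] by (simp add: mult.commute)

text \<open>
  In the induction step the squared linear combination contributes \<open>V\<close> times the sum of the squares of \<open>D (k+1) t\<close>. The
  recursion of \<open>trans_sum\<close> produces the same quantity from passing from \<open>trans_sum (k+1) t\<close> to \<open>trans_sum k t\<close>.
  The new term at \<open>t = k + 1\<close> fits in because \<open>D\<close> and \<open>trans_sum\<close> are \<open>1\<close> on the diagonal.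
\<close>

lemma R2_cond_mean:
  assumes A: "A \<in> sets F"
  shows "expectation (\<lambda>\<omega>. indicator A \<omega> * R2 \<omega> m k 0) = expectation (\<lambda>\<omega>. indicator A \<omega> * cond_mean m k \<omega>)"
proof (induction m arbitrary: k)
  case 0
  show ?case unfolding rho_zero_start cond_mean_def by simp
next
  case (Suc m)
  let ?I = "{Suc k..k + Suc m}" and ?p = "up_prob k 1 - up_prob k 0" and ?c = "1 - up_prob k 1 - up_prob k 0"
  let ?L = "\<lambda>\<omega>. \<Sum>t\<in>?I. D (Suc k) t * X (int t) \<omega>"
  note int = restricted_integrable[OF A] and i = Y2(1)[of "int (Suc k)"] R2_integrable[of m "Suc k"] cond_mean_integrable[of m "Suc k"]
    linear_X_square(1)[OF A, of ?I "D (Suc k)"]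
  have iV: "integrable M (\<lambda>\<omega>. V * (2 * real (\<eta> t \<omega>) - 1))" for t
    by (intro integrable_mult_right Bochner_Integration.integrable_diff eta_integrable) auto
  have iA: "integrable M (\<lambda>\<omega>. indicator A \<omega> * c)" and eA: "expectation (\<lambda>\<omega>. indicator A \<omega> * c) = prob A * c" for c :: real
    using F_events[OF A] by (simp_all add: less_top[symmetric])
  have "expectation (\<lambda>\<omega>. indicator A \<omega> * R2 \<omega> (Suc m) k 0) =
    expectation (\<lambda>\<omega>. ?p * ?c * (indicator A \<omega> * (?L \<omega>)\<^sup>2) + ?p * (indicator A \<omega> * Y2 (int (Suc k)) \<omega> + indicator A \<omega> * R2 \<omega> m (Suc k) 0))"
    by (intro Bochner_Integration.integral_cong refl) (simp only: R2_at_0_step distrib_left mult_ac)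
  also have "\<dots> = ?p * ?c * expectation (\<lambda>\<omega>. indicator A \<omega> * (?L \<omega>)\<^sup>2) + ?p * (expectation (\<lambda>\<omega>. indicator A \<omega> * Y2 (int (Suc k)) \<omega>)
     + expectation (\<lambda>\<omega>. indicator A \<omega> * R2 \<omega> m (Suc k) 0))"
    by (simp only: Bochner_Integration.integral_add integral_mult_right_zero
       Bochner_Integration.integrable_add integrable_mult_right int i finite_atLeastAtMost)
  also have "\<dots> = prob A * (?p * ?c * (V * (\<Sum>t\<in>?I. (D (Suc k) t)\<^sup>2)))
     + ?p * (expectation (\<lambda>\<omega>. indicator A \<omega> * (V * (2 * real (\<eta> (int (Suc k)) \<omega>) - 1))) + expectation (\<lambda>\<omega>. indicator A \<omega> * cond_mean m (Suc k) \<omega>))"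
    unfolding Suc.IH Y2(2)[OF A] linear_X_square(2)[OF A finite_atLeastAtMost] by (simp only: mult_ac)
  also have "\<dots> = expectation (\<lambda>\<omega>. indicator A \<omega> * (?p * ?c * (V * (\<Sum>t\<in>?I. (D (Suc k) t)\<^sup>2)))
     + ?p * (indicator A \<omega> * (V * (2 * real (\<eta> (int (Suc k)) \<omega>) - 1)) + indicator A \<omega> * cond_mean m (Suc k) \<omega>))"
    by (simp only: Bochner_Integration.integral_add integral_mult_right_zero
       Bochner_Integration.integrable_add integrable_mult_right int iV i iA eA)
  also have "\<dots> = expectation (\<lambda>\<omega>. indicator A \<omega> * cond_mean (Suc m) k \<omega>)"
  proof (intro Bochner_Integration.integral_cong refl)
    fix \<omega>
    have 1: "V * (2 * real (\<eta> (int (Suc k)) \<omega>) - 1) + cond_mean m (Suc k) \<omega> = V * (\<Sum>t\<in>?I. D (Suc k) t * (2 * real (\<eta> (int t) \<omega>) - trans_sum (Suc k) t))"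
      unfolding cond_mean_def sum_first D_refl trans_sum_refl by (simp add: distrib_left)
    have "cond_mean (Suc m) k \<omega> = V * (\<Sum>t\<in>?I. ?p * (D (Suc k) t * (2 * real (\<eta> (int t) \<omega>) - trans_sum (Suc k) t)) + ?p * ?c * (D (Suc k) t)\<^sup>2)"
      unfolding cond_mean_def
      by (intro arg_cong2[of _ _ _ _ "(*)"] sum.cong refl) (simp add: D_rec' trans_sum_rec' power2_eq_square algebra_simps)
    also have "\<dots> = ?p * (V * (2 * real (\<eta> (int (Suc k)) \<omega>) - 1) + cond_mean m (Suc k) \<omega>) + ?p * ?c * (V * (\<Sum>t\<in>?I. (D (Suc k) t)\<^sup>2))"
      unfolding 1 sum.distrib sum_distrib_left[symmetric] by (simp add: algebra_simps)
    finally have N: "cond_mean (Suc m) k \<omega> = ?p * (V * (2 * real (\<eta> (int (Suc k)) \<omega>) - 1) + cond_mean m (Suc k) \<omega>)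
      + ?p * ?c * (V * (\<Sum>t\<in>?I. (D (Suc k) t)\<^sup>2))" .
    show "indicator A \<omega> * (?p * ?c * (V * (\<Sum>t\<in>?I. (D (Suc k) t)\<^sup>2)))
     + ?p * (indicator A \<omega> * (V * (2 * real (\<eta> (int (Suc k)) \<omega>) - 1)) + indicator A \<omega> * cond_mean m (Suc k) \<omega>)
     = indicator A \<omega> * cond_mean (Suc m) k \<omega>"
      unfolding N by (simp only: distrib_left mult.left_commute mult.commute add_ac)
  qed
  finally show ?case .
qed

definition summand where "summand n \<omega> = D 0 (Suc n) * (2 * real (\<eta> (int (Suc n)) \<omega>) - trans_sum 0 (Suc n))"

lemma D_bound: "\<bar>D k (k + m)\<bar> \<le> \<gamma> ^ m"
proof (induction m arbitrary: k)
  case (Suc m)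
  have "\<bar>up_prob k 1 - up_prob k 0\<bar> \<le> \<gamma>"
    using filter.g1_bound[of k 0] by (simp add: tilt_def)
  then have "\<bar>up_prob k 1 - up_prob k 0\<bar> * \<bar>D (Suc k) (Suc k + m)\<bar> \<le> \<gamma> * \<gamma> ^ m"
    using gamma by (intro mult_mono Suc.IH) auto
  then show ?case unfolding D_rec abs_mult power_Suc .
qed (simp add: D_refl[simplified])

lemma summand_bound: "\<omega> \<in> space M \<Longrightarrow> \<bar>summand n \<omega>\<bar> \<le> \<gamma> ^ Suc n * 2"
  unfolding summand_def abs_mult
proof (rule mult_mono)
  show "\<bar>D 0 (Suc n)\<bar> \<le> \<gamma> ^ Suc n" using D_bound[of 0 "Suc n"] by simp
  assume "\<omega> \<in> space M"
  have "0 \<le> trans_prob M \<eta> (int 0) (int (Suc n)) a 1 \<and> trans_prob M \<eta> (int 0) (int (Suc n)) a 1 \<le> 1" if "a \<in> {0,1}" for a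
    using trans_prob_bounds[OF that states(1), of "int 0" "int (Suc n)"] kappa by simp
  from this[OF states(1)] this[OF states(2)] have "0 \<le> trans_sum 0 (Suc n)" "trans_sum 0 (Suc n) \<le> 2" unfolding trans_sum_def by auto
  moreover have "real (\<eta> (int (Suc n)) \<omega>) = 0 \<or> real (\<eta> (int (Suc n)) \<omega>) = 1"
    using eta_cases[OF \<open>\<omega> \<in> space M\<close>, of "int (Suc n)"] by auto
  ultimately show "\<bar>2 * real (\<eta> (int (Suc n)) \<omega>) - trans_sum 0 (Suc n)\<bar> \<le> 2" by auto
qed (use gamma in auto)

lemma summand_summable:
  assumes "\<omega> \<in> space M" shows "summable (\<lambda>n. summand n \<omega>)"
proof (rule summable_comparison_test'[where N = 0])
  show "summable (\<lambda>n. \<gamma> ^ Suc n * 2)"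
    using gamma by (intro summable_mult2) (auto simp: summable_Suc_iff intro: summable_geometric)
qed (use summand_bound[OF assms] in auto)

lemma cond_mean_eq: "cond_mean n 0 \<omega> = V * (\<Sum>i<n. summand i \<omega>)"
  unfolding cond_mean_def summand_def
  by (intro arg_cong2[of _ _ _ _ "(*)"] refl) (simp add: sum.atLeast1_atMost_eq)

lemma convergence_of_derivs:
  assumes \<omega>: "\<omega> \<in> space M" and s: "summable (\<lambda>m. \<Delta> m \<omega>)"
  shows "convergent (\<lambda>n. R1 \<omega> n 0 0)" "convergent (\<lambda>n. R2 \<omega> n 0 0)"
    "\<bar>R1 \<omega> n 0 0\<bar> \<le> (\<Sum>m. \<Delta> m \<omega>)" "\<bar>R2 \<omega> n 0 0\<bar> \<le> (\<Sum>m. \<Delta> m \<omega>)"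
proof -
  note B1 = bound_of_summable_differences[of "\<lambda>n. R1 \<omega> n 0 0", OF rho_zero_start(2) _ s]
  note B2 = bound_of_summable_differences[of "\<lambda>n. R2 \<omega> n 0 0", OF rho_zero_start(3) _ s]
  have d: "\<bar>R1 \<omega> (Suc m) 0 0 - R1 \<omega> m 0 0\<bar> \<le> \<Delta> m \<omega>" "\<bar>R2 \<omega> (Suc m) 0 0 - R2 \<omega> m 0 0\<bar> \<le> \<Delta> m \<omega>" for m
    by (rule differences[OF \<omega>]; simp)+
  show "convergent (\<lambda>n. R1 \<omega> n 0 0)" by (rule B1(1)[OF d(1)])
  show "convergent (\<lambda>n. R2 \<omega> n 0 0)" by (rule B2(1)[OF d(2)])
  show "\<bar>R1 \<omega> n 0 0\<bar> \<le> (\<Sum>m. \<Delta> m \<omega>)" by (rule B1(2)[OF d(1)])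
  show "\<bar>R2 \<omega> n 0 0\<bar> \<le> (\<Sum>m. \<Delta> m \<omega>)" by (rule B2(2)[OF d(2)])
qed

lemma AE_regular: "AE \<omega> in M. \<omega> \<in> space M \<and> summable (\<lambda>m. \<Delta> m \<omega>)"
  using \<Delta>_summable AE_space by eventually_elim simp

lemma first_derivative_cond_exp: "has_cond_exp M F (\<lambda>\<omega>. deriv (\<lambda>e. r e \<omega>) 0) (\<lambda>\<omega>. 0)"
proof (rule has_cond_exp_limit[where Y = "\<lambda>n \<omega>. R1 \<omega> n 0 0" and W = "\<lambda>\<omega>. \<Sum>m. \<Delta> m \<omega>" and g = "\<lambda>_ _. 0" and C = 0])
  show "AE \<omega> in M. \<bar>R1 \<omega> n 0 0\<bar> \<le> (\<Sum>m. \<Delta> m \<omega>)" for n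
    using AE_regular by eventually_elim (elim conjE, rule convergence_of_derivs(3))
  show "AE \<omega> in M. (\<lambda>n. R1 \<omega> n 0 0) \<longlonglongrightarrow> deriv (\<lambda>e. r e \<omega>) 0"
    using AE_regular
  proof eventually_elim
    case (elim \<omega>)
    then have "\<omega> \<in> space M" "summable (\<lambda>m. \<Delta> m \<omega>)" by blast+
    from convergence_of_derivs(1)[OF this] r_derivs_zero(3)[OF this]
    show ?case unfolding convergent_LIMSEQ_iff by (simp only:)
  qed
  show "expectation (\<lambda>\<omega>. indicator A \<omega> * R1 \<omega> n 0 0) = expectation (\<lambda>\<omega>. indicator A \<omega> * 0)" if A: "A \<in> sets F" for n A
  proof -
    have "expectation (\<lambda>\<omega>. indicator A \<omega> * R1 \<omega> n 0 0) = expectation (\<lambda>\<omega>. indicator A \<omega> * (\<Sum>t\<in>{Suc 0..0+n}. D 0 t * X (int t) \<omega>))"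
      by (intro Bochner_Integration.integral_cong refl) (simp only: R1_at_0)
    then show ?thesis unfolding linear_X(2)[OF A] by simp
  qed
qed (rule subalgebra_F R1_integrable \<Delta>_integrable | simp)+

lemma second_derivative_cond_exp:
  "has_cond_exp M F (\<lambda>\<omega>. deriv (deriv (\<lambda>e. r e \<omega>)) 0) (\<lambda>\<omega>. V * (\<Sum>n. summand n \<omega>))"
proof (rule has_cond_exp_limit[where Y = "\<lambda>n \<omega>. R2 \<omega> n 0 0" and W = "\<lambda>\<omega>. \<Sum>m. \<Delta> m \<omega>" and g = "\<lambda>n. cond_mean n 0" and C = "\<bar>V\<bar> * (\<Sum>n. \<gamma> ^ Suc n * 2)"])
  show "AE \<omega> in M. \<bar>R2 \<omega> n 0 0\<bar> \<le> (\<Sum>m. \<Delta> m \<omega>)" for n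
    using AE_regular by eventually_elim (elim conjE, rule convergence_of_derivs(4))
  show "AE \<omega> in M. (\<lambda>n. R2 \<omega> n 0 0) \<longlonglongrightarrow> deriv (deriv (\<lambda>e. r e \<omega>)) 0"
    using AE_regular
  proof eventually_elim
    case (elim \<omega>)
    then have "\<omega> \<in> space M" "summable (\<lambda>m. \<Delta> m \<omega>)" by blast+
    from convergence_of_derivs(2)[OF this] r_derivs_zero(4)[OF this]
    show ?case unfolding convergent_LIMSEQ_iff by (simp only:)
  qed
  show "\<bar>cond_mean n 0 \<omega>\<bar> \<le> \<bar>V\<bar> * (\<Sum>n. \<gamma> ^ Suc n * 2)" if "\<omega> \<in> space M" for n \<omega>
  proof -
    have sg: "summable (\<lambda>n. \<gamma> ^ Suc n * 2)"
      using gamma by (intro summable_mult2) (auto simp: summable_Suc_iff intro: summable_geometric)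
    have "\<bar>\<Sum>i<n. summand i \<omega>\<bar> \<le> (\<Sum>i<n. \<gamma> ^ Suc i * 2)"
      by (intro order.trans[OF sum_abs] sum_mono summand_bound that)
    also have "\<dots> \<le> (\<Sum>n. \<gamma> ^ Suc n * 2)" using gamma by (intro sum_le_suminf sg) auto
    finally show ?thesis unfolding cond_mean_eq abs_mult by (intro mult_left_mono) auto
  qed
  show "(\<lambda>n. cond_mean n 0 \<omega>) \<longlonglongrightarrow> V * (\<Sum>n. summand n \<omega>)" if "\<omega> \<in> space M" for \<omega>
    unfolding cond_mean_eq by (intro tendsto_mult_left summable_LIMSEQ summand_summable that)
qed (rule subalgebra_F \<Delta>_integrable R2_integrable R2_cond_mean cond_mean_F; assumption?)+

lemma log_lr_deriv:
  assumes "\<omega> \<in> space M"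
  shows "deriv (\<lambda>e. log_lr f \<phi> \<theta> \<eta> Z t e \<omega>) 0 = X t \<omega>"
  unfolding log_lr_eq using DERIV_imp_deriv[OF llr_derivs(1)[OF eta_cases[OF assms]]] llr1_same[OF eta_cases[OF assms]]
  by simp

end

section \<open>The expansion of the initial log-likelihood ratio\<close>

theorem proposition3p3:
  fixes M :: "'w measure"
    and \<eta> :: "int \<Rightarrow> 'w \<Rightarrow> nat"
    and Z :: "int \<Rightarrow> 'w \<Rightarrow> 'z::euclidean_space"
    and \<Theta> :: "real set"
    and \<phi> :: "'z \<Rightarrow> real \<Rightarrow> real"
    and \<theta> :: "nat \<Rightarrow> real \<Rightarrow> real"
    and f :: "real \<Rightarrow> real \<Rightarrow> real"
    and \<kappa> :: real
    and q :: nat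
  defines "d \<equiv> log_lr f \<phi> \<theta> \<eta> Z"
    and "r \<equiv> r_lim M f \<phi> \<theta> \<eta> Z"
    and "P \<equiv> trans_prob M \<eta>"
    and "D \<equiv> trans_diff M \<eta>"
    and "F \<equiv> path_algebra M (count_space {0, 1}) \<eta>"
  assumes M: "prob_space M"
    and eta_rv: "\<And>t. \<eta> t \<in> measurable M (count_space {0, 1})"
    and Z_rv: "\<And>t. Z t \<in> borel_measurable M"
    and Theta: "open \<Theta>"
    and theta_range: "\<And>a \<epsilon>. a \<in> {0, 1} \<Longrightarrow> \<theta> a \<epsilon> \<in> \<Theta>"
    and theta_zero: "\<theta> 0 0 = 0" "\<theta> 1 0 = 0"
    \<comment> \<open>(1)\<close>
    and indep: "prob_space.indep_set M (sets (path_algebra M borel Z)) (sets F)"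
    and Z_indep: "prob_space.indep_vars M (\<lambda>_. borel) Z UNIV"
    and Z_ident: "\<And>s t. distr M borel (Z s) = distr M borel (Z t)"
    and density: "\<And>\<tau> t. \<tau> \<in> \<Theta> \<Longrightarrow> distributed M lborel (\<lambda>\<omega>. \<phi> (Z t \<omega>) \<tau>) (\<lambda>x. ennreal (f x \<tau>))"
    \<comment> \<open>(2)\<close>
    and markov: "markov_chain M \<eta>"
    and kappa: "\<kappa> > 0"
    and mixing: "\<And>a b s t. a \<in> {0, 1} \<Longrightarrow> b \<in> {0, 1} \<Longrightarrow> \<bar>s - t\<bar> \<ge> 1 \<Longrightarrow> P s t a b \<ge> \<kappa>"
    \<comment> \<open>(3)\<close>
    and f_pos: "\<And>z a b \<epsilon>. a \<in> {0, 1} \<Longrightarrow> b \<in> {0, 1} \<Longrightarrow> 0 < f (\<phi> z (\<theta> a \<epsilon>)) (\<theta> b \<epsilon>)"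
    and f_cont: "\<And>z a b. a \<in> {0, 1} \<Longrightarrow> b \<in> {0, 1} \<Longrightarrow>
                   continuous_on UNIV (\<lambda>\<epsilon>. f (\<phi> z (\<theta> a \<epsilon>)) (\<theta> b \<epsilon>))"
    \<comment> \<open>(4)\<close>
    and q: "q \<ge> 2"
    and f_Cq: "\<And>z a b. a \<in> {0, 1} \<Longrightarrow> b \<in> {0, 1} \<Longrightarrow>
                 C_class q UNIV (\<lambda>\<epsilon>. f (\<phi> z (\<theta> a \<epsilon>)) (\<theta> b \<epsilon>))"
    and f_derivs_cont: "\<And>a b j. a \<in> {0, 1} \<Longrightarrow> b \<in> {0, 1} \<Longrightarrow> j \<le> q \<Longrightarrow>
          continuous_on UNIV (\<lambda>(z, \<epsilon>). (deriv ^^ j) (\<lambda>e. f (\<phi> z (\<theta> a e)) (\<theta> b e)) \<epsilon>)"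
    and moments: "\<And>\<rho>. \<rho> > 0 \<Longrightarrow>
          integrable M (\<lambda>\<omega>. M_sup f \<phi> \<theta> q (Z 0 \<omega>) \<rho> ^ (q\<^sup>2 * (q + 1) div 2))"
    \<comment> \<open>(5); the positivity of \<open>f\<close> is what makes \<open>\<lambda> = ln f\<close> a real function\<close>
    and lambda_real: "\<And>x \<tau>. \<tau> \<in> \<Theta> \<Longrightarrow> 0 < f x \<tau>"
    and lambda_C2: "C_class 2 (UNIV \<times> \<Theta>) (\<lambda>(x, \<tau>). ln (f x \<tau>))"
    and phi_C2: "\<And>z. C_class 2 \<Theta> (\<phi> z)"
    and E_partials: "\<And>t. partials_exist 2 (\<Theta> \<times> \<Theta>)
          (\<lambda>(v, \<tau>). prob_space.expectation M (\<lambda>\<omega>. ln (f (\<phi> (Z t \<omega>) v) \<tau>)))"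
    and interchange_int: "\<And>t \<nu> p. p \<in> \<Theta> \<times> \<Theta> \<Longrightarrow> set \<nu> \<subseteq> Basis \<Longrightarrow> length \<nu> \<le> 2 \<Longrightarrow>
          integrable M (\<lambda>\<omega>. partial_derivs \<nu> (\<lambda>(v, \<tau>). ln (f (\<phi> (Z t \<omega>) v) \<tau>)) p)"
    and interchange: "\<And>t \<nu> p. p \<in> \<Theta> \<times> \<Theta> \<Longrightarrow> set \<nu> \<subseteq> Basis \<Longrightarrow> length \<nu> \<le> 2 \<Longrightarrow>
          prob_space.expectation M (\<lambda>\<omega>. partial_derivs \<nu> (\<lambda>(v, \<tau>). ln (f (\<phi> (Z t \<omega>) v) \<tau>)) p)
          = partial_derivs \<nu> (\<lambda>(v, \<tau>). prob_space.expectation M (\<lambda>\<omega>. ln (f (\<phi> (Z t \<omega>) v) \<tau>))) p"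
    \<comment> \<open>(6)\<close>
    and theta_C2: "\<And>a. a \<in> {0, 1} \<Longrightarrow> C_class 2 UNIV (\<theta> a)"
  shows
    \<comment> \<open>the limit defining \<open>r\<close>, the derivatives \<open>r'(0)\<close>, \<open>r''(0)\<close> and the series are well defined\<close>
    "(AE \<omega> in M. (\<forall>\<epsilon>. convergent (log_ratio M f \<phi> \<theta> \<eta> Z \<epsilon> \<omega>)) \<and>
        (\<forall>\<^sub>F \<epsilon> in nhds 0. (\<lambda>e. r e \<omega>) differentiable (at \<epsilon>)) \<and>
        deriv (\<lambda>e. r e \<omega>) differentiable (at 0) \<and>
        summable (\<lambda>n. let t = int (Suc n) in D 0 t * (2 * real (\<eta> t \<omega>) - P 0 t 1 1 - P 0 t 0 1))) \<and>
     has_cond_exp M F (\<lambda>\<omega>. deriv (\<lambda>e. r e \<omega>) 0) (\<lambda>\<omega>. 0) \<and>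
     has_cond_exp M F (\<lambda>\<omega>. deriv (deriv (\<lambda>e. r e \<omega>)) 0)
       (\<lambda>\<omega>. prob_space.variance M (\<lambda>\<omega>. deriv (\<lambda>e. d 0 e \<omega>) 0) *
         (\<Sum>n. let t = int (Suc n) in D 0 t * (2 * real (\<eta> t \<omega>) - P 0 t 1 1 - P 0 t 0 1))) \<and>
     (\<forall>t. integrable M (\<lambda>\<omega>. deriv (\<lambda>e. d t e \<omega>) 0) \<and>
          integrable M (\<lambda>\<omega>. (deriv (\<lambda>e. d t e \<omega>) 0)\<^sup>2) \<and>
          prob_space.expectation M (\<lambda>\<omega>. deriv (\<lambda>e. d t e \<omega>) 0) = 0 \<and>
          prob_space.variance M (\<lambda>\<omega>. deriv (\<lambda>e. d t e \<omega>) 0)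
            = (deriv (\<theta> 1) 0 - deriv (\<theta> 0) 0)\<^sup>2 * fisher_info f 0)"
proof -
  interpret prob_space M by (rule M)
  interpret switching_model M \<eta> \<kappa> Z \<Theta> \<phi> \<theta> f q
    by unfold_locales (fact eta_rv markov kappa mixing[unfolded P_def] Z_rv Theta theta_range theta_zero indep[unfolded F_def]
      Z_indep Z_ident density q f_Cq f_derivs_cont moments lambda_real lambda_C2 phi_C2 theta_C2)+
  have summand_eq: "(\<lambda>n. let t = int (Suc n) in D 0 t * (2 * real (\<eta> t \<omega>) - P 0 t 1 1 - P 0 t 0 1)) = (\<lambda>n. summand n \<omega>)" for \<omega>
    by (rule ext) (simp add: Let_def summand_def trans_sum_def D_def P_def algebra_simps)
  have d1: "deriv (\<lambda>e. d t e \<omega>) 0 = X t \<omega>" if "\<omega> \<in> space M" for t \<omega>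
    unfolding d_def by (rule log_lr_deriv[OF that])
  have E1: "expectation (\<lambda>\<omega>. deriv (\<lambda>e. d t e \<omega>) 0) = 0" for t
    using llr_moments(1)[of t] by (simp add: d1 cong: Bochner_Integration.integral_cong)
  have var: "variance (\<lambda>\<omega>. deriv (\<lambda>e. d t e \<omega>) 0) = expectation (\<lambda>\<omega>. (X t \<omega>)\<^sup>2)" for t
    unfolding E1 by (simp add: d1 cong: Bochner_Integration.integral_cong)
  have int: "integrable M (\<lambda>\<omega>. deriv (\<lambda>e. d t e \<omega>) 0)" "integrable M (\<lambda>\<omega>. (deriv (\<lambda>e. d t e \<omega>) 0)\<^sup>2)" for t
    using llr_integrable(1,2)[OF states(2), of t] by (simp_all add: d1 cong: Bochner_Integration.integrable_cong)
  have "AE \<omega> in M. (\<forall>\<epsilon>. convergent (log_ratio M f \<phi> \<theta> \<eta> Z \<epsilon> \<omega>)) \<and>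
        (\<forall>\<^sub>F \<epsilon> in nhds 0. (\<lambda>e. r e \<omega>) differentiable (at \<epsilon>)) \<and>
        deriv (\<lambda>e. r e \<omega>) differentiable (at 0) \<and> summable (\<lambda>n. summand n \<omega>)"
    using AE_regular
  proof eventually_elim
    case (elim \<omega>)
    then have \<omega>: "\<omega> \<in> space M" "summable (\<lambda>m. \<Delta> m \<omega>)" by blast+
    have "convergent (log_ratio M f \<phi> \<theta> \<eta> Z \<epsilon> \<omega>)" for \<epsilon>
      unfolding log_ratio_eq[abs_def] by (rule filter.rho_convergent)
    then show ?case unfolding r_def using r_derivs_zero(1,2)[OF \<omega>] summand_summable[OF \<omega>(1)] by blast
  qed
  moreover have "has_cond_exp M F (\<lambda>\<omega>. deriv (\<lambda>e. r e \<omega>) 0) (\<lambda>\<omega>. 0)"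
    unfolding r_def F_def by (rule first_derivative_cond_exp)
  moreover have "has_cond_exp M F (\<lambda>\<omega>. deriv (deriv (\<lambda>e. r e \<omega>)) 0)
      (\<lambda>\<omega>. variance (\<lambda>\<omega>. deriv (\<lambda>e. d 0 e \<omega>) 0) * (\<Sum>n. summand n \<omega>))"
    unfolding var V_def[symmetric] unfolding r_def F_def by (rule second_derivative_cond_exp)
  ultimately show ?thesis
    unfolding summand_eq using int E1 var llr1_sq_expectation by simp
qed

end
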